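(* Let $(\beta_p)_{p\ge 2}$ be real numbers with $\sum_{p\ge2}2^p\beta_p^2<\infty$, and let $\xi(u)=\sum_{p\ge 2}\beta_p^2u^p$. Let $\mu_P$ be a Parisi measure for $\xi$, i.e. a minimizer over $M[0,1]$ of the Parisi functional $\mathcal P$. Then: (i) $0\in\operatorname{supp}\mu_P$. (ii) If $\xi''(0)<1$, then $\mu_P([0,\hat q))=\mu_P(\{0\})$, where $\hat q\in[0,1]$ satisfies $\xi''(\hat q)=1$.
   Context: $M[0,1]$ is the set of Borel probability measures on $[0,1]$ with the metric $d(\mu,\mu')=\int_0^1|\mu([0,u])-\mu'([0,u])|\,du$; $M_d[0,1]\subset M[0,1]$ is the subset of measures consisting of a finite number of atoms. Parisi PDE solution. For $\mu\in M_d[0,1]$ with atoms $0\le q_1<\dots<q_{k+1}\le 1$ ($k\ge0$), put $m_p=\mu([0,q_p])$ for $1\le p\le k+1$, $m_0=0$, $q_0=0$, $q_{k+2}=1$. Define $\Phi_\mu:\mathbb R\times[0,1]\to\mathbb R$ by $\Phi_\mu(x,u)=\log\cosh x+\frac12(\xi'(1)-\xi'(u))$ for $q_{k+1}\le u\le1$ and recursively, for $p=k,k-1,\dots,0$ and $q_p\le u<q_{p+1}$, $$\Phi_\mu(x,u)=\frac1{m_p}\log\mathbb E\exp m_p\Phi_\mu\big(x+z\sqrt{\xi'(q_{p+1})-\xi'(u)},\,q_{p+1}\big),$$ $z$ a standard Gaussian, where for $m_p=0$ the right side means $\mathbb E\,\Phi_\mu(x+z\sqrt{\xi'(q_{p+1})-\xi'(u)},q_{p+1})$.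 (This solves $\partial_u\Phi_\mu=-\frac{\xi''(u)}2(\partial_x^2\Phi_\mu+\mu([0,u])(\partial_x\Phi_\mu)^2)$ with $\Phi_\mu(x,1)=\log\cosh x$.) The map $\mu\mapsto\Phi_\mu$ is known to be Lipschitz from $(M_d[0,1],d)$ to $C(\mathbb R\times[0,1])$ with the uniform distance, and $\Phi_\mu$ for general $\mu\in M[0,1]$ is defined by continuous extension. Parisi functional: $\mathcal P(\mu)=\Phi_\mu(0,0)-\frac12\int_0^1u\,\xi''(u)\,\mu([0,u])\,du$ for $\mu\in M[0,1]$. A Parisi measure is any minimizer of $\mathcal P$ on $M[0,1]$.
   Formalization: It is assumed in addition that some β_p with p ≥ 2 is nonzero: for ξ = 0 the functional 𝒫 vanishes identically, so every measure (e.g. the point mass at 1) is a Parisi measure and (i) fails. *)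

theory Defs
  imports "HOL-Probability.Probability"
begin

(* The series starts at p = 2; the values of \<beta> at 0 and 1 are never used. *)
definition mixture :: "(nat \<Rightarrow> real) \<Rightarrow> real \<Rightarrow> real" where
  "mixture \<beta> u = (\<Sum>p. (\<beta> (p + 2))\<^sup>2 * u ^ (p + 2))"

definition unit_measures :: "real measure set" where
  "unit_measures = {\<mu>. prob_space \<mu> \<and> sets \<mu> = sets (restrict_space borel {0..1})}"

definition discrete_unit_measures :: "real measure set" where
  "discrete_unit_measures =
    {\<mu> \<in> unit_measures. \<exists>A. finite A \<and> A \<subseteq> {0..1} \<and> measure \<mu> A = 1}"

definition cdf_dist :: "real measure \<Rightarrow> real measure \<Rightarrow> real" where
  "cdf_dist \<mu> \<nu> = (LINT u:{0..1}|lborel. \<bar>measure \<mu> {0..u} - measure \<nu> {0..u}\<bar>)"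

definition measure_support :: "real measure \<Rightarrow> real set" where
  "measure_support \<mu> =
    {x \<in> space \<mu>. \<forall>U. open U \<longrightarrow> x \<in> U \<longrightarrow> measure \<mu> (U \<inter> space \<mu>) > 0}"

definition atoms :: "real measure \<Rightarrow> real set" where
  "atoms \<mu> = {q \<in> space \<mu>. measure \<mu> {q} > 0}"

(* (1/m) log E exp (m f(x + z sqrt v)) for standard Gaussian z, read as E f(x + z sqrt v)
   when m = 0. *)
definition gauss_step :: "real \<Rightarrow> real \<Rightarrow> (real \<Rightarrow> real) \<Rightarrow> real \<Rightarrow> real" where
  "gauss_step m v f x =
    (if m = 0 then (\<integral>z. f (x + z * sqrt v) \<partial>std_normal_distribution)
     else 1 / m * ln (\<integral>z. exp (m * f (x + z * sqrt v)) \<partial>std_normal_distribution))"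

(* The recursion over the atoms q_1 < ... < q_(k+1). In the call with list [q_(p+1), ..., q_(k+1)]
   the second argument is m_p, and u lies in [q_p, 1]. If u < q_(p+1) this is the p-th
   defining equation, whose right-hand side needs the values at level q_(p+1), computed by the
   recursive call; otherwise u belongs to one of the later intervals. The empty list is
   reached exactly when u is at or above the largest atom. *)
primrec parisi_rec ::
  "(real \<Rightarrow> real) \<Rightarrow> real measure \<Rightarrow> real list \<Rightarrow> real \<Rightarrow> real \<Rightarrow> real \<Rightarrow> real" where
  "parisi_rec \<xi> \<mu> [] m x u = ln (cosh x) + (deriv \<xi> 1 - deriv \<xi> u) / 2"
| "parisi_rec \<xi> \<mu> (q # qs) m x u =
    (if u < q
     then gauss_step m (deriv \<xi> q - deriv \<xi> u) (\<lambda>y. parisi_rec \<xi> \<mu> qs (measure \<mu> {0..q}) y q) x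
     else parisi_rec \<xi> \<mu> qs (measure \<mu> {0..q}) x u)"

(* The initial mass is m_0 = 0. *)
definition parisi_solution_discrete ::
  "(real \<Rightarrow> real) \<Rightarrow> real measure \<Rightarrow> real \<times> real \<Rightarrow> real" where
  "parisi_solution_discrete \<xi> \<mu> =
    (\<lambda>(x, u). parisi_rec \<xi> \<mu> (sorted_list_of_set (atoms \<mu>)) 0 x u)"

definition discrete_approx :: "real measure \<Rightarrow> real measure filter" where
  "discrete_approx \<mu> = (INF e\<in>{0<..}. principal {\<nu> \<in> discrete_unit_measures. cdf_dist \<nu> \<mu> < e})"

(* Continuous extension from the discrete measures: the uniform limit on R x [0,1] as discrete
   measures approach \<mu> with respect to cdf_dist. The limit is determined on R x [0,1] only; values
   outside are arbitrary. The filter does not exclude \<mu> itself, so for a discrete \<mu> the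
   limit is the function given by the recursion. *)
definition parisi_solution :: "(real \<Rightarrow> real) \<Rightarrow> real measure \<Rightarrow> real \<times> real \<Rightarrow> real" where
  "parisi_solution \<xi> \<mu> =
    (SOME \<Phi>. uniform_limit (UNIV \<times> {0..1}) (parisi_solution_discrete \<xi>) \<Phi> (discrete_approx \<mu>))"

definition parisi_functional :: "(real \<Rightarrow> real) \<Rightarrow> real measure \<Rightarrow> real" where
  "parisi_functional \<xi> \<mu> =
    parisi_solution \<xi> \<mu> (0, 0)
      - 1 / 2 * (LINT u:{0..1}|lborel. u * deriv (deriv \<xi>) u * measure \<mu> {0..u})"

definition parisi_measure :: "(real \<Rightarrow> real) \<Rightarrow> real measure \<Rightarrow> bool" where
  "parisi_measure \<xi> \<mu> \<longleftrightarrow> is_arg_min (parisi_functional \<xi>) (\<lambda>\<nu>. \<nu> \<in> unit_measures) \<mu>"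

end

theory Submission
  imports Defs
begin

text \<open>
  Let \<open>T m h F\<close> denote one step of the recursion. Everything rests on comparing the recursions for two
  step functions \<open>m \<le> m'\<close> without a PDE. By a Gaussian shift and Jensen's inequality,
  \<open>T m h F x\<close> is at least \<open>E F (x + m v h + z sqrt h) - m v\<^sup>2 h / 2\<close> for every \<open>v\<close>, with equality up to
  \<open>O(h\<^sup>2)\<close> when \<open>v\<close> is the derivative of \<open>T m h F\<close> at \<open>x\<close>. Short steps, summed with the semigroup
  property, give the derivative inequality
  \<open>\<Phi>' - \<Phi> \<le> (1/2) \<integral> \<xi>''(u) (m' - m)(u) E v(u)\<^sup>2 du\<close>, where \<open>v(u)\<close> is a martingale built from
  the space derivative of \<open>\<Phi>'\<close> and its variance grows at most like \<open>\<xi>'(u)\<close>.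

  For (ii), \<open>E v(u)\<^sup>2 \<le> \<xi>'(u) < u\<close> below \<open>\<xi>'' = 1\<close>, so moving all mass of \<open>[0, q)\<close> to \<open>0\<close> strictly
  decreases the functional unless it sits there already.

  For (i), let \<open>c > 0\<close> be the least point of the support, \<open>F = \<Phi>(., c)\<close>, \<open>t = \<xi>'(c)\<close>, and let \<open>X\<close> be
  centred Gaussian with variance \<open>t\<close>. On \<open>[0, c]\<close> the recursion is the heat semigroup. Moving a little mass
  from near \<open>c\<close> to \<open>0\<close> shows \<open>Var F(X) \<ge> c t / 2\<close>, while the Poincare inequality for even functions, which
  gains a factor \<open>1/2\<close>, gives \<open>Var F(X) < (t / 2) E F'(X)\<^sup>2\<close>; hence \<open>c < E F'(X)\<^sup>2\<close>. Moving the mass near \<open>c\<close>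
  to the right shows \<open>E F'(X)\<^sup>2 \<le> c\<close>, a contradiction.
\<close>

section \<open>Gaussian expectations\<close>

text \<open>Minimality is used only against upper bounds for the functional at a competitor, so
  one-sided comparisons suffice. The coefficient of \<open>m' - m\<close> in the comparison involves
  the slope of the solution for \<open>m'\<close>, the competitor. At \<open>x = 0\<close> and time
  0 that slope vanishes by evenness; for \<open>m' >= m\<close> the whole bound then comes from the
  growth of the variance, and this is where \<xi>'(u) enters. For \<open>m' <= m\<close> the
  variance is only bounded below by 0, so the slope at the later time c carries the estimate and has
  to be compared with the slope of the old solution afterwards. In (i) the bound by \<xi>' is too
  crude for the mass moved to 0, since \<xi>'(u) may exceed u there. Only a small proportion e of
  the mass is moved, and the single step over [0, c] is expanded in its small parameter, which
  yields the variance of F(X) itself. Strict inequalities are lost when step functions approximate a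
  general measure. Strictness is therefore always taken from a fixed object after the limit: the gap
  between s and \<xi>'(s) on a fixed interval, or the Poincare inequality for the fixed function
  F.\<close>

abbreviation gexp :: "(real \<Rightarrow> real) \<Rightarrow> real" where
  "gexp f \<equiv> integral\<^sup>L std_normal_distribution f"

lemma prob_space_std_normal: "prob_space std_normal_distribution"
  by (rule prob_space_normal_density) simp

lemma measure_std_normal_UNIV [simp]: "measure std_normal_distribution UNIV = 1"
  using prob_space.prob_space[OF prob_space_std_normal] by simp

lemma integrable_exp_mult_gauss: "integrable std_normal_distribution (\<lambda>z. exp (c * z))"
proof -
  have "std_normal_density z * exp (c * z) = exp (c\<^sup>2 / 2) * normal_density c 1 z" for z
  proof -
    have "- z\<^sup>2 / 2 + c * z = c\<^sup>2 / 2 + - (z - c)\<^sup>2 / 2"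
      by (simp add: power2_eq_square field_simps)
    then have "exp (- z\<^sup>2 / 2) * exp (c * z) = exp (c\<^sup>2 / 2) * exp (- (z - c)\<^sup>2 / 2)"
      by (metis exp_add)
    then show ?thesis by (simp add: normal_density_def)
  qed
  then show ?thesis
    by (subst integrable_density) auto
qed

lemma integrable_exp_abs_gauss: "integrable std_normal_distribution (\<lambda>z. exp (c * \<bar>z\<bar>))"
proof (rule Bochner_Integration.integrable_bound)
  show "integrable std_normal_distribution (\<lambda>z. exp (c * z) + exp (- c * z))"
    by (intro Bochner_Integration.integrable_add integrable_exp_mult_gauss)
  show "AE z in std_normal_distribution. norm (exp (c * \<bar>z\<bar>)) \<le> norm (exp (c * z) + exp (- c * z))"
  proof (rule AE_I2)
    fix z :: real
    show "norm (exp (c * \<bar>z\<bar>)) \<le> norm (exp (c * z) + exp (- c * z))"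
      by (cases "0 \<le> z") auto
  qed
qed simp

lemma integrable_gaussI:
  assumes "f \<in> borel_measurable borel" and "\<And>z. \<bar>f z\<bar> \<le> C * exp (c * \<bar>z\<bar>)"
  shows "integrable std_normal_distribution f"
proof (rule Bochner_Integration.integrable_bound)
  show "integrable std_normal_distribution (\<lambda>z. C * exp (c * \<bar>z\<bar>))"
    by (intro integrable_mult_right integrable_exp_abs_gauss)
  show "AE z in std_normal_distribution. norm (f z) \<le> norm (C * exp (c * \<bar>z\<bar>))"
    using assms(2) by (intro AE_I2) (metis abs_ge_self order_trans real_norm_def)
qed (use assms(1) in simp)

lemma gexp_mono:
  assumes "integrable std_normal_distribution f" "integrable std_normal_distribution g"
    "\<And>z. f z \<le> g z"
  shows "gexp f \<le> gexp g"
  using assms by (intro integral_mono) auto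

text \<open>Cameron-Martin formula in dimension one: the exponential factor is the ratio of the
  normal density at \<open>z + s\<close> to that at \<open>z\<close>. Every change of drift below
  goes through it.\<close>

lemma gexp_shift:
  assumes [measurable]: "g \<in> borel_measurable borel"
  shows "gexp (\<lambda>z. g (z + s) * exp (- s * z - s\<^sup>2 / 2)) = gexp g"
proof -
  have "std_normal_density z * exp (- s * z - s\<^sup>2 / 2) = std_normal_density (z + s)" for z
  proof -
    have "- z\<^sup>2 / 2 + (- s * z - s\<^sup>2 / 2) = - (z + s)\<^sup>2 / 2"
      by (simp add: power2_eq_square field_simps)
    then show ?thesis
      by (simp add: std_normal_density_def flip: exp_add)
  qed
  then have "gexp (\<lambda>z. g (z + s) * exp (- s * z - s\<^sup>2 / 2))
      = (\<integral>z. std_normal_density (z + s) * g (z + s) \<partial>lborel)"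
    by (subst integral_density) (auto intro!: Bochner_Integration.integral_cong simp: mult.left_commute mult.commute)
  also have "\<dots> = (\<integral>z. std_normal_density z * g z \<partial>lborel)"
    by (subst (2) lborel_integral_real_affine[of 1 _ s]) (auto simp: add_ac)
  also have "\<dots> = gexp g"
    by (subst integral_density) auto
  finally show ?thesis .
qed

lemma gexp_uminus:
  assumes [measurable]: "g \<in> borel_measurable borel"
  shows "gexp (\<lambda>z. g (- z)) = gexp g"
proof -
  have "gexp g = (\<integral>z. std_normal_density z * g z \<partial>lborel)"
    by (subst integral_density) auto
  also have "\<dots> = (\<integral>z. std_normal_density z * g (- z) \<partial>lborel)"
    by (subst lborel_integral_real_affine[of "-1" _ 0]) (auto simp: std_normal_density_def)
  also have "\<dots> = gexp (\<lambda>z. g (- z))"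
    by (subst integral_density) auto
  finally show ?thesis by simp
qed

lemma distr_std_normal_scale:
  assumes "0 < \<sigma>"
  shows "distr std_normal_distribution borel (\<lambda>z. z * \<sigma>) = density lborel (normal_density 0 \<sigma>)"
proof -
  interpret prob_space std_normal_distribution by (rule prob_space_std_normal)
  have "distributed std_normal_distribution lborel (\<lambda>z. z) (\<lambda>z. ennreal (normal_density 0 1 z))"
    unfolding distributed_def by (auto intro!: distr_id2 measurable_ident_sets)
  from normal_density_affine[OF this, of \<sigma> 0] assms
  have "distributed std_normal_distribution lborel (\<lambda>z. \<sigma> * z) (\<lambda>z. ennreal (normal_density 0 \<sigma> z))"
    by simp
  then have "distr std_normal_distribution lborel (\<lambda>z. \<sigma> * z) = density lborel (normal_density 0 \<sigma>)"
    by (simp add: distributed_def)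
  then show ?thesis
    by (metis (no_types, lifting) distr_cong mult.commute sets_lborel)
qed

text \<open>Convolution of centred normal densities followed by Fubini; the exponential growth bound
  only secures integrability. The semigroup property of the recursion step rests on this.\<close>

lemma gexp_add:
  assumes "0 \<le> h" "0 \<le> k" and meas[measurable]: "f \<in> borel_measurable borel"
    and bound: "\<And>z. \<bar>f z\<bar> \<le> C * exp (c * \<bar>z\<bar>)" and "0 \<le> C" "0 \<le> c"
  shows "gexp (\<lambda>w. gexp (\<lambda>z. f (w * sqrt h + z * sqrt k))) = gexp (\<lambda>z. f (z * sqrt (h + k)))"
proof (cases "h = 0 \<or> k = 0")
  \<comment> \<open>Zero variances are treated apart because \<open>normal_density\<close> is a
    probability density only for a positive deviation.\<close>
  case True
  then show ?thesis by auto
next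
  case False
  then have pos: "0 < h" "0 < k" using assms by auto
  let ?N = "std_normal_distribution"
  let ?A = "distr ?N borel (\<lambda>z. z * sqrt h)" and ?B = "distr ?N borel (\<lambda>z. z * sqrt k)"
  interpret prob_space ?N by (rule prob_space_std_normal)
  interpret A: prob_space ?A by (rule prob_space_distr) simp
  interpret B: prob_space ?B by (rule prob_space_distr) simp
  interpret AB: pair_prob_space ?A ?B ..
  have fin: "finite_measure (density lborel (\<lambda>x. ennreal (normal_density 0 (sqrt h) x)))" 
      "finite_measure (density lborel (\<lambda>x. ennreal (normal_density 0 (sqrt k) x)))"
    using prob_space_normal_density[of "sqrt h" 0] prob_space_normal_density[of "sqrt k" 0] pos
    by (auto simp: prob_space_def)
  have "convolution ?A ?B = convolution (density lborel (normal_density 0 (sqrt h))) (density lborel (normal_density 0 (sqrt k)))"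
    using pos by (simp add: distr_std_normal_scale)
  also have "\<dots> = density lborel (\<lambda>x. \<integral>\<^sup>+y. ennreal (normal_density 0 (sqrt h) (x - y)) * 
      ennreal (normal_density 0 (sqrt k) y) \<partial>lborel)"
    by (rule convolution_density) (use fin in auto)
  also have "\<dots> = density lborel (\<lambda>x. \<integral>\<^sup>+y. ennreal (normal_density 0 (sqrt h) (x - y) * 
      normal_density 0 (sqrt k) y) \<partial>lborel)"
    by (simp add: ennreal_mult)
  also have "\<dots> = density lborel (normal_density 0 (sqrt (h + k)))"
    using pos by (simp add: conv_normal_density_zero_mean)
  also have "\<dots> = distr ?N borel (\<lambda>z. z * sqrt (h + k))"
    using pos by (simp add: distr_std_normal_scale)
  finally have eq: "distr (?A \<Otimes>\<^sub>M ?B) borel (\<lambda>(x, y). x + y) = distr ?N borel (\<lambda>z. z * sqrt (h + k))"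
    by (simp add: convolution_def)
  have int: "integrable ?N (\<lambda>z. f (z * sqrt (h + k)))"
    by (rule integrable_gaussI[where C=C and c="c * sqrt (h + k)"]) 
      (use pos bound[of "_ * sqrt (h + k)"] in \<open>auto simp: abs_mult mult_ac\<close>)
  have "integrable (distr ?N borel (\<lambda>z. z * sqrt (h + k))) f"
    using int by (subst integrable_distr_eq) auto
  then have "integrable (distr (?A \<Otimes>\<^sub>M ?B) borel (\<lambda>(x, y). x + y)) f"
    by (simp add: eq)
  then have int2: "integrable (?A \<Otimes>\<^sub>M ?B) (\<lambda>(x, y). f (x + y))"
    by (subst (asm) integrable_distr_eq) (auto simp: case_prod_beta')
  have "gexp (\<lambda>z. f (z * sqrt (h + k))) = integral\<^sup>L (distr ?N borel (\<lambda>z. z * sqrt (h + k))) f"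
    by (subst integral_distr) auto
  also have "\<dots> = integral\<^sup>L (distr (?A \<Otimes>\<^sub>M ?B) borel (\<lambda>(x, y). x + y)) f"
    by (simp add: eq)
  also have "\<dots> = integral\<^sup>L (?A \<Otimes>\<^sub>M ?B) (\<lambda>(x, y). f (x + y))"
    by (subst integral_distr) (auto simp: case_prod_beta')
  also have "\<dots> = (\<integral>x. (\<integral>y. f (x + y) \<partial>?B) \<partial>?A)"
    using AB.integral_fst'[OF int2] by simp
  also have "\<dots> = (\<integral>x. gexp (\<lambda>z. f (x + z * sqrt k)) \<partial>?A)"
    by (intro Bochner_Integration.integral_cong refl integral_distr) auto
  also have "\<dots> = gexp (\<lambda>w. gexp (\<lambda>z. f (w * sqrt h + z * sqrt k)))"
    by (subst integral_distr) auto
  finally show ?thesis by simp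
qed

lemma gexp_Jensen_exp:
  assumes "integrable std_normal_distribution X" "integrable std_normal_distribution (\<lambda>z. exp (X z))"
  shows "exp (gexp X) \<le> gexp (\<lambda>z. exp (X z))"
proof -
  interpret prob_space std_normal_distribution by (rule prob_space_std_normal)
  let ?c = "gexp X"
  have "exp ?c = gexp (\<lambda>z. exp ?c * (1 + (X z - ?c)))"
    using assms prob_space by (simp add: integrable_const)
  also have "\<dots> \<le> gexp (\<lambda>z. exp (X z))"
  proof (rule gexp_mono)
    fix z
    have "exp ?c * (1 + (X z - ?c)) \<le> exp ?c * exp (X z - ?c)"
      by (intro mult_left_mono exp_ge_add_one_self) auto
    then show "exp ?c * (1 + (X z - ?c)) \<le> exp (X z)"
      by (simp flip: exp_add)
  qed (use assms in auto)
  finally show ?thesis .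
qed

lemma gexp_pos:
  assumes "integrable std_normal_distribution f" "\<And>z. 0 < f z"
  shows "0 < gexp f"
proof -
  interpret prob_space std_normal_distribution by (rule prob_space_std_normal)
  have "gexp f \<noteq> 0"
  proof
    assume "gexp f = 0"
    then have "AE z in std_normal_distribution. f z = 0"
      using assms by (subst (asm) integral_nonneg_eq_0_iff_AE) (auto simp: less_imp_le)
    then have "AE z in std_normal_distribution. False"
      by eventually_elim (use assms(2) in \<open>metis less_irrefl\<close>)
    then show False by simp
  qed
  moreover have "0 \<le> gexp f"
    using assms(2) by (intro integral_nonneg_AE) (auto simp: less_imp_le)
  ultimately show ?thesis by simp
qed

section \<open>A class of functions preserved by the recursion step\<close>

text \<open>The last condition is \<open>F'' + F'\<^sup>2 \<le> 1\<close> in integrated form, saying that \<open>u'' \<le> u\<close> for \<open>u = exp F\<close>.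
  Stated this way it passes through the recursion step and to pointwise limits.\<close>

definition parisi_class :: "(real \<Rightarrow> real) set" where
  "parisi_class = {F. (\<forall>x. F (- x) = F x) \<and> (\<forall>x y. \<bar>F x - F y\<bar> \<le> \<bar>x - y\<bar>) \<and> convex_on UNIV F
      \<and> (\<forall>x s. exp (F (x + s)) + exp (F (x - s)) \<le> 2 * cosh s * exp (F x))}"

text \<open>Kept apart from \<open>parisi_class\<close> because derivatives of functions in the
  class have this property too, so the integrability and variance lemmas serve both.\<close>

definition nonexpansive :: "(real \<Rightarrow> real) \<Rightarrow> bool" where
  "nonexpansive F \<longleftrightarrow> (\<forall>x y. \<bar>F x - F y\<bar> \<le> \<bar>x - y\<bar>)"

lemma class_even: "F \<in> parisi_class \<Longrightarrow> F (- x) = F x"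
  by (simp add: parisi_class_def)

lemma class_nonexpansive: "F \<in> parisi_class \<Longrightarrow> nonexpansive F"
  by (simp add: parisi_class_def nonexpansive_def)

lemma class_convex: "F \<in> parisi_class \<Longrightarrow> convex_on UNIV F"
  by (simp add: parisi_class_def)

lemma class_hyperbolic:
  "F \<in> parisi_class \<Longrightarrow> exp (F (x + s)) + exp (F (x - s)) \<le> 2 * cosh s * exp (F x)"
  by (simp add: parisi_class_def)

lemma nonexpansiveD: "nonexpansive F \<Longrightarrow> \<bar>F x - F y\<bar> \<le> \<bar>x - y\<bar>"
  by (simp add: nonexpansive_def)

lemma nonexpansive_continuous: 
  assumes "nonexpansive F" shows "continuous_on UNIV F"
proof -
  have "1-lipschitz_on UNIV F"
    using assms by (intro lipschitz_onI) (auto simp: nonexpansive_def dist_real_def)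
  then show ?thesis by (rule lipschitz_on_continuous_on)
qed

lemma nonexpansive_measurable: "nonexpansive F \<Longrightarrow> F \<in> borel_measurable borel"
  using nonexpansive_continuous borel_measurable_continuous_onI by blast

lemma abs_le_exp_abs: "\<bar>z\<bar> \<le> exp \<bar>z :: real\<bar>"
  using exp_ge_add_one_self[of "\<bar>z\<bar>"] by linarith

lemma nonexpansive_gauss_bound:
  assumes "nonexpansive F" "0 \<le> h"
  shows "\<bar>F (x + z * sqrt h) - F x\<bar> \<le> sqrt h * \<bar>z\<bar>"
  using nonexpansiveD[OF assms(1), of "x + z * sqrt h" x] assms(2) by (simp add: abs_mult mult.commute)

lemma nonexpansive_integrable:
  assumes F: "nonexpansive F" and h: "0 \<le> h"
  shows "integrable std_normal_distribution (\<lambda>z. F (x + z * sqrt h))"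
proof (rule integrable_gaussI[where C="\<bar>F x\<bar> + sqrt h" and c=1])
  note [measurable] = nonexpansive_measurable[OF F]
  show "(\<lambda>z. F (x + z * sqrt h)) \<in> borel_measurable borel" by measurable
  fix z
  have "\<bar>F (x + z * sqrt h)\<bar> \<le> \<bar>F x\<bar> * 1 + sqrt h * \<bar>z\<bar>"
    using nonexpansive_gauss_bound[OF F h, of x z] by linarith
  also have "\<dots> \<le> \<bar>F x\<bar> * exp \<bar>z\<bar> + sqrt h * exp \<bar>z\<bar>"
    using h by (intro add_mono mult_left_mono abs_le_exp_abs) auto
  finally show "\<bar>F (x + z * sqrt h)\<bar> \<le> (\<bar>F x\<bar> + sqrt h) * exp (1 * \<bar>z\<bar>)"
    by (simp add: algebra_simps)
qed

lemma nonexpansive_integrable_exp: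
  assumes F: "nonexpansive F" and h: "0 \<le> h"
  shows "integrable std_normal_distribution (\<lambda>z. exp (m * F (x + z * sqrt h)))"
proof (rule integrable_gaussI[where C="exp (m * F x)" and c="\<bar>m\<bar> * sqrt h"])
  note [measurable] = nonexpansive_measurable[OF F]
  show "(\<lambda>z. exp (m * F (x + z * sqrt h))) \<in> borel_measurable borel" by measurable
  fix z
  have "m * (F (x + z * sqrt h) - F x) \<le> \<bar>m\<bar> * (sqrt h * \<bar>z\<bar>)"
    using nonexpansive_gauss_bound[OF F h, of x z] 
    by (metis abs_ge_self abs_ge_zero abs_mult mult_left_mono order_trans)
  then have "m * F (x + z * sqrt h) \<le> m * F x + \<bar>m\<bar> * sqrt h * \<bar>z\<bar>"
    by (simp add: algebra_simps)
  then show "\<bar>exp (m * F (x + z * sqrt h))\<bar> \<le> exp (m * F x) * exp (\<bar>m\<bar> * sqrt h * \<bar>z\<bar>)"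
    by (simp flip: exp_add)
qed

lemma exp_gauss_step:
  assumes F: "nonexpansive F" and h: "0 \<le> h" and m: "m \<noteq> 0"
  shows "exp (m * gauss_step m h F x) = gexp (\<lambda>z. exp (m * F (x + z * sqrt h)))"
  using gexp_pos[OF nonexpansive_integrable_exp[OF F h, of m x]] m 
  by (simp add: gauss_step_def)

lemma gauss_step_0: "gauss_step 0 h F x = gexp (\<lambda>z. F (x + z * sqrt h))"
  by (simp add: gauss_step_def)

text \<open>Monotonicity and compatibility with additive constants in one statement. Two base points
  \<open>x\<close>, \<open>y\<close> give the Lipschitz bound for the step, equal base points give
  its contraction in the uniform norm.\<close>

lemma gauss_step_le:
  assumes F: "nonexpansive F" and H: "nonexpansive H" and h: "0 \<le> h" and m: "0 \<le> m"
    and le: "\<And>z. F (x + z * sqrt h) \<le> H (y + z * sqrt h) + c"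
  shows "gauss_step m h F x \<le> gauss_step m h H y + c"
proof (cases "m = 0")
  case True
  have "gexp (\<lambda>z. F (x + z * sqrt h)) \<le> gexp (\<lambda>z. H (y + z * sqrt h) + c)"
    by (rule gexp_mono[OF nonexpansive_integrable[OF F h] Bochner_Integration.integrable_add le])
      (auto intro: nonexpansive_integrable H h finite_measure.integrable_const
        prob_space.finite_measure[OF prob_space_std_normal])
  also have "\<dots> = gexp (\<lambda>z. H (y + z * sqrt h)) + c"
    by (subst Bochner_Integration.integral_add) 
      (auto intro: nonexpansive_integrable H h finite_measure.integrable_const
        prob_space.finite_measure[OF prob_space_std_normal])
  finally show ?thesis using True by (simp add: gauss_step_0)
next
  case False
  have "exp (m * gauss_step m h F x) \<le> gexp (\<lambda>z. exp (m * H (y + z * sqrt h)) * exp (m * c))"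
    unfolding exp_gauss_step[OF F h False]
  proof (rule gexp_mono)
    fix z
    have "m * F (x + z * sqrt h) \<le> m * (H (y + z * sqrt h) + c)"
      using le m by (intro mult_left_mono) auto
    then show "exp (m * F (x + z * sqrt h)) \<le> exp (m * H (y + z * sqrt h)) * exp (m * c)"
      by (simp add: algebra_simps flip: exp_add)
  qed (intro integrable_mult_left nonexpansive_integrable_exp F H h)+
  also have "\<dots> = exp (m * gauss_step m h H y) * exp (m * c)"
    by (simp add: exp_gauss_step[OF H h False])
  also have "\<dots> = exp (m * (gauss_step m h H y + c))"
    by (simp add: algebra_simps flip: exp_add)
  finally show ?thesis using m False by simp
qed

lemma gauss_step_nonexpansive:
  assumes F: "nonexpansive F" and h: "0 \<le> h" and m: "0 \<le> m"
  shows "nonexpansive (gauss_step m h F)"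
proof -
  have "gauss_step m h F x \<le> gauss_step m h F y + \<bar>x - y\<bar>" for x y
  proof (rule gauss_step_le[OF F F h m])
    fix z show "F (x + z * sqrt h) \<le> F (y + z * sqrt h) + \<bar>x - y\<bar>"
      using nonexpansiveD[OF F, of "x + z * sqrt h" "y + z * sqrt h"] by simp
  qed
  then show ?thesis unfolding nonexpansive_def 
    by (smt (verit, ccfv_threshold))
qed

lemma gauss_step_contraction:
  assumes "nonexpansive F" "nonexpansive H" "0 \<le> h" "0 \<le> m" "\<And>x. \<bar>F x - H x\<bar> \<le> c"
  shows "\<bar>gauss_step m h F x - gauss_step m h H x\<bar> \<le> c"
proof -
  have "gauss_step m h F x \<le> gauss_step m h H x + c" "gauss_step m h H x \<le> gauss_step m h F x + c"
    by (intro gauss_step_le assms; use assms(5) in \<open>smt (verit, best)\<close>)+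
  then show ?thesis by linarith
qed

lemma convex_exp_le: "0 \<le> u \<Longrightarrow> 0 \<le> v \<Longrightarrow> u + v = 1 \<Longrightarrow> exp (u * x + v * y :: real) \<le> u * exp x + v * exp y"
  using exp_convex[unfolded convex_on_def] by auto

lemma gauss_step_even:
  assumes F: "nonexpansive F" and ev: "\<And>x. F (- x) = F x"
  shows "gauss_step m h F (- x) = gauss_step m h F x"
proof -
  note [measurable] = nonexpansive_measurable[OF F]
  have eq: "F (- x + z * sqrt h) = F (x + - z * sqrt h)" for z
    using ev[of "x + - z * sqrt h"] by simp
  have "gexp (\<lambda>z. F (x + - z * sqrt h)) = gexp (\<lambda>z. F (x + z * sqrt h))"
      "gexp (\<lambda>z. exp (m * F (x + - z * sqrt h))) = gexp (\<lambda>z. exp (m * F (x + z * sqrt h)))"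
    by (rule gexp_uminus[where g="\<lambda>z. F (x + z * sqrt h)"], measurable)
       (rule gexp_uminus[where g="\<lambda>z. exp (m * F (x + z * sqrt h))"], measurable)
  then show ?thesis unfolding gauss_step_def eq by simp
qed

text \<open>Hoelder's inequality for \<open>exp (m * F)\<close>. Subtracting \<open>m * ?P\<close>
  and \<open>m * ?M\<close> in the exponents normalises both Gaussian integrals to 1, after which
  convexity of exp can be applied pointwise.\<close>

lemma gauss_step_convex:
  assumes F: "nonexpansive F" and cv: "convex_on UNIV F" and h: "0 \<le> h" and m: "0 \<le> m"
  shows "convex_on UNIV (gauss_step m h F)"
proof (rule convex_onI)
  fix t x y :: real
  assume t: "0 < t" "t < 1"
  let ?w = "(1 - t) *\<^sub>R x + t *\<^sub>R y"
  have cF: "F (?w + z * sqrt h) \<le> (1 - t) * F (x + z * sqrt h) + t * F (y + z * sqrt h)" for z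
  proof -
    have "?w + z * sqrt h = (1 - t) *\<^sub>R (x + z * sqrt h) + t *\<^sub>R (y + z * sqrt h)"
      by (simp add: algebra_simps)
    then show ?thesis using convex_onD[OF cv, of t "x + z * sqrt h" "y + z * sqrt h"] t by simp
  qed
  show "gauss_step m h F ?w \<le> (1 - t) * gauss_step m h F x + t * gauss_step m h F y"
  proof (cases "m = 0")
    case True
    have "gexp (\<lambda>z. F (?w + z * sqrt h)) \<le> gexp (\<lambda>z. (1 - t) * F (x + z * sqrt h) + t * F (y + z * sqrt h))"
      by (intro gexp_mono cF Bochner_Integration.integrable_add integrable_mult_right nonexpansive_integrable F h)
    also have "\<dots> = (1 - t) * gexp (\<lambda>z. F (x + z * sqrt h)) + t * gexp (\<lambda>z. F (y + z * sqrt h))"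
      by (subst Bochner_Integration.integral_add) (auto intro: nonexpansive_integrable F h)
    finally show ?thesis by (simp add: True gauss_step_0)
  next
    case False
    let ?P = "gauss_step m h F x" and ?M = "gauss_step m h F y"
    let ?Q = "(1 - t) * ?P + t * ?M"
    have "exp (m * gauss_step m h F ?w) \<le> gexp (\<lambda>z. exp (m * ?Q) * 
       ((1 - t) * exp (- m * ?P) * exp (m * F (x + z * sqrt h)) + t * exp (- m * ?M) * exp (m * F (y + z * sqrt h))))"
      unfolding exp_gauss_step[OF F h False]
    proof (rule gexp_mono)
      fix z
      have "m * F (?w + z * sqrt h) \<le> m * ((1 - t) * F (x + z * sqrt h) + t * F (y + z * sqrt h))"
        by (intro mult_left_mono m cF)
      also have "\<dots> = m * ?Q + ((1 - t) * (- m * ?P + m * F (x + z * sqrt h)) + t * (- m * ?M + m * F (y + z * sqrt h)))"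
        by (simp add: algebra_simps)
      finally have "exp (m * F (?w + z * sqrt h)) \<le> exp (m * ?Q) * 
          exp ((1 - t) * (- m * ?P + m * F (x + z * sqrt h)) + t * (- m * ?M + m * F (y + z * sqrt h)))"
        by (simp flip: exp_add)
      also have "\<dots> \<le> exp (m * ?Q) * ((1 - t) * exp (- m * ?P + m * F (x + z * sqrt h)) 
          + t * exp (- m * ?M + m * F (y + z * sqrt h)))"
        using t by (intro mult_left_mono convex_exp_le) auto
      finally show "exp (m * F (?w + z * sqrt h)) \<le> exp (m * ?Q) * ((1 - t) * exp (- m * ?P) * 
          exp (m * F (x + z * sqrt h)) + t * exp (- m * ?M) * exp (m * F (y + z * sqrt h)))"
        by (simp only: exp_add mult.assoc)
    qed (intro Bochner_Integration.integrable_add integrable_mult_right nonexpansive_integrable_exp F h)+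
    also have "\<dots> = exp (m * ?Q) * ((1 - t) * (exp (- m * ?P) * gexp (\<lambda>z. exp (m * F (x + z * sqrt h)))) 
        + t * (exp (- m * ?M) * gexp (\<lambda>z. exp (m * F (y + z * sqrt h)))))"
      by (subst integral_mult_right_zero, subst Bochner_Integration.integral_add)
         (auto intro!: integrable_mult_right nonexpansive_integrable_exp F h simp: mult.assoc simp del: mult_minus_left)
    also have "\<dots> = exp (m * ?Q)"
      unfolding exp_gauss_step[OF F h False, symmetric]
      by (simp flip: exp_add)
    finally show ?thesis using m False by simp
  qed
qed simp

text \<open>A power-mean inequality for the Gibbs weights; the only place where \<open>m \<le> 1\<close> is essential.\<close>

lemma exp_gauss_step_shift:
  assumes F: "nonexpansive F" and h: "0 \<le> h" and m: "0 \<le> m" "m \<le> 1"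
  shows "exp (gauss_step m h F y - gauss_step m h F x) * gexp (\<lambda>z. exp (m * F (x + z * sqrt h)))
    \<le> gexp (\<lambda>z. exp (m * F (x + z * sqrt h)) * exp (F (y + z * sqrt h) - F (x + z * sqrt h)))"
proof -
  note [measurable] = nonexpansive_measurable[OF F]
  have int: "integrable std_normal_distribution
     (\<lambda>z. exp (m * F (x + z * sqrt h)) * exp (F (y + z * sqrt h) - F (x + z * sqrt h)))"
  proof (rule Bochner_Integration.integrable_bound)
    show "integrable std_normal_distribution (\<lambda>z. exp (m * F (x + z * sqrt h)) * exp \<bar>y - x\<bar>)"
      by (intro integrable_mult_left nonexpansive_integrable_exp F h)
    show "AE z in std_normal_distribution. norm (exp (m * F (x + z * sqrt h)) * exp (F (y + z * sqrt h) - F (x + z * sqrt h)))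
       \<le> norm (exp (m * F (x + z * sqrt h)) * exp \<bar>y - x\<bar>)"
    proof (rule AE_I2)
      fix z
      have "F (y + z * sqrt h) - F (x + z * sqrt h) \<le> \<bar>y - x\<bar>"
        using nonexpansiveD[OF F, of "y + z * sqrt h" "x + z * sqrt h"] by simp
      then show "norm (exp (m * F (x + z * sqrt h)) * exp (F (y + z * sqrt h) - F (x + z * sqrt h)))
       \<le> norm (exp (m * F (x + z * sqrt h)) * exp \<bar>y - x\<bar>)" by simp
    qed
  qed measurable
  show ?thesis
  proof (cases "m = 0")
    case True
    have int2: "integrable std_normal_distribution (\<lambda>z. F (y + z * sqrt h) - F (x + z * sqrt h))"
      by (intro Bochner_Integration.integrable_diff nonexpansive_integrable F h)
    have "exp (gexp (\<lambda>z. F (y + z * sqrt h) - F (x + z * sqrt h))) 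
        \<le> gexp (\<lambda>z. exp (F (y + z * sqrt h) - F (x + z * sqrt h)))"
      by (rule gexp_Jensen_exp[OF int2]) (use int True in simp)
    moreover have "gexp (\<lambda>z. F (y + z * sqrt h) - F (x + z * sqrt h)) 
        = gexp (\<lambda>z. F (y + z * sqrt h)) - gexp (\<lambda>z. F (x + z * sqrt h))"
      by (intro Bochner_Integration.integral_diff nonexpansive_integrable F h)
    ultimately show ?thesis using True by (simp add: gauss_step_0)
  next
    case False
    let ?M = "gauss_step m h F y - gauss_step m h F x"
    let ?W = "gexp (\<lambda>z. exp (m * F (x + z * sqrt h)))"
    let ?R = "gexp (\<lambda>z. exp (m * F (x + z * sqrt h)) * exp (F (y + z * sqrt h) - F (x + z * sqrt h)))"
    have "exp (- m * ?M) * gexp (\<lambda>z. exp (m * F (y + z * sqrt h))) 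
        = gexp (\<lambda>z. exp (- m * ?M) * exp (m * F (y + z * sqrt h)))" by simp
    also have "\<dots> \<le> gexp (\<lambda>z. m * exp (- ?M) * (exp (m * F (x + z * sqrt h)) * 
        exp (F (y + z * sqrt h) - F (x + z * sqrt h))) + (1 - m) * exp (m * F (x + z * sqrt h)))"
    proof (rule gexp_mono)
      fix z
      let ?a = "F (x + z * sqrt h)" and ?b = "F (y + z * sqrt h)"
      \<comment> \<open>The bound exp (m t) <= m exp t + (1 - m) at t = b - a - M. Under the weights
        \<open>exp (m * ?a)\<close> the average of exp (m t) is 1 by the choice of
        \<open>?M\<close>, so the average of exp t is at least 1.\<close>
      have "exp (m * (?b - ?a - ?M) + (1 - m) * 0) \<le> m * exp (?b - ?a - ?M) + (1 - m) * exp 0"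
        by (rule convex_exp_le) (use m in auto)
      then have "exp (m * ?a) * exp (m * (?b - ?a - ?M)) \<le> exp (m * ?a) * (m * exp (?b - ?a - ?M) + (1 - m))"
        by (intro mult_left_mono) auto
      moreover have "exp (m * ?a) * exp (m * (?b - ?a - ?M)) = exp (- m * ?M) * exp (m * ?b)"
        by (simp add: algebra_simps flip: exp_add)
      moreover have "exp (?b - ?a - ?M) = exp (- ?M) * exp (?b - ?a)"
        by (simp flip: exp_add)
      ultimately show "exp (- m * ?M) * exp (m * ?b) \<le> m * exp (- ?M) * (exp (m * ?a) * exp (?b - ?a)) + (1 - m) * exp (m * ?a)"
        by (simp add: algebra_simps)
    qed (intro Bochner_Integration.integrable_add integrable_mult_right nonexpansive_integrable_exp int F h)+
    also have "\<dots> = m * exp (- ?M) * ?R + (1 - m) * ?W"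
      by (subst Bochner_Integration.integral_add) (auto intro!: integrable_mult_right nonexpansive_integrable_exp int F h)
    also have "exp (- m * ?M) * gexp (\<lambda>z. exp (m * F (y + z * sqrt h))) = ?W"
      unfolding exp_gauss_step[OF F h False, symmetric] by (simp add: algebra_simps flip: exp_add)
    finally have "m * ?W \<le> m * (exp (- ?M) * ?R)" by (simp add: algebra_simps)
    then have "?W \<le> exp (- ?M) * ?R" using m False by simp
    then have "exp ?M * ?W \<le> exp ?M * (exp (- ?M) * ?R)" by (intro mult_left_mono) auto
    also have "\<dots> = ?R" by (simp flip: mult.assoc exp_add)
    finally show ?thesis .
  qed
qed

text \<open>The two shifted values are bounded by averages over the same Gibbs weights at
  \<open>x\<close>, so the pointwise inequality for \<open>F\<close> can be added up under the
  integral and the common normalisation cancels.\<close>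

lemma gauss_step_hyperbolic:
  assumes F: "F \<in> parisi_class" and h: "0 \<le> h" and m: "0 \<le> m" "m \<le> 1"
  shows "exp (gauss_step m h F (x + s)) + exp (gauss_step m h F (x - s)) \<le> 2 * cosh s * exp (gauss_step m h F x)"
proof -
  note ne = class_nonexpansive[OF F]
  note [measurable] = nonexpansive_measurable[OF ne]
  let ?W = "gexp (\<lambda>z. exp (m * F (x + z * sqrt h)))" and ?G = "gauss_step m h F"
  let ?p = "\<lambda>y z. exp (m * F (x + z * sqrt h)) * exp (F (y + z * sqrt h) - F (x + z * sqrt h))"
  have int: "integrable std_normal_distribution (?p y)" for y
  proof (rule Bochner_Integration.integrable_bound)
    show "integrable std_normal_distribution (\<lambda>z. exp (m * F (x + z * sqrt h)) * exp \<bar>y - x\<bar>)"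
      by (intro integrable_mult_left nonexpansive_integrable_exp ne h)
    show "AE z in std_normal_distribution. norm (?p y z) \<le> norm (exp (m * F (x + z * sqrt h)) * exp \<bar>y - x\<bar>)"
    proof (rule AE_I2)
      fix z
      have "F (y + z * sqrt h) - F (x + z * sqrt h) \<le> \<bar>y - x\<bar>"
        using nonexpansiveD[OF ne, of "y + z * sqrt h" "x + z * sqrt h"] by simp
      then show "norm (?p y z) \<le> norm (exp (m * F (x + z * sqrt h)) * exp \<bar>y - x\<bar>)" by simp
    qed
  qed measurable
  have W: "0 < ?W" by (intro gexp_pos nonexpansive_integrable_exp ne h) auto
  have "(exp (?G (x + s) - ?G x) + exp (?G (x - s) - ?G x)) * ?W \<le> gexp (?p (x + s)) + gexp (?p (x - s))"
    using exp_gauss_step_shift[OF ne h m, of "x + s" x] exp_gauss_step_shift[OF ne h m, of "x - s" x] 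
    by (simp add: algebra_simps)
  also have "\<dots> = gexp (\<lambda>z. ?p (x + s) z + ?p (x - s) z)"
    by (intro Bochner_Integration.integral_add[symmetric] int)
  also have "\<dots> \<le> gexp (\<lambda>z. 2 * cosh s * exp (m * F (x + z * sqrt h)))"
  proof (rule gexp_mono)
    fix z
    have "exp (F (x + s + z * sqrt h)) + exp (F (x - s + z * sqrt h)) \<le> 2 * cosh s * exp (F (x + z * sqrt h))"
      using class_hyperbolic[OF F, of "x + z * sqrt h" s] by (simp add: algebra_simps)
    then have "exp (F (x + s + z * sqrt h) - F (x + z * sqrt h)) + exp (F (x - s + z * sqrt h) - F (x + z * sqrt h)) 
        \<le> 2 * cosh s"
      by (simp add: exp_diff divide_simps)
    then have "exp (m * F (x + z * sqrt h)) * (exp (F (x + s + z * sqrt h) - F (x + z * sqrt h)) + exp (F (x - s + z * sqrt h) - F (x + z * sqrt h))) 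
        \<le> exp (m * F (x + z * sqrt h)) * (2 * cosh s)"
      by (intro mult_left_mono) auto
    then show "?p (x + s) z + ?p (x - s) z \<le> 2 * cosh s * exp (m * F (x + z * sqrt h))"
      by (simp add: algebra_simps)
  qed (intro Bochner_Integration.integrable_add integrable_mult_right nonexpansive_integrable_exp int ne h)+
  also have "\<dots> = 2 * cosh s * ?W" by simp
  finally have "exp (?G (x + s) - ?G x) + exp (?G (x - s) - ?G x) \<le> 2 * cosh s"
    using W by simp
  then show ?thesis by (simp add: exp_diff divide_simps)
qed

lemma gauss_step_class:
  assumes F: "F \<in> parisi_class" and h: "0 \<le> h" and m: "0 \<le> m" "m \<le> 1"
  shows "gauss_step m h F \<in> parisi_class"
  unfolding parisi_class_def mem_Collect_eq
  using gauss_step_even[OF class_nonexpansive[OF F] class_even[OF F]]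
    gauss_step_nonexpansive[OF class_nonexpansive[OF F] h m(1)]
    gauss_step_convex[OF class_nonexpansive[OF F] class_convex[OF F] h m(1)]
    gauss_step_hyperbolic[OF F h m]
  by (auto simp: nonexpansive_def)

lemma class_add_const: 
  assumes "F \<in> parisi_class" shows "(\<lambda>x. F x + c) \<in> parisi_class"
proof -
  have "convex_on UNIV (\<lambda>x. F x + c)"
    by (rule convex_on_add[OF class_convex[OF assms]]) (auto simp: convex_on_def simp flip: distrib_right)
  moreover have "exp (F (x + s) + c) + exp (F (x - s) + c) \<le> 2 * cosh s * exp (F x + c)" for x s
    using mult_right_mono[OF class_hyperbolic[OF assms, of x s], of "exp c"] 
    by (simp add: exp_add algebra_simps)
  ultimately show ?thesis
    using assms by (auto simp: parisi_class_def)
qed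

lemma class_limit:
  assumes F: "\<And>n. F n \<in> parisi_class" and lim: "\<And>x. (\<lambda>n. F n x) \<longlonglongrightarrow> G x"
  shows "G \<in> parisi_class"
proof -
  have "G (- x) = G x" for x
    using LIMSEQ_unique[OF lim[of "- x"]] lim[of x] by (simp add: class_even[OF F])
  moreover have "\<bar>G x - G y\<bar> \<le> \<bar>x - y\<bar>" for x y
    by (rule tendsto_upperbound[OF tendsto_rabs[OF tendsto_diff[OF lim lim]]])
      (auto intro!: always_eventually nonexpansiveD class_nonexpansive F)
  moreover have "convex_on UNIV G"
  proof (rule convex_onI)
    fix t x y :: real assume t: "0 < t" "t < 1"
    have "F n ((1 - t) *\<^sub>R x + t *\<^sub>R y) \<le> (1 - t) * F n x + t * F n y" for n
      using convex_onD[OF class_convex[OF F]] t by auto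
    then show "G ((1 - t) *\<^sub>R x + t *\<^sub>R y) \<le> (1 - t) * G x + t * G y"
      by (intro LIMSEQ_le[OF lim tendsto_add[OF tendsto_mult[OF tendsto_const lim] tendsto_mult[OF tendsto_const lim]]]) auto
  qed simp
  moreover have "exp (G (x + s)) + exp (G (x - s)) \<le> 2 * cosh s * exp (G x)" for x s
    by (rule LIMSEQ_le[OF tendsto_add[OF tendsto_exp[OF lim] tendsto_exp[OF lim]] 
          tendsto_mult[OF tendsto_const tendsto_exp[OF lim]]]) (auto intro: class_hyperbolic F)
  ultimately show ?thesis by (auto simp: parisi_class_def)
qed

text \<open>For the terminal value, exp F = cosh is the extremal case: the last condition of the
  class holds with equality by the addition theorem.\<close>

lemma ln_cosh_class: "(\<lambda>x. ln (cosh x)) \<in> parisi_class"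
proof -
  have der: "((\<lambda>x. ln (cosh x)) has_real_derivative tanh x) (at x)" for x :: real
    by (auto intro!: derivative_eq_intros simp: tanh_def cosh_real_pos divide_inverse)
  have "\<bar>ln (cosh x) - ln (cosh y)\<bar> \<le> \<bar>x - y\<bar>" for x y :: real
  proof -
    have "norm (ln (cosh x) - ln (cosh y)) \<le> 1 * norm (x - y)"
    proof (rule field_differentiable_bound[where S=UNIV])
      show "norm (tanh z :: real) \<le> 1" for z :: real
        using tanh_real_bounds[of z] by auto
    qed (use der in auto)
    then show ?thesis by simp
  qed
  moreover have "convex_on UNIV (\<lambda>x::real. ln (cosh x))"
    by (rule convex_on_realI[where f'=tanh]) (use der in auto)
  moreover have "cosh (x + s) + cosh (x - s) = 2 * cosh s * cosh x" for x s :: real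
    by (simp add: cosh_add cosh_diff)
  ultimately show ?thesis by (auto simp: parisi_class_def cosh_real_pos)
qed

lemma tanh_le_self: "0 \<le> x \<Longrightarrow> tanh x \<le> (x::real)"
proof -
  assume x: "0 \<le> x"
  have "0 - tanh 0 \<le> x - tanh x"
  proof (rule DERIV_nonneg_imp_nondecreasing[OF x])
    fix t :: real
    have "((\<lambda>x. x - tanh x) has_real_derivative (tanh t)\<^sup>2) (at t)"
      by (auto intro!: derivative_eq_intros)
    then show "\<exists>y. ((\<lambda>x. x - tanh x) has_real_derivative y) (at t) \<and> 0 \<le> y" by force
  qed
  then show ?thesis by simp
qed

lemma ln_cosh_le: "ln (cosh s) \<le> (s::real)\<^sup>2 / 2"
proof -
  have *: "ln (cosh x) \<le> x\<^sup>2 / 2" if "0 \<le> x" for x :: real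
  proof -
    have "0\<^sup>2 / 2 - ln (cosh 0) \<le> x\<^sup>2 / 2 - ln (cosh x)"
    proof (rule DERIV_nonneg_imp_nondecreasing[OF that])
      fix t :: real assume "0 \<le> t"
      moreover have "((\<lambda>x. x\<^sup>2 / 2 - ln (cosh x)) has_real_derivative t - tanh t) (at t)"
        by (auto intro!: derivative_eq_intros simp: tanh_def cosh_real_pos)
      ultimately show "\<exists>y. ((\<lambda>x. x\<^sup>2 / 2 - ln (cosh x)) has_real_derivative y) (at t) \<and> 0 \<le> y" 
        using tanh_le_self by force
    qed
    then show ?thesis by simp
  qed
  show ?thesis using *[of "\<bar>s\<bar>"] by simp
qed

section \<open>Slope and curvature of functions in the class\<close>

lemma class_second_difference:
  assumes F: "F \<in> parisi_class" shows "F (x + s) + F (x - s) - 2 * F x \<le> s\<^sup>2"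
proof -
  let ?u = "F (x + s) - F x" and ?w = "F (x - s) - F x"
  have "exp (1/2 * ?u + 1/2 * ?w) \<le> 1/2 * exp ?u + 1/2 * exp ?w"
    by (rule convex_exp_le) auto
  also have "\<dots> = (exp (F (x + s)) + exp (F (x - s))) / (2 * exp (F x))"
    by (simp add: exp_diff field_simps)
  also have "\<dots> \<le> cosh s"
    using class_hyperbolic[OF F, of x s] by (simp add: divide_simps mult_ac)
  finally have "1/2 * ?u + 1/2 * ?w \<le> ln (cosh s)"
    by (simp add: ln_ge_iff cosh_real_pos)
  then show ?thesis using ln_cosh_le[of s] by (simp add: field_simps)
qed

text \<open>A subgradient \<open>a\<close> from convexity gives a lower bound linear in s;
  reflecting it through the second-difference bound gives an upper bound that differs by s^2 only.
  The squeeze yields differentiability, which the class does not demand outright.\<close>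

lemma class_deriv_exists:
  assumes F: "F \<in> parisi_class"
  shows "\<exists>a. (F has_real_derivative a) (at x) \<and> (\<forall>y. F x + a * (y - x) \<le> F y)"
proof -
  obtain a where a: "\<And>y. F x + a * (y - x) \<le> F y"
    using convex_le_Inf_differential[OF class_convex[OF F], of x] by auto
  have up: "F (x + s) \<le> F x + a * s + s\<^sup>2" for s
    using a[of "x - s"] class_second_difference[OF F, of x s] by simp
  have "((\<lambda>s. (F (x + s) - F x) / s - a) \<longlongrightarrow> 0) (at 0)"
  proof (rule Lim_null_comparison[OF _ tendsto_rabs_zero[OF tendsto_ident_at]])
    have "norm ((F (x + s) - F x) / s - a) \<le> \<bar>s\<bar>" if "s \<noteq> 0" for s
    proof -
      have "\<bar>F (x + s) - F x - a * s\<bar> \<le> \<bar>s\<bar> * \<bar>s\<bar>"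
        using up[of s] a[of "x + s"] by (simp add: power2_eq_square abs_le_iff)
      then have "\<bar>F (x + s) - F x - a * s\<bar> / \<bar>s\<bar> \<le> \<bar>s\<bar>"
        using that by (simp add: divide_simps)
      moreover have "(F (x + s) - F x) / s - a = (F (x + s) - F x - a * s) / s"
        using that by (simp add: field_simps)
      ultimately show ?thesis by simp
    qed
    then show "\<forall>\<^sub>F s in at 0. norm ((F (x + s) - F x) / s - a) \<le> \<bar>s\<bar>"
      by (auto simp: eventually_at intro: exI[of _ 1])
  qed
  then have "(F has_real_derivative a) (at x)"
    by (simp add: DERIV_def LIM_zero_iff)
  with a show ?thesis by blast
qed

lemma class_has_deriv:
  assumes F: "F \<in> parisi_class" shows "(F has_real_derivative deriv F x) (at x)"
  using class_deriv_exists[OF F, of x] DERIV_imp_deriv by blast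

lemma class_tangent:
  assumes F: "F \<in> parisi_class" shows "F x + deriv F x * (y - x) \<le> F y"
  using class_deriv_exists[OF F, of x] DERIV_imp_deriv by blast

text \<open>Slopes are identified below through supporting lines, which avoids differentiating under
  the Gaussian integral.\<close>

lemma class_deriv_unique:
  assumes F: "F \<in> parisi_class" and a: "\<And>y. F x + a * (y - x) \<le> F y" shows "deriv F x = a"
proof -
  have "((\<lambda>y. F y - a * y) has_real_derivative deriv F x - a) (at x)"
    by (auto intro!: derivative_eq_intros class_has_deriv F)
  then have "deriv F x - a = 0"
    by (rule DERIV_local_min[of _ _ _ 1]) (use a in \<open>auto simp: algebra_simps\<close>)
  then show ?thesis by simp
qed

lemma class_deriv_mono:
  assumes F: "F \<in> parisi_class" and "x \<le> y" shows "deriv F x \<le> deriv F y"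
proof (cases "x = y")
  case False
  then have "0 < y - x" using assms by simp
  moreover have "(deriv F x - deriv F y) * (y - x) \<le> 0"
    using class_tangent[OF F, of x y] class_tangent[OF F, of y x] by (simp add: algebra_simps)
  ultimately show ?thesis by (simp add: mult_le_0_iff)
qed simp

text \<open>Chaining second differences along a mesh of width t transports an increment from
  \<open>x\<close> to \<open>x + n * t\<close> at the cost n t^2. With t = (y - x)/(n + 1), division
  by t and passage to the limit give the Lipschitz constant exactly 1, on which the variance bound
  by \<xi>' depends.\<close>

lemma class_deriv_diff_le:
  assumes F: "F \<in> parisi_class" and xy: "x \<le> y" shows "deriv F y - deriv F x \<le> y - x"
proof (cases "x = y")
  case False
  then have lt: "x < y" using xy by simp
  define s where "s n = (y - x) / real (Suc n)" for n
  have s0: "s n \<noteq> 0" for n using lt by (simp add: s_def)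
  have s: "s \<longlonglongrightarrow> 0" unfolding s_def
    by (rule LIMSEQ_Suc[OF lim_const_over_n])
  have quot: "(\<lambda>n. (F (z + s n) - F z) / s n) \<longlonglongrightarrow> deriv F z" for z
    using class_has_deriv[OF F, of z] s s0 
    unfolding DERIV_def tendsto_at_iff_sequentially by (auto simp: o_def)
  have step: "F (x + real n * t + t) - F (x + real n * t) \<le> F (x + t) - F x + real n * t\<^sup>2" for n t
  proof (induction n)
    case (Suc n)
    then show ?case
      using class_second_difference[OF F, of "x + real n * t + t" t] by (simp add: algebra_simps)
  qed simp
  have "(F (y + s n) - F y) / s n \<le> (F (x + s n) - F x) / s n + (y - x)" for n
  proof -
    have "x + real (Suc n) * s n = y" by (simp add: s_def)
    moreover have "real (Suc n) * (s n)\<^sup>2 = (y - x) * s n" by (simp add: s_def power2_eq_square)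
    ultimately have "F (y + s n) - F y \<le> F (x + s n) - F x + (y - x) * s n"
      using step[of "Suc n" "s n"] by (simp del: of_nat_Suc)
    moreover have "0 < s n" using lt by (simp add: s_def)
    ultimately have "(F (y + s n) - F y) / s n \<le> (F (x + s n) - F x + (y - x) * s n) / s n"
      by (intro divide_right_mono) auto
    then show ?thesis using \<open>0 < s n\<close> by (simp add: add_divide_distrib)
  qed
  then have "deriv F y \<le> deriv F x + (y - x)"
    by (intro LIMSEQ_le[OF quot tendsto_add[OF quot tendsto_const]]) auto
  then show ?thesis by simp
qed simp

lemma class_deriv_nonexpansive:
  assumes F: "F \<in> parisi_class" shows "nonexpansive (deriv F)"
  unfolding nonexpansive_def
proof (intro allI)
  fix x y show "\<bar>deriv F x - deriv F y\<bar> \<le> \<bar>x - y\<bar>"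
    using class_deriv_mono[OF F, of x y] class_deriv_diff_le[OF F, of x y]
      class_deriv_mono[OF F, of y x] class_deriv_diff_le[OF F, of y x] by linarith
qed

lemma class_deriv_abs_le:
  assumes F: "F \<in> parisi_class" shows "\<bar>deriv F x\<bar> \<le> 1"
  using class_tangent[OF F, of x "x + 1"] class_tangent[OF F, of x "x - 1"]
    nonexpansiveD[OF class_nonexpansive[OF F], of "x + 1" x] 
    nonexpansiveD[OF class_nonexpansive[OF F], of "x - 1" x] by (simp add: abs_le_iff)

lemma class_deriv_square_le: "F \<in> parisi_class \<Longrightarrow> (deriv F x)\<^sup>2 \<le> 1"
  using class_deriv_abs_le[of F x] by (simp add: abs_square_le_1)

lemma class_deriv_uminus:
  assumes F: "F \<in> parisi_class" shows "deriv F (- x) = - deriv F x"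
proof (rule class_deriv_unique[OF F])
  fix y show "F (- x) + - deriv F x * (y - - x) \<le> F y"
    using class_tangent[OF F, of x "- y"] class_even[OF F] by (simp add: algebra_simps)
qed

lemma class_deriv_0: "F \<in> parisi_class \<Longrightarrow> deriv F 0 = 0"
  using class_deriv_uminus[of F 0] by simp

lemma class_upper:
  assumes F: "F \<in> parisi_class" shows "F y \<le> F x + deriv F x * (y - x) + (y - x)\<^sup>2 / 2"
proof -
  define \<psi> where "\<psi> y = deriv F x * (y - x) + (y - x)\<^sup>2 / 2 - F y" for y
  have der: "(\<psi> has_real_derivative (deriv F x + (t - x) - deriv F t)) (at t)" for t
    unfolding \<psi>_def by (auto intro!: derivative_eq_intros class_has_deriv F)
  have "\<psi> x \<le> \<psi> y"
  proof (cases "x \<le> y")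
    case True
    show ?thesis
    proof (rule DERIV_nonneg_imp_nondecreasing[OF True])
      fix t assume "x \<le> t" "t \<le> y"
      then show "\<exists>d. (\<psi> has_real_derivative d) (at t) \<and> 0 \<le> d"
        using class_deriv_diff_le[OF F, of x t] der[of t] by (intro exI conjI) auto
    qed
  next
    case False
    then have "y \<le> x" by simp
    then show ?thesis
    proof (rule DERIV_nonpos_imp_nonincreasing)
      fix t assume "y \<le> t" "t \<le> x"
      then show "\<exists>d. (\<psi> has_real_derivative d) (at t) \<and> d \<le> 0"
        using class_deriv_diff_le[OF F, of t x] der[of t] by (intro exI conjI) auto
    qed
  qed
  then show ?thesis by (simp add: \<psi>_def)
qed

section \<open>Gaussian moments, the slope of a recursion step, and its composition law\<close>

lemma gexp_id: "gexp (\<lambda>z. z) = 0"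
  using integral_std_normal_distribution_moment_odd[of 1] by simp

lemma integrable_gauss_id: "integrable std_normal_distribution (\<lambda>z. z)"
  by (rule integrable_gaussI[where C=1 and c=1]) (auto simp: abs_le_exp_abs)

lemma gexp_square: "gexp (\<lambda>z. z\<^sup>2) = 1"
  using std_normal_distribution_even_moments(1)[of 1] by simp

lemma integrable_gauss_square: "integrable std_normal_distribution (\<lambda>z. z\<^sup>2)"
  using std_normal_distribution_even_moments(2)[of 1] by simp

lemma integrable_gauss_const: "integrable std_normal_distribution (\<lambda>z. c)"
  by (intro finite_measure.integrable_const prob_space.finite_measure prob_space_std_normal)

lemma integrable_deriv_weight:
  assumes F: "F \<in> parisi_class" and h: "0 \<le> h"
  shows "integrable std_normal_distribution (\<lambda>z. deriv F (x + z * sqrt h) * exp (m * F (x + z * sqrt h)))"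
proof (rule Bochner_Integration.integrable_bound)
  note [measurable] = nonexpansive_measurable[OF class_deriv_nonexpansive[OF F]]
      nonexpansive_measurable[OF class_nonexpansive[OF F]]
  show "(\<lambda>z. deriv F (x + z * sqrt h) * exp (m * F (x + z * sqrt h))) \<in> borel_measurable std_normal_distribution"
    by measurable
  show "integrable std_normal_distribution (\<lambda>z. exp (m * F (x + z * sqrt h)))"
    by (intro nonexpansive_integrable_exp class_nonexpansive F h)
qed (use class_deriv_abs_le[OF F] in \<open>auto simp: abs_mult mult_le_cancel_right1\<close>)

text \<open>The slope is the Gibbs average \<open>a\<close> of the slopes of \<open>F\<close>. It is
  enough to see that the line with slope \<open>a\<close> supports the new function: tangents of
  \<open>F\<close> and exp t >= 1 + t are integrated against the weights, and the first-order terms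
  cancel because \<open>a\<close> is their mean.\<close>

lemma deriv_gauss_step:
  assumes F: "F \<in> parisi_class" and h: "0 \<le> h" and m: "0 \<le> m" "m \<le> 1"
  shows "deriv (gauss_step m h F) x * gexp (\<lambda>z. exp (m * F (x + z * sqrt h)))
      = gexp (\<lambda>z. deriv F (x + z * sqrt h) * exp (m * F (x + z * sqrt h)))"
proof -
  let ?N = std_normal_distribution
  note ne = class_nonexpansive[OF F]
  let ?W = "gexp (\<lambda>z. exp (m * F (x + z * sqrt h)))"
  let ?R = "gexp (\<lambda>z. deriv F (x + z * sqrt h) * exp (m * F (x + z * sqrt h)))"
  define a where "a = ?R / ?W"
  have W: "0 < ?W" by (intro gexp_pos nonexpansive_integrable_exp ne h) auto
  note int = nonexpansive_integrable[OF ne h] nonexpansive_integrable_exp[OF ne h]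
    integrable_deriv_weight[OF F h]
  have tan: "F (x + z * sqrt h) + deriv F (x + z * sqrt h) * (y - x) \<le> F (y + z * sqrt h)" for y z
    using class_tangent[OF F, of "x + z * sqrt h" "y + z * sqrt h"] by simp
  have "gauss_step m h F x + a * (y - x) \<le> gauss_step m h F y" for y
  proof (cases "m = 0")
    case True
    have int0: "integrable ?N (\<lambda>z. deriv F (x + z * sqrt h))"
      using integrable_deriv_weight[OF F h, of x 0] by simp
    have "gexp (\<lambda>z. F (x + z * sqrt h)) + gexp (\<lambda>z. deriv F (x + z * sqrt h)) * (y - x) 
        = gexp (\<lambda>z. F (x + z * sqrt h) + deriv F (x + z * sqrt h) * (y - x))"
      using int(1)[of x] int0 by simp
    also have "\<dots> \<le> gexp (\<lambda>z. F (y + z * sqrt h))"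
      by (intro gexp_mono tan int int0 Bochner_Integration.integrable_add integrable_mult_left)
    finally show ?thesis using True by (simp add: gauss_step_0 a_def)
  next
    case False
    let ?c = "m * (y - x)"
    have aW: "a * ?W = ?R" using W by (simp add: a_def)
    have "?W = (1 - ?c * a) * ?W + ?c * ?R"
      unfolding aW[symmetric] by (simp add: algebra_simps)
    also have "\<dots> = gexp (\<lambda>z. (1 - ?c * a) * exp (m * F (x + z * sqrt h)) 
        + ?c * (deriv F (x + z * sqrt h) * exp (m * F (x + z * sqrt h))))"
      by (subst Bochner_Integration.integral_add)
        (auto intro!: integrable_mult_right int)
    also have "\<dots> \<le> gexp (\<lambda>z. exp (- ?c * a) * exp (m * F (y + z * sqrt h)))"
    proof (rule gexp_mono)
      fix z
      let ?u = "F (x + z * sqrt h)" and ?e = "deriv F (x + z * sqrt h)"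
      have "(1 - ?c * a) * exp (m * ?u) + ?c * (?e * exp (m * ?u)) = exp (m * ?u) * (1 + ?c * (?e - a))"
        by (simp add: algebra_simps)
      also have "\<dots> \<le> exp (m * ?u) * exp (?c * (?e - a))"
        by (intro mult_left_mono exp_ge_add_one_self) auto
      also have "\<dots> = exp (- ?c * a) * exp (m * (?u + ?e * (y - x)))"
        by (simp add: algebra_simps flip: exp_add)
      also have "\<dots> \<le> exp (- ?c * a) * exp (m * F (y + z * sqrt h))"
        using m tan[of z y] by (intro mult_left_mono) (auto intro!: mult_left_mono)
      finally show "(1 - ?c * a) * exp (m * ?u) + ?c * (?e * exp (m * ?u)) 
         \<le> exp (- ?c * a) * exp (m * F (y + z * sqrt h))" .
    qed (intro Bochner_Integration.integrable_add integrable_mult_right int)+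
    also have "\<dots> = exp (- ?c * a) * exp (m * gauss_step m h F y)"
      by (simp add: exp_gauss_step[OF ne h False])
    finally have "exp (m * gauss_step m h F x) \<le> exp (- ?c * a + m * gauss_step m h F y)"
      by (simp only: exp_gauss_step[OF ne h False] exp_add)
    then have "m * (gauss_step m h F x + a * (y - x)) \<le> m * gauss_step m h F y"
      by (simp add: algebra_simps)
    then show ?thesis using m False by simp
  qed
  then have "deriv (gauss_step m h F) x = a"
    by (rule class_deriv_unique[OF gauss_step_class[OF F h m]])
  then show ?thesis using W by (simp add: a_def)
qed

text \<open>For fixed \<open>m\<close> the step is the heat semigroup conjugated by exp (m .), or
  the heat semigroup itself if \<open>m = 0\<close>. This allows steps to be subdivided and grid
  points to be inserted.\<close>

lemma gauss_step_semigroup: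
  assumes F: "nonexpansive F" and h: "0 \<le> h" "0 \<le> k" and m: "0 \<le> m"
  shows "gauss_step m h (gauss_step m k F) = gauss_step m (h + k) F"
proof
  fix x
  note [measurable] = nonexpansive_measurable[OF F]
  have b: "\<bar>F (x + u) - F x\<bar> \<le> \<bar>u\<bar>" for u
    using nonexpansiveD[OF F, of "x + u" x] by simp
  show "gauss_step m h (gauss_step m k F) x = gauss_step m (h + k) F x"
  proof (cases "m = 0")
    case True
    have "gexp (\<lambda>w. gexp (\<lambda>z. (\<lambda>u. F (x + u)) (w * sqrt h + z * sqrt k))) 
        = gexp (\<lambda>z. (\<lambda>u. F (x + u)) (z * sqrt (h + k)))"
    proof (rule gexp_add[OF h, where C="\<bar>F x\<bar> + 1" and c=1])
      show "(\<lambda>u. F (x + u)) \<in> borel_measurable borel" by measurable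
    next
      fix u
      have "\<bar>F (x + u)\<bar> \<le> \<bar>F x\<bar> * 1 + \<bar>u\<bar>" using b[of u] by linarith
      also have "\<dots> \<le> \<bar>F x\<bar> * exp \<bar>u\<bar> + exp \<bar>u\<bar>"
        by (intro add_mono mult_left_mono abs_le_exp_abs) auto
      finally show "\<bar>F (x + u)\<bar> \<le> (\<bar>F x\<bar> + 1) * exp (1 * \<bar>u\<bar>)" by (simp add: algebra_simps)
    qed auto
    then show ?thesis by (simp add: True gauss_step_0 add.assoc)
  next
    case False
    have "gexp (\<lambda>w. gexp (\<lambda>z. (\<lambda>u. exp (m * F (x + u))) (w * sqrt h + z * sqrt k))) 
        = gexp (\<lambda>z. (\<lambda>u. exp (m * F (x + u))) (z * sqrt (h + k)))"
    proof (rule gexp_add[OF h, where C="exp (m * F x)" and c=m])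
      show "(\<lambda>u. exp (m * F (x + u))) \<in> borel_measurable borel" by measurable
    next
      fix u
      have "m * F (x + u) \<le> m * (F x + \<bar>u\<bar>)" using b[of u] m by (intro mult_left_mono) auto
      then show "\<bar>exp (m * F (x + u))\<bar> \<le> exp (m * F x) * exp (m * \<bar>u\<bar>)"
        by (simp add: algebra_simps flip: exp_add)
    qed (use m in auto)
    then have "exp (m * gauss_step m h (gauss_step m k F) x) = exp (m * gauss_step m (h + k) F x)"
      using h by (simp add: exp_gauss_step[OF gauss_step_nonexpansive[OF F h(2) m] h(1) False]
         exp_gauss_step[OF F _ False] add.assoc)
    then show ?thesis using False by simp
  qed
qed

lemma gauss_step_zero_var: "gauss_step m 0 F x = F x"
  by (simp add: gauss_step_def)

text \<open>The lower half of the Gibbs variational principle, tested with a constant drift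
  \<open>a * v\<close>. The drift moves the standard Gaussian by s = a v sqrt k; its entropy cost
  s^2/2, divided by \<open>a\<close>, is the subtracted term.\<close>

lemma gauss_step_ge_shift:
  assumes F: "nonexpansive F" and k: "0 \<le> k" and a: "0 \<le> a"
  shows "gexp (\<lambda>z. F (x + a * v * k + z * sqrt k)) - a * v\<^sup>2 * k / 2 \<le> gauss_step a k F x"
proof (cases "a = 0")
  case True then show ?thesis by (simp add: gauss_step_0)
next
  case False
  note [measurable] = nonexpansive_measurable[OF F]
  define s where "s = a * v * sqrt k"
  have s2: "s\<^sup>2 = a\<^sup>2 * v\<^sup>2 * k" using k by (simp add: s_def power_mult_distrib)
  have sk: "(z + s) * sqrt k = a * v * k + z * sqrt k" for z
    using k by (simp add: s_def algebra_simps)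
  let ?X = "\<lambda>z. a * F (x + a * v * k + z * sqrt k) - s * z - s\<^sup>2 / 2"
  have int: "integrable std_normal_distribution (\<lambda>z. F (x + a * v * k + z * sqrt k))"
    by (rule nonexpansive_integrable[OF F k])
  have "gexp (\<lambda>z. (\<lambda>z. exp (a * F (x + z * sqrt k))) (z + s) * exp (- s * z - s\<^sup>2 / 2)) 
      = gexp (\<lambda>z. exp (a * F (x + z * sqrt k)))"
    by (rule gexp_shift) measurable
  also have "(\<lambda>z. (\<lambda>z. exp (a * F (x + z * sqrt k))) (z + s) * exp (- s * z - s\<^sup>2 / 2)) = (\<lambda>z. exp (?X z))"
    by (intro ext, subst exp_add[symmetric], rule arg_cong[where f=exp]) (simp add: sk add.assoc)
  finally have E: "gexp (\<lambda>z. exp (?X z)) = exp (a * gauss_step a k F x)"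
    by (simp add: exp_gauss_step[OF F k False])
  \<comment> \<open>The integral of a non-integrable function is 0 by convention, so a nonzero value
    already proves integrability and no growth estimate is needed.\<close>
  have ne0: "gexp (\<lambda>z. exp (?X z)) \<noteq> 0" unfolding E by simp
  have "integrable std_normal_distribution (\<lambda>z. exp (?X z))"
    using ne0 not_integrable_integral_eq by blast
  moreover have iX: "integrable std_normal_distribution ?X"
    by (intro Bochner_Integration.integrable_diff integrable_mult_right int integrable_gauss_id integrable_gauss_const)
  ultimately have "exp (gexp ?X) \<le> exp (a * gauss_step a k F x)"
    unfolding E[symmetric] by (intro gexp_Jensen_exp)
  moreover have "gexp ?X = a * gexp (\<lambda>z. F (x + a * v * k + z * sqrt k)) - s\<^sup>2 / 2"
  proof -
    have "gexp ?X = gexp (\<lambda>z. a * F (x + a * v * k + z * sqrt k) - s * z) - gexp (\<lambda>z. s\<^sup>2 / 2)"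
      by (intro Bochner_Integration.integral_diff Bochner_Integration.integrable_diff integrable_mult_right 
          int integrable_gauss_id integrable_gauss_const)
    also have "gexp (\<lambda>z. a * F (x + a * v * k + z * sqrt k) - s * z) 
        = gexp (\<lambda>z. a * F (x + a * v * k + z * sqrt k)) - gexp (\<lambda>z. s * z)"
      by (intro Bochner_Integration.integral_diff integrable_mult_right int integrable_gauss_id)
    finally show ?thesis by (simp add: gexp_id)
  qed
  ultimately have "a * gexp (\<lambda>z. F (x + a * v * k + z * sqrt k)) - s\<^sup>2 / 2 \<le> a * gauss_step a k F x"
    by (metis exp_le_cancel_iff)
  moreover have "a * (gexp (\<lambda>z. F (x + a * v * k + z * sqrt k)) - a * v\<^sup>2 * k / 2)
      = a * gexp (\<lambda>z. F (x + a * v * k + z * sqrt k)) - s\<^sup>2 / 2"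
    unfolding s2 right_diff_distrib by (simp add: power2_eq_square)
  ultimately have "a * (gexp (\<lambda>z. F (x + a * v * k + z * sqrt k)) - a * v\<^sup>2 * k / 2) \<le> a * gauss_step a k F x"
    by linarith
  then show ?thesis using a False by simp
qed

section \<open>The recursion step over a short time\<close>

lemma exp_minus_one_le: "\<bar>exp t - 1\<bar> \<le> \<bar>t\<bar> * exp \<bar>t :: real\<bar>"
proof -
  obtain u where "\<bar>u\<bar> \<le> \<bar>t\<bar>" "exp t = (\<Sum>m<1. t ^ m / fact m) + exp u / fact 1 * t ^ 1"
    using Maclaurin_exp_le[of t 1] by blast
  then show ?thesis by (auto simp: abs_mult mult.commute intro!: mult_left_mono)
qed

lemma exp_second_order_le: "exp t \<le> 1 + t + t\<^sup>2 / 2 * exp \<bar>t :: real\<bar>"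
proof -
  obtain u where u: "\<bar>u\<bar> \<le> \<bar>t\<bar>" "exp t = (\<Sum>m<2. t ^ m / fact m) + exp u / fact 2 * t ^ 2"
    using Maclaurin_exp_le[of t 2] by blast
  then have "exp t = 1 + t + t\<^sup>2 / 2 * exp u" by (simp add: numeral_2_eq_2)
  also have "\<dots> \<le> 1 + t + t\<^sup>2 / 2 * exp \<bar>t\<bar>" using u(1) by (intro add_left_mono mult_left_mono) auto
  finally show ?thesis .
qed

lemma gexp_affine: "gexp (\<lambda>z. c + d * (z * e)) = c"
proof -
  have "gexp (\<lambda>z. c + d * (z * e)) = gexp (\<lambda>z. c) + gexp (\<lambda>z. d * (z * e))"
    by (intro Bochner_Integration.integral_add integrable_gauss_const integrable_mult_right 
        integrable_mult_left integrable_gauss_id)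
  then show ?thesis by (simp add: gexp_id)
qed

lemma gexp_abs_le:
  assumes "f \<in> borel_measurable borel" "\<And>z. \<bar>f z\<bar> \<le> C * exp (c * \<bar>z\<bar>)"
  shows "\<bar>gexp f\<bar> \<le> C * gexp (\<lambda>z. exp (c * \<bar>z\<bar>))"
proof -
  have "\<bar>gexp f\<bar> \<le> gexp (\<lambda>z. \<bar>f z\<bar>)" by (rule integral_abs_bound)
  also have "\<dots> \<le> gexp (\<lambda>z. C * exp (c * \<bar>z\<bar>))"
    by (intro gexp_mono integrable_abs integrable_gaussI[OF assms] integrable_mult_right integrable_exp_abs_gauss assms(2))
  finally show ?thesis by simp
qed

text \<open>Relative to the drift \<open>b * v * k\<close>, the tilted Gaussian is a perturbation of order \<open>k\<close> of the standard one:
  the exponent \<open>X\<close> below is of order \<open>k\<close>, because the tilt \<open>v\<close> is the mean slope.\<close>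

lemma small_gauss_step:
  obtains C where "0 \<le> C" and
    "\<And>H b k x. H \<in> parisi_class \<Longrightarrow> 0 \<le> b \<Longrightarrow> b \<le> 1 \<Longrightarrow> 0 \<le> k \<Longrightarrow> k \<le> 1 \<Longrightarrow>
      gauss_step b k H x \<le> gexp (\<lambda>z. H (x + b * deriv (gauss_step b k H) x * k + z * sqrt k)) 
          - b * (deriv (gauss_step b k H) x)\<^sup>2 * k / 2 + C * k\<^sup>2" and
    "\<And>H b k x. H \<in> parisi_class \<Longrightarrow> 0 \<le> b \<Longrightarrow> b \<le> 1 \<Longrightarrow> 0 \<le> k \<Longrightarrow> k \<le> 1 \<Longrightarrow>
      \<bar>gexp (\<lambda>z. deriv H (x + b * deriv (gauss_step b k H) x * k + z * sqrt k)) - deriv (gauss_step b k H) x\<bar> 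
        \<le> C * (k * sqrt k)"
proof -
  \<comment> \<open>The constants are built from Gaussian exponential moments alone, hence uniform
    in \<open>H\<close>, \<open>b\<close>, \<open>k\<close>, \<open>x\<close>. \<open>c1\<close>
    controls the slope defect \<open>r - v\<close>, \<open>c2\<close> the residual exponent
    \<open>X\<close>, \<open>C1\<close> the error in the value and \<open>C2\<close> the error in
    the mean slope.\<close>
  define E where "E c = gexp (\<lambda>z. exp (c * \<bar>z\<bar>))" for c
  have E_pos: "0 < E c" for c unfolding E_def by (rule gexp_pos[OF integrable_exp_abs_gauss]) auto
  define c1 where "c1 = 2 * E 2"
  define c2 where "c2 = 1 + c1"
  define C1 where "C1 = c2\<^sup>2 * E 4"
  define C2 where "C2 = c2 * (1 + E 3) * E 4"
  define C where "C = max C1 C2"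
  have c_pos: "0 < c1" "0 < c2" unfolding c2_def c1_def using E_pos[of 2] by auto
  have both: "gauss_step b k H x \<le> gexp (\<lambda>z. H (x + b * deriv (gauss_step b k H) x * k + z * sqrt k)) 
          - b * (deriv (gauss_step b k H) x)\<^sup>2 * k / 2 + C1 * k\<^sup>2 \<and>
      \<bar>gexp (\<lambda>z. deriv H (x + b * deriv (gauss_step b k H) x * k + z * sqrt k)) - deriv (gauss_step b k H) x\<bar> 
        \<le> C2 * (k * sqrt k)"
    if H: "H \<in> parisi_class" and b: "0 \<le> b" "b \<le> 1" and k: "0 \<le> k" "k \<le> 1" for H b k x
  proof -
    note ne = class_nonexpansive[OF H] class_deriv_nonexpansive[OF H]
    note [measurable] = nonexpansive_measurable[OF ne(1)] nonexpansive_measurable[OF ne(2)]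
    define G where "G = gauss_step b k H"
    have G: "G \<in> parisi_class" unfolding G_def by (rule gauss_step_class[OF H k(1) b])
    define v where "v = deriv G x"
    define y where "y z = x + b * v * k + z * sqrt k" for z
    define r where "r = deriv H (y 0)"
    define s where "s = b * v * sqrt k"
    have v1: "\<bar>v\<bar> \<le> 1" unfolding v_def by (rule class_deriv_abs_le[OF G])
    have sqk: "0 \<le> sqrt k" "sqrt k \<le> 1" "sqrt k * sqrt k = k" "k \<le> sqrt k"
      using k by (auto simp: real_le_rsqrt power2_eq_square mult_left_le)
    have [measurable]: "y \<in> borel_measurable borel" unfolding y_def by measurable
    let ?w = "\<lambda>z. exp (b * H (x + z * sqrt k))"
    define W0 where "W0 = gexp ?w"
    have W0pos: "0 < W0" unfolding W0_def by (intro gexp_pos nonexpansive_integrable_exp ne k) auto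
    have wle: "?w z \<le> exp (b * H x) * exp \<bar>z\<bar>" for z
    proof -
      have "b * (H (x + z * sqrt k) - H x) \<le> 1 * \<bar>H (x + z * sqrt k) - H x\<bar>"
        using b by (intro order_trans[OF mult_left_mono[OF abs_ge_self b(1)] mult_right_mono]) auto
      also have "\<dots> \<le> sqrt k * \<bar>z\<bar>" using nonexpansive_gauss_bound[OF ne(1) k(1), of x z] by simp
      also have "\<dots> \<le> 1 * \<bar>z\<bar>" using sqk by (intro mult_right_mono) auto
      finally show ?thesis by (simp add: algebra_simps flip: exp_add)
    qed
    \<comment> \<open>The normalisation is bounded below by the factor \<open>exp (b * H x)\<close>
      that also appears in \<open>wle\<close>, so quotients by \<open>W0\<close> are bounded
      independently of the size of \<open>H x\<close>.\<close>
    have W0ge: "exp (b * H x) \<le> W0"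
    proof -
      have "H x = gexp (\<lambda>z. H x + deriv H x * (z * sqrt k))"
        by (simp only: gexp_affine)
      also have "\<dots> \<le> gexp (\<lambda>z. H (x + z * sqrt k))"
      proof (rule gexp_mono)
        show "H x + deriv H x * (z * sqrt k) \<le> H (x + z * sqrt k)" for z
          using class_tangent[OF H, of x "x + z * sqrt k"] by simp
      qed (intro nonexpansive_integrable ne k Bochner_Integration.integrable_add integrable_gauss_const
            integrable_mult_right integrable_mult_left integrable_gauss_id)+
      also have "\<dots> \<le> G x" unfolding G_def using gauss_step_ge_shift[OF ne(1) k(1) b(1), of x 0] by simp
      finally have "H x \<le> G x" .
      show ?thesis
      proof (cases "b = 0")
        case True then show ?thesis by (simp add: W0_def)
      next
        case False
        have "exp (b * H x) \<le> exp (b * G x)" using \<open>H x \<le> G x\<close> b by (simp add: mult_left_mono)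
        then show ?thesis unfolding G_def W0_def exp_gauss_step[OF ne(1) k(1) False] .
      qed
    qed
    have ynorm: "x + (z + s) * sqrt k = y z" for z
    proof -
      have "s * sqrt k = b * v * (sqrt k * sqrt k)" by (simp add: s_def)
      then show ?thesis unfolding sqk(3) by (simp add: y_def algebra_simps)
    qed
    have vW0: "v * W0 = gexp (\<lambda>z. deriv H (x + z * sqrt k) * ?w z)"
      unfolding v_def G_def W0_def by (rule deriv_gauss_step[OF H k(1) b])
    \<comment> \<open>\<open>v\<close> is a weighted average of slopes of \<open>H\<close> at
      \<open>x + z * sqrt k\<close>, and each of them differs from \<open>r\<close> by at most (|z|
      + 1) sqrt k because the slope is 1-Lipschitz.\<close>
    have r_v: "\<bar>r - v\<bar> \<le> c1 * sqrt k"
    proof -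
      let ?f = "\<lambda>z. (deriv H (x + z * sqrt k) - r) * ?w z"
      have "(v - r) * W0 = gexp (\<lambda>z. deriv H (x + z * sqrt k) * ?w z) - gexp (\<lambda>z. r * ?w z)"
        using vW0 by (simp add: left_diff_distrib W0_def)
      also have "\<dots> = gexp (\<lambda>z. deriv H (x + z * sqrt k) * ?w z - r * ?w z)"
        by (intro Bochner_Integration.integral_diff[symmetric] integrable_mult_right 
            nonexpansive_integrable_exp ne k integrable_deriv_weight H)
      also have "\<dots> = gexp ?f" by (simp add: left_diff_distrib)
      also have "\<bar>\<dots>\<bar> \<le> (2 * sqrt k * exp (b * H x)) * E 2"
        unfolding E_def
      proof (rule gexp_abs_le)
        fix z
        have "\<bar>deriv H (x + z * sqrt k) - r\<bar> \<le> \<bar>z * sqrt k - b * v * k\<bar>"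
          using nonexpansiveD[OF ne(2), of "x + z * sqrt k" "y 0"] by (simp add: r_def y_def)
        also have "\<dots> \<le> \<bar>z * sqrt k\<bar> + \<bar>b * v * k\<bar>" by (rule abs_triangle_ineq4)
        also have "\<dots> \<le> \<bar>z\<bar> * sqrt k + 1 * sqrt k"
        proof -
          have "\<bar>b * v\<bar> * k \<le> 1 * sqrt k"
            using b v1 k sqk by (intro mult_mono) (auto simp: abs_mult intro: mult_le_one)
          then show ?thesis using k b by (simp add: abs_mult)
        qed
        also have "\<dots> = (\<bar>z\<bar> + 1) * sqrt k" by (simp add: algebra_simps)
        also have "\<dots> \<le> (2 * exp \<bar>z\<bar>) * sqrt k"
          using sqk abs_le_exp_abs[of z] by (intro mult_right_mono) (auto simp: one_le_exp_iff intro!: add_mono[of _ "exp \<bar>z\<bar>" _ "exp \<bar>z\<bar>", simplified])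
        finally have "\<bar>?f z\<bar> \<le> ((2 * exp \<bar>z\<bar>) * sqrt k) * (exp (b * H x) * exp \<bar>z\<bar>)"
          using wle[of z] k unfolding abs_mult abs_exp_cancel by (intro mult_mono) auto
        also have "\<dots> = (2 * sqrt k * exp (b * H x)) * (exp \<bar>z\<bar> * exp \<bar>z\<bar>)"
          by (simp only: mult_ac)
        also have "exp \<bar>z\<bar> * exp \<bar>z\<bar> = exp (2 * \<bar>z\<bar>)" by (simp add: mult_exp_exp)
        finally show "\<bar>?f z\<bar> \<le> (2 * sqrt k * exp (b * H x)) * exp (2 * \<bar>z\<bar>)" .
      qed measurable
      finally have "\<bar>v - r\<bar> * W0 \<le> (2 * sqrt k * exp (b * H x)) * E 2"
        using W0pos by (simp add: abs_mult)
      also have "\<dots> \<le> (2 * sqrt k * W0) * E 2"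
        using W0ge sqk E_pos[of 2] by (intro mult_right_mono mult_left_mono) auto
      finally have "\<bar>v - r\<bar> * W0 \<le> (c1 * sqrt k) * W0" by (simp add: c1_def mult_ac)
      then show ?thesis using W0pos by (simp add: abs_minus_commute)
    qed
    define X where "X z = H (y z) - H (y 0) - v * (z * sqrt k)" for z
    have [measurable]: "X \<in> borel_measurable borel" unfolding X_def by measurable
    have yy: "y z - y 0 = z * sqrt k" for z by (simp add: y_def)
    have zk2: "(z * sqrt k)\<^sup>2 = k * z\<^sup>2" for z using k by (simp add: power_mult_distrib mult.commute)
    have X1: "\<bar>X z\<bar> \<le> k * c2 * exp \<bar>z\<bar>" for z
    proof -
      have "\<bar>H (y z) - H (y 0) - r * (z * sqrt k)\<bar> \<le> k * z\<^sup>2 / 2"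
        using class_upper[OF H, of "y z" "y 0"] class_tangent[OF H, of "y 0" "y z"]
        unfolding yy zk2 r_def[symmetric] by linarith
      moreover have "\<bar>(r - v) * (z * sqrt k)\<bar> \<le> (c1 * sqrt k) * (\<bar>z\<bar> * sqrt k)"
        unfolding abs_mult using r_v sqk by (intro mult_mono) (auto simp: mult_right_mono)
      moreover have "(c1 * sqrt k) * (\<bar>z\<bar> * sqrt k) = c1 * k * \<bar>z\<bar>"
        using sqk(3) by (simp add: mult_ac)
      moreover have "X z = (H (y z) - H (y 0) - r * (z * sqrt k)) + (r - v) * (z * sqrt k)"
        by (simp add: X_def algebra_simps)
      ultimately have "\<bar>X z\<bar> \<le> k * (z\<^sup>2 / 2) + c1 * k * \<bar>z\<bar>" by linarith
      also have "\<dots> \<le> k * exp \<bar>z\<bar> + c1 * k * exp \<bar>z\<bar>"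
      proof (intro add_mono mult_left_mono abs_le_exp_abs)
        show "z\<^sup>2 / 2 \<le> exp \<bar>z\<bar>" using exp_lower_Taylor_quadratic[of "\<bar>z\<bar>"] by simp
      qed (use k c_pos in auto)
      finally show ?thesis by (simp add: c2_def algebra_simps)
    qed
    have X2: "\<bar>X z\<bar> \<le> 2 * \<bar>z\<bar>" for z
    proof -
      have "\<bar>X z\<bar> \<le> \<bar>H (y z) - H (y 0)\<bar> + \<bar>v\<bar> * \<bar>z * sqrt k\<bar>"
        unfolding X_def using abs_triangle_ineq4[of "H (y z) - H (y 0)" "v * (z * sqrt k)"] by (simp add: abs_mult)
      also have "\<dots> \<le> \<bar>z * sqrt k\<bar> + 1 * \<bar>z * sqrt k\<bar>"
        using nonexpansiveD[OF ne(1), of "y z" "y 0"] v1 unfolding yy by (intro add_mono mult_right_mono) auto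
      also have "\<dots> \<le> 2 * \<bar>z\<bar>" using sqk by (simp add: abs_mult mult_left_le)
      finally show ?thesis .
    qed
    have expX: "\<bar>exp (b * X z) - 1\<bar> \<le> k * c2 * exp (3 * \<bar>z\<bar>)" for z
    proof -
      have bX: "\<bar>b * X z\<bar> \<le> \<bar>X z\<bar>" using b by (simp add: abs_mult mult_left_le_one_le)
      have "\<bar>exp (b * X z) - 1\<bar> \<le> \<bar>b * X z\<bar> * exp \<bar>b * X z\<bar>" by (rule exp_minus_one_le)
      also have "\<dots> \<le> (k * c2 * exp \<bar>z\<bar>) * exp (2 * \<bar>z\<bar>)"
        using order_trans[OF bX X1[of z]] order_trans[OF bX X2[of z]] by (intro mult_mono) auto
      also have "\<dots> = k * c2 * exp (3 * \<bar>z\<bar>)" by (simp add: mult.assoc mult_exp_exp)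
      finally show ?thesis .
    qed
    have iX: "integrable std_normal_distribution X"
    proof (rule integrable_gaussI[where C="k * c2" and c=1])
      show "X \<in> borel_measurable borel" by measurable
    qed (use X1 in simp)
    have ieX1: "integrable std_normal_distribution (\<lambda>z. exp (b * X z) - 1)"
      by (rule integrable_gaussI[OF _ expX]) measurable
    have ieX: "integrable std_normal_distribution (\<lambda>z. exp (b * X z))"
      using Bochner_Integration.integrable_add[OF ieX1 integrable_gauss_const[of 1]] by simp
    define W where "W = gexp (\<lambda>z. exp (b * X z))"
    have EX: "gexp X = gexp (\<lambda>z. H (y z)) - H (y 0)"
    proof -
      have "gexp X = gexp (\<lambda>z. H (y z) - H (y 0)) - gexp (\<lambda>z. v * (z * sqrt k))"
        unfolding X_def y_def
        by (intro Bochner_Integration.integral_diff Bochner_Integration.integrable_diff 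
            integrable_gauss_const nonexpansive_integrable ne k integrable_mult_right integrable_mult_left integrable_gauss_id)
      also have "gexp (\<lambda>z. H (y z) - H (y 0)) = gexp (\<lambda>z. H (y z)) - gexp (\<lambda>z. H (y 0))"
        unfolding y_def
        by (intro Bochner_Integration.integral_diff integrable_gauss_const nonexpansive_integrable ne k)
      finally show ?thesis by (simp add: gexp_id)
    qed
    \<comment> \<open>Convexity at \<open>y 0\<close>: \<open>X\<close> lies above a linear function
      of mean zero. Hence \<open>W >= 1\<close>, which permits division by \<open>W\<close> and
      keeps its logarithm meaningful.\<close>
    have EX0: "0 \<le> gexp X"
    proof -
      have "gexp (\<lambda>z. (r - v) * (z * sqrt k)) \<le> gexp X"
      proof (rule gexp_mono[OF _ iX])
        fix z show "(r - v) * (z * sqrt k) \<le> X z"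
          using class_tangent[OF H, of "y 0" "y z"] unfolding yy r_def[symmetric] X_def by (simp add: left_diff_distrib)
      qed (intro integrable_mult_right integrable_mult_left integrable_gauss_id)
      then show ?thesis by (simp add: gexp_id)
    qed
    have W1: "1 \<le> W"
    proof -
      have "exp (gexp (\<lambda>z. b * X z)) \<le> W"
        unfolding W_def by (intro gexp_Jensen_exp ieX integrable_mult_right iX)
      moreover have "1 \<le> exp (gexp (\<lambda>z. b * X z))" using EX0 b by simp
      ultimately show ?thesis by linarith
    qed
    have W2: "\<bar>W - 1\<bar> \<le> k * c2 * E 3"
    proof -
      have "W - 1 = gexp (\<lambda>z. exp (b * X z) - 1)"
        unfolding W_def by (subst Bochner_Integration.integral_diff[OF ieX integrable_gauss_const]) simp
      then show ?thesis unfolding E_def using gexp_abs_le[OF _ expX] by simp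
    qed
    \<comment> \<open>The density factor of the shift cancels the linear part of
      \<open>b * H\<close> exactly, because \<open>X\<close> was formed with the slope
      \<open>v\<close> and not with the local slope \<open>r\<close>. Only \<open>b * X\<close>
      remains.\<close>
    have tilt: "exp (b * H (y z)) * exp (- s * z - s\<^sup>2 / 2) = exp (b * H (y 0) - s\<^sup>2 / 2) * exp (b * X z)" for z
    proof -
      have sz: "s * z = b * (v * (z * sqrt k))" by (simp add: s_def)
      have "b * H (y z) + (- s * z - s\<^sup>2 / 2) = (b * H (y 0) - s\<^sup>2 / 2) + b * X z"
        unfolding X_def right_diff_distrib sz[symmetric] by simp
      then show ?thesis by (simp only: exp_add[symmetric])
    qed
    have W0W: "W0 = exp (b * H (y 0) - s\<^sup>2 / 2) * W"
    proof -
      have "W0 = gexp (\<lambda>z. ?w (z + s) * exp (- s * z - s\<^sup>2 / 2))"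
        unfolding W0_def by (rule gexp_shift[symmetric]) measurable
      then show ?thesis unfolding ynorm tilt by (simp add: W_def)
    qed
    have vW: "v * W = gexp (\<lambda>z. deriv H (y z) * exp (b * X z))"
    proof -
      have "v * W0 = gexp (\<lambda>z. (deriv H (x + (z + s) * sqrt k) * ?w (z + s)) * exp (- s * z - s\<^sup>2 / 2))"
        unfolding vW0 by (rule gexp_shift[symmetric]) measurable
      also have "\<dots> = gexp (\<lambda>z. exp (b * H (y 0) - s\<^sup>2 / 2) * (deriv H (y z) * exp (b * X z)))"
        unfolding ynorm mult.assoc tilt by (simp add: mult_ac)
      finally have "v * W0 = exp (b * H (y 0) - s\<^sup>2 / 2) * gexp (\<lambda>z. deriv H (y z) * exp (b * X z))" by simp
      then show ?thesis unfolding W0W by simp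
    qed
    have s2: "s\<^sup>2 = b * (b * v\<^sup>2 * k)" using k by (simp add: s_def power_mult_distrib power2_eq_square)
    have "G x \<le> gexp (\<lambda>z. H (y z)) - b * v\<^sup>2 * k / 2 + C1 * k\<^sup>2"
    proof (cases "b = 0")
      case True
      have "G x = gexp (\<lambda>z. H (y z))" unfolding G_def y_def True gauss_step_0 by simp
      then show ?thesis using True E_pos[of 4] by (simp add: C1_def)
    next
      case False
      have quad: "(X z)\<^sup>2 * exp \<bar>X z\<bar> \<le> (k * c2)\<^sup>2 * exp (4 * \<bar>z\<bar>)" for z
      proof -
        have "(X z)\<^sup>2 \<le> (k * c2 * exp \<bar>z\<bar>)\<^sup>2"
          by (rule abs_le_square_iff[THEN iffD1]) (use X1[of z] k c_pos in \<open>simp add: abs_mult\<close>)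
        then have "(X z)\<^sup>2 * exp \<bar>X z\<bar> \<le> (k * c2 * exp \<bar>z\<bar>)\<^sup>2 * exp (2 * \<bar>z\<bar>)"
          using X2[of z] by (intro mult_mono) auto
        also have "\<dots> = (k * c2)\<^sup>2 * (exp \<bar>z\<bar> * exp \<bar>z\<bar> * exp (2 * \<bar>z\<bar>))"
          by (simp only: power2_eq_square mult_ac)
        also have "exp \<bar>z\<bar> * exp \<bar>z\<bar> * exp (2 * \<bar>z\<bar>) = exp (4 * \<bar>z\<bar>)" by (simp add: mult_exp_exp)
        finally show ?thesis .
      qed
      \<comment> \<open>One factor \<open>b\<close> is kept in front of the quadratic remainder: the
        value of the step results from a division by \<open>b\<close>, and the error must stay
        uniform as \<open>b\<close> tends to 0.\<close>
      have "W \<le> gexp (\<lambda>z. (1 + b * X z) + b * ((k * c2)\<^sup>2 * exp (4 * \<bar>z\<bar>)))"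
        unfolding W_def
      proof (rule gexp_mono[OF ieX])
        fix z
        have "exp (b * X z) \<le> 1 + b * X z + (b * X z)\<^sup>2 / 2 * exp \<bar>b * X z\<bar>" by (rule exp_second_order_le)
        also have "\<dots> \<le> 1 + b * X z + b * ((X z)\<^sup>2 * exp \<bar>X z\<bar>)"
        proof -
          have "(b * X z)\<^sup>2 / 2 \<le> b * (X z)\<^sup>2"
          proof -
            have "b * b \<le> b * 2" using b by (intro mult_left_mono) auto
            from mult_right_mono[OF this, of "(X z)\<^sup>2"] show ?thesis by (simp add: power2_eq_square algebra_simps)
          qed
          moreover have "exp \<bar>b * X z\<bar> \<le> exp \<bar>X z\<bar>" using b by (simp add: abs_mult mult_left_le_one_le)
          ultimately have "(b * X z)\<^sup>2 / 2 * exp \<bar>b * X z\<bar> \<le> (b * (X z)\<^sup>2) * exp \<bar>X z\<bar>"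
            using b by (intro mult_mono) auto
          then show ?thesis by (simp add: mult.assoc)
        qed
        also have "\<dots> \<le> (1 + b * X z) + b * ((k * c2)\<^sup>2 * exp (4 * \<bar>z\<bar>))"
          using quad[of z] b by (intro add_left_mono mult_left_mono) auto
        finally show "exp (b * X z) \<le> (1 + b * X z) + b * ((k * c2)\<^sup>2 * exp (4 * \<bar>z\<bar>))" .
      qed (intro Bochner_Integration.integrable_add integrable_gauss_const integrable_mult_right iX integrable_exp_abs_gauss)
      also have "\<dots> = gexp (\<lambda>z. 1 + b * X z) + gexp (\<lambda>z. b * ((k * c2)\<^sup>2 * exp (4 * \<bar>z\<bar>)))"
        by (intro Bochner_Integration.integral_add Bochner_Integration.integrable_add integrable_gauss_const integrable_mult_right iX integrable_exp_abs_gauss)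
      also have "\<dots> = 1 + b * gexp X + b * ((k * c2)\<^sup>2 * E 4)"
        by (subst Bochner_Integration.integral_add) (auto intro!: integrable_gauss_const integrable_mult_right iX simp: E_def)
      finally have W3: "W - 1 \<le> b * (gexp X + C1 * k\<^sup>2)" by (simp add: C1_def algebra_simps)
      have "exp (b * G x) = exp (b * H (y 0) - s\<^sup>2 / 2) * W"
        unfolding G_def exp_gauss_step[OF ne(1) k(1) False] using W0W by (simp add: W0_def)
      also have "\<dots> = exp (b * H (y 0) - s\<^sup>2 / 2 + ln W)" using W1 by (simp add: exp_add)
      finally have "b * G x = b * H (y 0) - s\<^sup>2 / 2 + ln W" by simp
      also have "ln W \<le> W - 1" using W1 by (intro ln_le_minus_one) auto
      also note W3
      finally have "b * G x \<le> b * (H (y 0) - b * v\<^sup>2 * k / 2 + gexp X + C1 * k\<^sup>2)"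
        unfolding s2 by (simp add: algebra_simps)
      then show ?thesis using b False EX by simp
    qed
    moreover have "\<bar>gexp (\<lambda>z. deriv H (y z)) - v\<bar> \<le> C2 * (k * sqrt k)"
    proof -
      let ?d = "\<lambda>z. deriv H (y z)"
      have id: "integrable std_normal_distribution ?d"
        unfolding y_def by (intro nonexpansive_integrable ne k)
      have ide: "integrable std_normal_distribution (\<lambda>z. ?d z * exp (b * X z))"
      proof (rule Bochner_Integration.integrable_bound[OF ieX])
        show "AE z in std_normal_distribution. norm (?d z * exp (b * X z)) \<le> norm (exp (b * X z))"
          using class_deriv_abs_le[OF H] by (intro AE_I2) (auto simp: abs_mult mult_le_cancel_right1)
      qed measurable
      \<comment> \<open>A covariance: its mean is W (v - mean slope), while its two factors are of
        order sqrt k and k. Their product is the claimed order k sqrt k.\<close>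
      let ?f = "\<lambda>z. (?d z - r) * (exp (b * X z) - W)"
      have "gexp ?f = gexp (\<lambda>z. (?d z * exp (b * X z) - r * exp (b * X z)) - (W * ?d z - W * r))"
        by (simp add: algebra_simps)
      also have "\<dots> = (gexp (\<lambda>z. ?d z * exp (b * X z)) - r * W) - (W * gexp ?d - W * r)"
      proof -
        have i1: "integrable std_normal_distribution (\<lambda>z. ?d z * exp (b * X z) - r * exp (b * X z))"
          "integrable std_normal_distribution (\<lambda>z. W * ?d z - W * r)"
          by (intro Bochner_Integration.integrable_diff integrable_mult_right id ide ieX integrable_gauss_const)+
        have "gexp (\<lambda>z. ?d z * exp (b * X z) - r * exp (b * X z)) = gexp (\<lambda>z. ?d z * exp (b * X z)) - gexp (\<lambda>z. r * exp (b * X z))"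
          by (intro Bochner_Integration.integral_diff integrable_mult_right ide ieX)
        moreover have "gexp (\<lambda>z. W * ?d z - W * r) = gexp (\<lambda>z. W * ?d z) - gexp (\<lambda>z. W * r)"
          by (intro Bochner_Integration.integral_diff integrable_mult_right id integrable_gauss_const)
        ultimately show ?thesis using Bochner_Integration.integral_diff[OF i1] by (simp add: W_def)
      qed
      also have "\<dots> = W * (v - gexp ?d)" unfolding vW[symmetric] by (simp add: algebra_simps)
      finally have "W * \<bar>v - gexp ?d\<bar> = \<bar>gexp ?f\<bar>" using W1 by (simp add: abs_mult)
      also have "\<dots> \<le> (sqrt k * (k * c2) * (1 + E 3)) * E 4"
        unfolding E_def[of 4]
      proof (rule gexp_abs_le)
        fix z
        have d: "\<bar>?d z - r\<bar> \<le> exp \<bar>z\<bar> * sqrt k"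
        proof -
          have "\<bar>?d z - r\<bar> \<le> \<bar>z * sqrt k\<bar>"
            using nonexpansiveD[OF ne(2), of "y z" "y 0"] unfolding yy r_def .
          also have "\<dots> \<le> exp \<bar>z\<bar> * sqrt k" using abs_le_exp_abs[of z] sqk by (auto simp: abs_mult intro: mult_right_mono)
          finally show ?thesis .
        qed
        have "\<bar>exp (b * X z) - W\<bar> \<le> \<bar>exp (b * X z) - 1\<bar> + \<bar>W - 1\<bar>" by linarith
        also have "\<dots> \<le> k * c2 * exp (3 * \<bar>z\<bar>) + k * c2 * E 3 * exp (3 * \<bar>z\<bar>)"
        proof (rule add_mono[OF expX])
          have "\<bar>W - 1\<bar> \<le> k * c2 * E 3 * 1" using W2 by simp
          also have "\<dots> \<le> k * c2 * E 3 * exp (3 * \<bar>z\<bar>)"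
            using k c_pos E_pos[of 3] by (intro mult_left_mono) auto
          finally show "\<bar>W - 1\<bar> \<le> k * c2 * E 3 * exp (3 * \<bar>z\<bar>)" .
        qed
        also have "\<dots> = (k * c2) * (1 + E 3) * exp (3 * \<bar>z\<bar>)" by (simp add: algebra_simps)
        finally have "\<bar>?f z\<bar> \<le> (exp \<bar>z\<bar> * sqrt k) * ((k * c2) * (1 + E 3) * exp (3 * \<bar>z\<bar>))"
          unfolding abs_mult using d k by (intro mult_mono) auto
        also have "\<dots> = (sqrt k * (k * c2) * (1 + E 3)) * (exp \<bar>z\<bar> * exp (3 * \<bar>z\<bar>))" by (simp only: mult_ac)
        also have "exp \<bar>z\<bar> * exp (3 * \<bar>z\<bar>) = exp (4 * \<bar>z\<bar>)" by (simp add: mult_exp_exp)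
        finally show "\<bar>?f z\<bar> \<le> (sqrt k * (k * c2) * (1 + E 3)) * exp (4 * \<bar>z\<bar>)" .
      qed measurable
      also have "\<dots> = C2 * (k * sqrt k)" by (simp add: C2_def mult_ac)
      finally have "W * \<bar>v - gexp ?d\<bar> \<le> C2 * (k * sqrt k)" .
      moreover have "1 * \<bar>v - gexp ?d\<bar> \<le> W * \<bar>v - gexp ?d\<bar>" using W1 by (intro mult_right_mono) auto
      ultimately show ?thesis by (simp add: abs_minus_commute)
    qed
    ultimately show ?thesis by (simp add: G_def v_def y_def)
  qed
  show ?thesis
  proof (rule that[of C])
    show "0 \<le> C" using E_pos[of 4] by (simp add: C_def C1_def le_max_iff_disj)
  next
    fix H and b k x :: real assume A: "H \<in> parisi_class" "0 \<le> b" "b \<le> 1" "0 \<le> k" "k \<le> (1::real)"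
    have "C1 * k\<^sup>2 \<le> C * k\<^sup>2" by (intro mult_right_mono) (auto simp: C_def)
    then show "gauss_step b k H x \<le> gexp (\<lambda>z. H (x + b * deriv (gauss_step b k H) x * k + z * sqrt k)) 
          - b * (deriv (gauss_step b k H) x)\<^sup>2 * k / 2 + C * k\<^sup>2"
      using both[OF A, of x] by linarith
  next
    fix H and b k x :: real assume A: "H \<in> parisi_class" "0 \<le> b" "b \<le> 1" "0 \<le> k" "k \<le> (1::real)"
    have "C2 * (k * sqrt k) \<le> C * (k * sqrt k)" using A by (intro mult_right_mono) (auto simp: C_def)
    then show "\<bar>gexp (\<lambda>z. deriv H (x + b * deriv (gauss_step b k H) x * k + z * sqrt k)) - deriv (gauss_step b k H) x\<bar> 
        \<le> C * (k * sqrt k)"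
      using both[OF A, of x] by linarith
  qed
qed

section \<open>Comparison of two recursions\<close>

text \<open>The variance is at most the mean square distance from \<open>f w\<close>, hence at most
  \<open>k\<close> for a 1-Lipschitz function. Applied to slopes, this is the growth of E v^2 over
  one step, with \<open>k\<close> the increment of \<xi>'.\<close>

lemma gexp_square_nonexpansive:
  assumes f: "nonexpansive f" and k: "0 \<le> k"
  shows "(gexp (\<lambda>z. f (w + z * sqrt k)))\<^sup>2 \<le> gexp (\<lambda>z. (f (w + z * sqrt k))\<^sup>2)"
    and "gexp (\<lambda>z. (f (w + z * sqrt k))\<^sup>2) \<le> (gexp (\<lambda>z. f (w + z * sqrt k)))\<^sup>2 + k"
    and "integrable std_normal_distribution (\<lambda>z. (f (w + z * sqrt k))\<^sup>2)"
proof -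
  let ?N = std_normal_distribution
  let ?f = "\<lambda>z. f (w + z * sqrt k)" and ?r = "f w"
  note [measurable] = nonexpansive_measurable[OF f]
  have i1: "integrable ?N ?f" by (rule nonexpansive_integrable[OF f k])
  have le: "(?f z - ?r)\<^sup>2 \<le> k * z\<^sup>2" for z
  proof -
    have "(?f z - ?r)\<^sup>2 \<le> (sqrt k * \<bar>z\<bar>)\<^sup>2"
      using nonexpansive_gauss_bound[OF f k, of w z] k by (intro abs_le_square_iff[THEN iffD1]) (simp add: abs_mult)
    then show ?thesis using k by (simp add: power_mult_distrib)
  qed
  have i2: "integrable ?N (\<lambda>z. (?f z - ?r)\<^sup>2)"
  proof (rule Bochner_Integration.integrable_bound)
    show "integrable ?N (\<lambda>z. k * z\<^sup>2)" by (intro integrable_mult_right integrable_gauss_square)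
    show "AE z in ?N. norm ((?f z - ?r)\<^sup>2) \<le> norm (k * z\<^sup>2)" using le k by (intro AE_I2) auto
  qed measurable
  have sq: "(?f z)\<^sup>2 = (?f z - ?r)\<^sup>2 + (2 * ?r * ?f z - ?r\<^sup>2)" for z
    by (simp add: power2_eq_square algebra_simps)
  have i3: "integrable ?N (\<lambda>z. 2 * ?r * ?f z - ?r\<^sup>2)"
    by (intro Bochner_Integration.integrable_diff integrable_mult_right i1 integrable_gauss_const)
  show i4: "integrable ?N (\<lambda>z. (?f z)\<^sup>2)"
    unfolding sq by (intro Bochner_Integration.integrable_add i2 i3)
  let ?m = "gexp ?f"
  have e3: "gexp (\<lambda>z. 2 * c * ?f z - c\<^sup>2) = 2 * c * ?m - c\<^sup>2" for c
    using Bochner_Integration.integral_diff[OF integrable_mult_right[OF i1, of "2 * c"] integrable_gauss_const[of "c\<^sup>2"]] by simp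
  have "gexp (\<lambda>z. (?f z)\<^sup>2) = gexp (\<lambda>z. (?f z - ?r)\<^sup>2) + (2 * ?r * ?m - ?r\<^sup>2)"
    unfolding e3[symmetric] Bochner_Integration.integral_add[OF i2 i3, symmetric] sq ..
  also have "gexp (\<lambda>z. (?f z - ?r)\<^sup>2) \<le> gexp (\<lambda>z. k * z\<^sup>2)"
    by (intro gexp_mono i2 le integrable_mult_right integrable_gauss_square)
  also have "\<dots> = k" using gexp_square by simp
  also have "2 * ?r * ?m - ?r\<^sup>2 \<le> ?m\<^sup>2"
    using zero_le_power2[of "?m - ?r"] by (simp add: power2_eq_square algebra_simps)
  finally show "gexp (\<lambda>z. (?f z)\<^sup>2) \<le> ?m\<^sup>2 + k" by simp
  have "2 * ?m * ?m - ?m\<^sup>2 \<le> gexp (\<lambda>z. (?f z)\<^sup>2)"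
    unfolding e3[symmetric]
  proof (rule gexp_mono[OF _ i4])
    show "2 * ?m * ?f z - ?m\<^sup>2 \<le> (?f z)\<^sup>2" for z
      using zero_le_power2[of "?f z - ?m"] by (simp add: power2_eq_square algebra_simps)
  qed (intro Bochner_Integration.integrable_diff integrable_mult_right i1 integrable_gauss_const)
  then show "?m\<^sup>2 \<le> gexp (\<lambda>z. (?f z)\<^sup>2)" by (simp add: power2_eq_square)
qed

text \<open>The displacement \<open>D\<close> is the accumulated difference of the drifts of the two optimally
  controlled diffusions behind \<open>H\<close> and \<open>F\<close>; a pointwise bound on \<^term>\<open>H x - F x\<close> alone would not
  propagate through the recursion.\<close>

definition dominated_upto ::
  "real \<Rightarrow> (real \<Rightarrow> real) \<Rightarrow> (real \<Rightarrow> real) \<Rightarrow> real \<Rightarrow> real \<Rightarrow> bool" where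
  "dominated_upto D0 F H A B \<longleftrightarrow>
    (\<forall>x D. \<bar>D\<bar> \<le> D0 \<longrightarrow> H x - F (x - D) \<le> D * deriv H x + A / 2 * (deriv H x)\<^sup>2 + B / 2)"

text \<open>Both functions are controlled by the same slope \<open>v\<close>, that of the step of
  \<open>H\<close>. The drift difference feeds \<open>A\<close>; the growth of the second moment of
  the slope feeds \<open>B\<close>, but only through a positive \<open>A\<close>, since for negative
  \<open>A\<close> Jensen's inequality already suffices. The admissible displacement shrinks by
  \<open>k\<close> because the drift difference moves \<open>D\<close> by at most that much. The
  error k sqrt k is small enough to be summed over h/k steps.\<close>

lemma small_dominated_step:
  obtains C where "0 \<le> C" and
    "\<And>F H A B D0 a b k \<delta>. F \<in> parisi_class \<Longrightarrow> H \<in> parisi_class \<Longrightarrow> 0 \<le> a \<Longrightarrow> a \<le> 1 \<Longrightarrow> 0 \<le> b \<Longrightarrow> b \<le> 1 \<Longrightarrow>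
      0 \<le> k \<Longrightarrow> k \<le> 1 \<Longrightarrow> b - a \<le> \<delta> \<Longrightarrow> 0 \<le> D0 \<Longrightarrow> dominated_upto (D0 + k) F H A B \<Longrightarrow>
      dominated_upto D0 (gauss_step a k F) (gauss_step b k H) (A + \<delta> * k)
        (B + max 0 A * k + C * (1 + \<bar>A\<bar> + D0) * (k * sqrt k))"
proof -
  obtain C0 where C0: "0 \<le> C0" and
    step1: "\<And>H b k x. H \<in> parisi_class \<Longrightarrow> 0 \<le> b \<Longrightarrow> b \<le> 1 \<Longrightarrow> 0 \<le> k \<Longrightarrow> k \<le> 1 \<Longrightarrow>
      gauss_step b k H x \<le> gexp (\<lambda>z. H (x + b * deriv (gauss_step b k H) x * k + z * sqrt k)) 
          - b * (deriv (gauss_step b k H) x)\<^sup>2 * k / 2 + C0 * k\<^sup>2" and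
    step2: "\<And>H b k x. H \<in> parisi_class \<Longrightarrow> 0 \<le> b \<Longrightarrow> b \<le> 1 \<Longrightarrow> 0 \<le> k \<Longrightarrow> k \<le> 1 \<Longrightarrow>
      \<bar>gexp (\<lambda>z. deriv H (x + b * deriv (gauss_step b k H) x * k + z * sqrt k)) - deriv (gauss_step b k H) x\<bar> 
        \<le> C0 * (k * sqrt k)"
    by (rule small_gauss_step) blast
  show ?thesis
  proof (rule that[of "4 * C0"])
    fix F H A B D0 and a b k \<delta> :: real
    assume F: "F \<in> parisi_class" and H: "H \<in> parisi_class" and a: "0 \<le> a" "a \<le> 1" and b: "0 \<le> b" "b \<le> 1"
      and k: "0 \<le> k" "k \<le> 1" and \<delta>: "b - a \<le> \<delta>" and D0: "0 \<le> D0" and dom: "dominated_upto (D0 + k) F H A B"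
    let ?N = std_normal_distribution
    note neF = class_nonexpansive[OF F] and neH = class_nonexpansive[OF H] class_deriv_nonexpansive[OF H]
    show "dominated_upto D0 (gauss_step a k F) (gauss_step b k H) (A + \<delta> * k)
        (B + max 0 A * k + 4 * C0 * (1 + \<bar>A\<bar> + D0) * (k * sqrt k))"
      unfolding dominated_upto_def
    proof (intro allI impI)
      fix x D :: real assume D: "\<bar>D\<bar> \<le> D0"
      define v where "v = deriv (gauss_step b k H) x"
      have v1: "\<bar>v\<bar> \<le> 1" unfolding v_def by (rule class_deriv_abs_le[OF gauss_step_class[OF H k(1) b]])
      let ?y = "\<lambda>z. x + b * v * k + z * sqrt k"
      \<comment> \<open>Under \<open>H\<close> the drift is \<open>b * v\<close>, under
        \<open>F\<close> it is \<open>a * v\<close>, and the discrepancy is added to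
        \<open>D\<close>. It contributes (b - a) v^2 k to the difference; the drift costs take back
        half of that, so A/2 grows by at most \<delta> k/2.\<close>
      define D' where "D' = D + (b - a) * v * k"
      have "\<bar>(b - a) * v\<bar> \<le> 1 * 1" unfolding abs_mult using a b v1 by (intro mult_mono) auto
      then have "\<bar>(b - a) * v * k\<bar> \<le> 1 * k" unfolding abs_mult[of _ k] using k by (intro mult_mono) auto
      then have D': "\<bar>D'\<bar> \<le> D0 + k" using D unfolding D'_def by linarith
      define e where "e = C0 * (k * sqrt k)"
      have e0: "0 \<le> e" using C0 k by (simp add: e_def)
      define M where "M = gexp (\<lambda>z. deriv H (?y z))"
      define Q where "Q = gexp (\<lambda>z. (deriv H (?y z))\<^sup>2)"
      have M: "\<bar>M - v\<bar> \<le> e" unfolding M_def e_def v_def by (rule step2[OF H b k])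
      have Q: "M\<^sup>2 \<le> Q" "Q \<le> M\<^sup>2 + k" and iQ: "integrable ?N (\<lambda>z. (deriv H (?y z))\<^sup>2)"
        unfolding M_def Q_def by (rule gexp_square_nonexpansive[OF neH(2) k(1)])+
      have iM: "integrable ?N (\<lambda>z. deriv H (?y z))" by (rule nonexpansive_integrable[OF neH(2) k(1)])
      have iH: "integrable ?N (\<lambda>z. H (?y z))" by (rule nonexpansive_integrable[OF neH(1) k(1)])
      have iF: "integrable ?N (\<lambda>z. F (x - D + a * v * k + z * sqrt k))" by (rule nonexpansive_integrable[OF neF k(1)])
      have M1: "\<bar>M\<bar> \<le> 1"
      proof -
        have "\<bar>M\<bar> \<le> gexp (\<lambda>z. \<bar>deriv H (?y z)\<bar>)" unfolding M_def by (rule integral_abs_bound)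
        also have "\<dots> \<le> gexp (\<lambda>z. 1)"
          by (intro gexp_mono integrable_abs iM integrable_gauss_const class_deriv_abs_le H)
        finally show ?thesis by simp
      qed
      have "\<bar>M\<^sup>2 - v\<^sup>2\<bar> = \<bar>M - v\<bar> * \<bar>M + v\<bar>" by (simp add: power2_eq_square algebra_simps flip: abs_mult)
      also have "\<dots> \<le> e * 2" using M M1 v1 by (intro mult_mono) auto
      finally have Mv: "\<bar>M\<^sup>2 - v\<^sup>2\<bar> \<le> 2 * e" by simp
      have 1: "gauss_step b k H x \<le> gexp (\<lambda>z. H (?y z)) - b * v\<^sup>2 * k / 2 + C0 * k\<^sup>2"
        unfolding v_def by (rule step1[OF H b k])
      have 2: "gexp (\<lambda>z. F (x - D + a * v * k + z * sqrt k)) - a * v\<^sup>2 * k / 2 \<le> gauss_step a k F (x - D)"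
        by (rule gauss_step_ge_shift[OF neF k(1) a(1)])
      have 3: "gexp (\<lambda>z. H (?y z)) - gexp (\<lambda>z. F (x - D + a * v * k + z * sqrt k)) \<le> D' * M + A / 2 * Q + B / 2"
      proof -
        have "gexp (\<lambda>z. H (?y z)) - gexp (\<lambda>z. F (x - D + a * v * k + z * sqrt k)) 
            = gexp (\<lambda>z. H (?y z) - F (x - D + a * v * k + z * sqrt k))"
          by (rule Bochner_Integration.integral_diff[OF iH iF, symmetric])
        also have "\<dots> \<le> gexp (\<lambda>z. (D' * deriv H (?y z) + A / 2 * (deriv H (?y z))\<^sup>2) + B / 2)"
        proof (rule gexp_mono)
          fix z
          have "x - D + a * v * k + z * sqrt k = ?y z - D'" by (simp add: D'_def algebra_simps)
          from this[symmetric] show "H (?y z) - F (x - D + a * v * k + z * sqrt k) \<le> (D' * deriv H (?y z) + A / 2 * (deriv H (?y z))\<^sup>2) + B / 2"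
            using dom[unfolded dominated_upto_def, rule_format, of D' "?y z", OF D'] by (simp only:)
        qed (intro Bochner_Integration.integrable_diff Bochner_Integration.integrable_add integrable_mult_right iH iF iM iQ integrable_gauss_const)+
        also have "\<dots> = gexp (\<lambda>z. D' * deriv H (?y z) + A / 2 * (deriv H (?y z))\<^sup>2) + gexp (\<lambda>z. B / 2)"
          by (intro Bochner_Integration.integral_add Bochner_Integration.integrable_add integrable_mult_right iM iQ integrable_gauss_const)
        also have "gexp (\<lambda>z. D' * deriv H (?y z) + A / 2 * (deriv H (?y z))\<^sup>2) 
            = gexp (\<lambda>z. D' * deriv H (?y z)) + gexp (\<lambda>z. A / 2 * (deriv H (?y z))\<^sup>2)"
          by (intro Bochner_Integration.integral_add integrable_mult_right iM iQ)
        finally show ?thesis by (simp add: M_def Q_def)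
      qed
      have 4: "D' * M \<le> D * v + (b - a) * v\<^sup>2 * k + (D0 + k) * e"
      proof -
        have "D' * M = D' * v + D' * (M - v)" by (simp add: algebra_simps)
        also have "D' * (M - v) \<le> \<bar>D'\<bar> * \<bar>M - v\<bar>" by (simp add: abs_mult[symmetric])
        also have "\<dots> \<le> (D0 + k) * e" using D' M by (intro mult_mono) auto
        finally show ?thesis by (simp add: D'_def power2_eq_square algebra_simps)
      qed
      have 5: "A / 2 * Q \<le> A / 2 * v\<^sup>2 + \<bar>A\<bar> * e + max 0 A * k / 2"
      proof -
        have "A * (M\<^sup>2 - v\<^sup>2) \<le> \<bar>A\<bar> * \<bar>M\<^sup>2 - v\<^sup>2\<bar>" by (simp add: abs_mult[symmetric])
        also have "\<dots> \<le> \<bar>A\<bar> * (2 * e)" using Mv by (intro mult_left_mono) auto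
        finally have "A * (M\<^sup>2 - v\<^sup>2) \<le> \<bar>A\<bar> * (2 * e)" .
        moreover have "A * (Q - M\<^sup>2) \<le> max 0 A * k"
          using Q k by (cases "0 \<le> A") (auto simp: max_def mult_left_mono mult_nonpos_nonneg)
        ultimately show ?thesis by (simp add: algebra_simps)
      qed
      have 6: "(b - a) * v\<^sup>2 * k \<le> \<delta> * k * v\<^sup>2"
        using \<delta> k by (simp add: mult_right_mono mult.assoc mult.commute[of k])
      have 7: "C0 * k\<^sup>2 + (D0 + k) * e + \<bar>A\<bar> * e \<le> 2 * C0 * (1 + \<bar>A\<bar> + D0) * (k * sqrt k)"
      proof -
        have "k \<le> sqrt k" using k by (simp add: real_le_rsqrt power2_eq_square mult_left_le)
        then have "k * k \<le> k * sqrt k" using k by (intro mult_left_mono) auto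
        then have "C0 * k\<^sup>2 \<le> e" unfolding e_def power2_eq_square using C0 by (rule mult_left_mono)
        moreover have "k * e \<le> e" using k e0 by (simp add: mult_left_le_one_le)
        moreover have "0 \<le> D0 * e" "0 \<le> \<bar>A\<bar> * e" using D0 e0 by auto
        ultimately have "C0 * k\<^sup>2 + (D0 + k) * e + \<bar>A\<bar> * e \<le> 2 * (1 + \<bar>A\<bar> + D0) * e"
          by (simp add: algebra_simps)
        then show ?thesis by (simp add: e_def mult_ac)
      qed
      have "gauss_step b k H x - gauss_step a k F (x - D) 
        \<le> D * v + (A / 2 * v\<^sup>2 + (b - a) * v\<^sup>2 * k / 2) + (B / 2 + max 0 A * k / 2) + (C0 * k\<^sup>2 + (D0 + k) * e + \<bar>A\<bar> * e)"
      proof -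
        have "(b - a) * v\<^sup>2 * k = b * v\<^sup>2 * k - a * v\<^sup>2 * k" by (simp add: left_diff_distrib)
        with 1 2 3 4 5 show ?thesis by linarith
      qed
      also have "\<dots> \<le> D * v + (A / 2 * v\<^sup>2 + \<delta> * k * v\<^sup>2 / 2) + (B / 2 + max 0 A * k / 2) + 2 * C0 * (1 + \<bar>A\<bar> + D0) * (k * sqrt k)"
        using 6 7 by linarith
      also have "\<dots> = D * v + (A + \<delta> * k) / 2 * v\<^sup>2 + (B + max 0 A * k + 4 * C0 * (1 + \<bar>A\<bar> + D0) * (k * sqrt k)) / 2"
        by (simp add: algebra_simps add_divide_distrib)
      finally show "gauss_step b k H x - gauss_step a k F (x - D) \<le> D * deriv (gauss_step b k H) x 
          + (A + \<delta> * k) / 2 * (deriv (gauss_step b k H) x)\<^sup>2 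
          + (B + max 0 A * k + 4 * C0 * (1 + \<bar>A\<bar> + D0) * (k * sqrt k)) / 2"
        unfolding v_def .
    qed
  qed (use C0 in simp)
qed

text \<open>No bound on the displacement: the error terms of a short step grow with
  \<open>D0\<close>, but for each fixed displacement they vanish with the mesh.\<close>

definition dominated :: "(real \<Rightarrow> real) \<Rightarrow> (real \<Rightarrow> real) \<Rightarrow> real \<Rightarrow> real \<Rightarrow> bool" where
  "dominated F H A B \<longleftrightarrow>
    (\<forall>x D. H x - F (x - D) \<le> D * deriv H x + A / 2 * (deriv H x)\<^sup>2 + B / 2)"

lemma dominated_imp_upto: "dominated F H A B \<Longrightarrow> dominated_upto D0 F H A B"
  by (simp add: dominated_def dominated_upto_def)

lemma dominated_refl: "H \<in> parisi_class \<Longrightarrow> dominated H H 0 0"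
  unfolding dominated_def
proof (intro allI)
  fix x D assume "H \<in> parisi_class"
  from class_tangent[OF this, of x "x - D"] 
  show "H x - H (x - D) \<le> D * deriv H x + 0 / 2 * (deriv H x)\<^sup>2 + 0 / 2" by (simp add: mult.commute)
qed

text \<open>A step of length \<open>h\<close> is cut into \<open>n\<close> equal ones by the
  semigroup property. The errors add up to a multiple of h sqrt (h/n) and disappear in the limit,
  while \<open>S\<close> bounds the Riemann sums of the positive part of A + \<delta> t, the
  accumulated variance growth.\<close>

lemma dominated_step:
  assumes F: "F \<in> parisi_class" and H: "H \<in> parisi_class" and a: "0 \<le> a" "a \<le> 1" and b: "0 \<le> b" "b \<le> 1"
    and h: "0 \<le> h" and \<delta>: "b - a \<le> \<delta>" and dom: "dominated F H A B"
    and S: "\<And>n. 0 < n \<Longrightarrow> (h / real n) * (\<Sum>j<n. max 0 (A + \<delta> * (real j * (h / real n)))) \<le> S"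
  shows "dominated (gauss_step a h F) (gauss_step b h H) (A + \<delta> * h) (B + S)"
  unfolding dominated_def
proof (intro allI)
  fix x D :: real
  obtain C where C: "0 \<le> C" and step:
    "\<And>F H A B D0 a b k \<delta>. F \<in> parisi_class \<Longrightarrow> H \<in> parisi_class \<Longrightarrow> 0 \<le> a \<Longrightarrow> a \<le> 1 \<Longrightarrow> 0 \<le> b \<Longrightarrow> b \<le> 1 \<Longrightarrow>
      0 \<le> k \<Longrightarrow> k \<le> 1 \<Longrightarrow> b - a \<le> \<delta> \<Longrightarrow> 0 \<le> D0 \<Longrightarrow> dominated_upto (D0 + k) F H A B \<Longrightarrow>
      dominated_upto D0 (gauss_step a k F) (gauss_step b k H) (A + \<delta> * k)
        (B + max 0 A * k + C * (1 + \<bar>A\<bar> + D0) * (k * sqrt k))"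
    by (rule small_dominated_step) blast
  define v where "v = deriv (gauss_step b h H) x"
  \<comment> \<open>Bounds all error constants \<open>C * (1 + |A_i| + D0_i)\<close> met along the
    way, uniformly in the index and in \<open>n\<close>.\<close>
  define R where "R = C * (1 + (\<bar>A\<bar> + \<bar>\<delta>\<bar> * h) + (\<bar>D\<bar> + h))"
  have R0: "0 \<le> R" using C h by (simp add: R_def)
  have main: "gauss_step b h H x - gauss_step a h F (x - D) 
      \<le> D * v + (A + \<delta> * h) / 2 * v\<^sup>2 + (B + S) / 2 + R * h * sqrt (h / real n) / 2"
    if n: "0 < n" "h / real n \<le> 1" for n
  proof -
    define k where "k = h / real n"
    have k: "0 \<le> k" "k \<le> 1" "real n * k = h" using h n by (auto simp: k_def)
    let ?A = "\<lambda>i. A + \<delta> * (real i * k)"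
    let ?B = "\<lambda>i. B + k * (\<Sum>j<i. max 0 (?A j)) + real i * (R * (k * sqrt k))"
    \<comment> \<open>The displacement allowance starts at |D| + h and loses \<open>k\<close> per
      step, so that exactly |D| is left after \<open>n\<close> steps.\<close>
    have "dominated_upto (\<bar>D\<bar> + real (n - i) * k) (gauss_step a (real i * k) F) (gauss_step b (real i * k) H) (?A i) (?B i)"
      if "i \<le> n" for i
      using that
    proof (induction i)
      case 0
      have z: "gauss_step c 0 G = G" for c G by (rule ext) (rule gauss_step_zero_var)
      then show ?case using dominated_imp_upto[OF dom] by (simp add: z)
    next
      case (Suc i)
      have ik: "0 \<le> real i * k" "real i * k \<le> h"
        using k Suc.prems mult_right_mono[of "real i" "real n" k] by auto
      have "real (n - i) = real (n - Suc i) + 1" using Suc.prems by simp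
      then have eq: "\<bar>D\<bar> + real (n - i) * k = (\<bar>D\<bar> + real (n - Suc i) * k) + k" by (simp add: algebra_simps)
      have "i \<le> n" using Suc.prems by simp
      note IH = Suc.IH[OF this, unfolded eq]
      have "dominated_upto (\<bar>D\<bar> + real (n - Suc i) * k) (gauss_step a k (gauss_step a (real i * k) F))
         (gauss_step b k (gauss_step b (real i * k) H)) (?A i + \<delta> * k) 
         (?B i + max 0 (?A i) * k + C * (1 + \<bar>?A i\<bar> + (\<bar>D\<bar> + real (n - Suc i) * k)) * (k * sqrt k))"
        by (rule step[OF _ _ a b k(1,2) \<delta> _ IH]) (use k a b ik F H in \<open>auto intro!: gauss_step_class\<close>)
      moreover have "k + real i * k = real (Suc i) * k" by (simp add: algebra_simps)
      ultimately have *: "dominated_upto (\<bar>D\<bar> + real (n - Suc i) * k) (gauss_step a (real (Suc i) * k) F)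
         (gauss_step b (real (Suc i) * k) H) (?A i + \<delta> * k) 
         (?B i + max 0 (?A i) * k + C * (1 + \<bar>?A i\<bar> + (\<bar>D\<bar> + real (n - Suc i) * k)) * (k * sqrt k))"
        using k ik a b F H by (simp add: gauss_step_semigroup class_nonexpansive)
      have A_eq: "?A i + \<delta> * k = ?A (Suc i)" by (simp add: algebra_simps)
      have "C * (1 + \<bar>?A i\<bar> + (\<bar>D\<bar> + real (n - Suc i) * k)) \<le> R"
        unfolding R_def
      proof (intro mult_left_mono add_mono C order_refl)
        have "\<bar>\<delta> * (real i * k)\<bar> = \<bar>\<delta>\<bar> * (real i * k)" using k by (simp add: abs_mult)
        also have "\<dots> \<le> \<bar>\<delta>\<bar> * h" using ik by (intro mult_left_mono) auto
        finally show "\<bar>?A i\<bar> \<le> \<bar>A\<bar> + \<bar>\<delta>\<bar> * h" by linarith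
        show "real (n - Suc i) * k \<le> h" using k mult_right_mono[of "real (n - Suc i)" "real n" k] by auto
      qed
      then have "C * (1 + \<bar>?A i\<bar> + (\<bar>D\<bar> + real (n - Suc i) * k)) * (k * sqrt k) \<le> R * (k * sqrt k)"
        using k by (intro mult_right_mono) auto
      then have "?B i + max 0 (?A i) * k + C * (1 + \<bar>?A i\<bar> + (\<bar>D\<bar> + real (n - Suc i) * k)) * (k * sqrt k) \<le> ?B (Suc i)"
        by (simp add: algebra_simps)
      then show ?case using * unfolding A_eq dominated_upto_def 
        by (smt (verit, best) divide_right_mono)
    qed
    from this[of n] have "dominated_upto \<bar>D\<bar> (gauss_step a h F) (gauss_step b h H) (A + \<delta> * h) (?B n)"
      using k by simp
    then have "gauss_step b h H x - gauss_step a h F (x - D) \<le> D * v + (A + \<delta> * h) / 2 * v\<^sup>2 + ?B n / 2"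
      unfolding dominated_upto_def v_def by auto
    moreover have "k * (\<Sum>j<n. max 0 (?A j)) \<le> S" using S[OF n(1)] by (simp add: k_def)
    moreover have "real n * (R * (k * sqrt k)) = R * h * sqrt (h / real n)"
      using k(3)[symmetric] by (simp add: k_def[symmetric])
    ultimately show ?thesis by (simp add: add_divide_distrib)
  qed
  have lim0: "(\<lambda>n. h / real n) \<longlonglongrightarrow> 0" by (rule lim_const_over_n)
  have lim: "(\<lambda>n. D * v + (A + \<delta> * h) / 2 * v\<^sup>2 + (B + S) / 2 + R * h * sqrt (h / real n) / 2) 
     \<longlonglongrightarrow> D * v + (A + \<delta> * h) / 2 * v\<^sup>2 + (B + S) / 2 + R * h * sqrt 0 / 2"
    by (intro tendsto_intros lim0) simp_all
  have "\<forall>\<^sub>F n in sequentially. 0 < n \<and> h / real n \<le> 1"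
    using order_tendstoD(2)[OF lim0 zero_less_one] eventually_gt_at_top[of "0::nat"] by eventually_elim auto
  then have "\<forall>\<^sub>F n in sequentially. gauss_step b h H x - gauss_step a h F (x - D) 
      \<le> D * v + (A + \<delta> * h) / 2 * v\<^sup>2 + (B + S) / 2 + R * h * sqrt (h / real n) / 2"
    by eventually_elim (use main in auto)
  from tendsto_lowerbound[OF lim this]
  show "gauss_step b h H x - gauss_step a h F (x - D) \<le> D * deriv (gauss_step b h H) x 
      + (A + \<delta> * h) / 2 * (deriv (gauss_step b h H) x)\<^sup>2 + (B + S) / 2"
    unfolding v_def by simp
qed

text \<open>Left Riemann sums of the nondecreasing function A + \<delta> t stay below its
  integral.\<close>

lemma dominated_step_pos:
  assumes "F \<in> parisi_class" "H \<in> parisi_class" "0 \<le> a" "a \<le> 1" "0 \<le> b" "b \<le> 1" "0 \<le> h" "b - a \<le> \<delta>"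
    "dominated F H A B" and A: "0 \<le> A" and \<delta>: "0 \<le> \<delta>"
  shows "dominated (gauss_step a h F) (gauss_step b h H) (A + \<delta> * h) (B + (A * h + \<delta> * h\<^sup>2 / 2))"
proof (rule dominated_step[OF assms(1-9)])
  fix n :: nat assume n: "0 < n"
  define k where "k = h / real n"
  have k: "0 \<le> k" "real n * k = h" using assms(7) n by (auto simp: k_def)
  have "(\<Sum>j<n. max 0 (A + \<delta> * (real j * k))) = (\<Sum>j<n. A + \<delta> * k * real j)"
    using A \<delta> k by (intro sum.cong) (auto simp: mult_ac max_def)
  also have "\<dots> = real n * A + \<delta> * k * (\<Sum>j<n. real j)" by (simp add: sum.distrib sum_distrib_left)
  also have "\<dots> \<le> real n * A + \<delta> * k * ((real n)\<^sup>2 / 2)"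
  proof (intro add_left_mono mult_left_mono)
    show "(\<Sum>j<n. real j) \<le> (real n)\<^sup>2 / 2" 
      by (induction n) (auto simp: power2_eq_square field_simps)
  qed (use \<delta> k in auto)
  finally have "k * (\<Sum>j<n. max 0 (A + \<delta> * (real j * k))) \<le> k * (real n * A + \<delta> * k * ((real n)\<^sup>2 / 2))"
    using k by (intro mult_left_mono) auto
  also have "\<dots> = A * (real n * k) + \<delta> * (real n * k)\<^sup>2 / 2" by (simp add: power2_eq_square algebra_simps)
  finally show "h / real n * (\<Sum>j<n. max 0 (A + \<delta> * (real j * (h / real n)))) \<le> A * h + \<delta> * h\<^sup>2 / 2"
    unfolding k(2) unfolding k_def .
qed

text \<open>The positive part vanishes throughout, so nothing is added to \<open>B\<close>; the
  growth of the variance would only improve the bound.\<close>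

lemma dominated_step_neg:
  assumes "F \<in> parisi_class" "H \<in> parisi_class" "0 \<le> a" "a \<le> 1" "0 \<le> b" "b \<le> 1" "0 \<le> h" "b - a \<le> \<delta>"
    "dominated F H A B" and A: "A \<le> 0" and \<delta>: "\<delta> \<le> 0"
  shows "dominated (gauss_step a h F) (gauss_step b h H) (A + \<delta> * h) B"
proof -
  have "dominated (gauss_step a h F) (gauss_step b h H) (A + \<delta> * h) (B + 0)"
  proof (rule dominated_step[OF assms(1-9)])
    fix n :: nat
    have "max 0 (A + \<delta> * (real j * (h / real n))) = 0" for j
      using A \<delta> assms(7) mult_nonpos_nonneg[of \<delta> "real j * (h / real n)"] by (simp add: max_def)
    then show "h / real n * (\<Sum>j<n. max 0 (A + \<delta> * (real j * (h / real n)))) \<le> 0" by simp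
  qed
  then show ?thesis by simp
qed

section \<open>The mixture function and the recursion on a grid\<close>

locale mixture_function =
  fixes \<beta> :: "nat \<Rightarrow> real" and \<xi> :: "real \<Rightarrow> real"
  assumes summable_2: "summable (\<lambda>p. 2 ^ (p + 2) * (\<beta> (p + 2))\<^sup>2)"
    and nontrivial: "\<exists>p\<ge>2. \<beta> p \<noteq> 0"
    and \<xi>_eq: "\<xi> = mixture \<beta>"
begin

abbreviation \<xi>1 :: "real \<Rightarrow> real" where "\<xi>1 \<equiv> deriv \<xi>"
abbreviation \<xi>2 :: "real \<Rightarrow> real" where "\<xi>2 \<equiv> deriv \<xi>1"

text \<open>Padded with zeros so that the index is the exponent and termwise differentiation through
  \<open>diffs\<close> applies.\<close>

definition cf :: "nat \<Rightarrow> real" where "cf n = (if n < 2 then 0 else (\<beta> n)\<^sup>2)"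

lemma cf_nonneg: "0 \<le> cf n" by (simp add: cf_def)

lemma summable_cf2: "summable (\<lambda>n. cf n * 2 ^ n)"
proof -
  have "summable (\<lambda>n. cf (n + 2) * 2 ^ (n + 2))" using summable_2 by (simp add: cf_def mult_ac)
  then show ?thesis by (rule summable_iff_shift[THEN iffD1])
qed

lemma summable_cf: "\<bar>u\<bar> < 2 \<Longrightarrow> summable (\<lambda>n. cf n * u ^ n)"
  using powser_inside[OF summable_cf2, of u] by simp

lemma summable_cf1: "\<bar>u\<bar> < 2 \<Longrightarrow> summable (\<lambda>n. diffs cf n * u ^ n)"
  using termdiff_converges[of u 2 cf] summable_cf by auto

lemma summable_cf2': "\<bar>u\<bar> < 2 \<Longrightarrow> summable (\<lambda>n. diffs (diffs cf) n * u ^ n)"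
  using termdiff_converges[of u 2 "diffs cf"] summable_cf1 by auto

lemma \<xi>_series: "\<bar>u\<bar> < 2 \<Longrightarrow> \<xi> u = (\<Sum>n. cf n * u ^ n)"
  using suminf_split_initial_segment[OF summable_cf, of u 2]
  by (simp add: \<xi>_eq mixture_def cf_def numeral_2_eq_2)

lemma has_deriv_series:
  assumes s: "\<And>u. \<bar>u\<bar> < 2 \<Longrightarrow> summable (\<lambda>n. c n * u ^ n)" and u: "\<bar>u\<bar> < (2::real)"
    and f: "\<And>u. \<bar>u\<bar> < 2 \<Longrightarrow> f u = (\<Sum>n. c n * u ^ n)"
  shows "(f has_real_derivative (\<Sum>n. diffs c n * u ^ n)) (at u)"
proof -
  have "((\<lambda>u. \<Sum>n. c n * u ^ n) has_real_derivative (\<Sum>n. diffs c n * u ^ n)) (at u)"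
    by (rule termdiffs_strong'[of 2]) (use s u in auto)
  moreover have "open {-2<..<2::real}" by simp
  ultimately show ?thesis
    by (rule has_field_derivative_transform_within_open[where S="{-2<..<2}"]) (use f u in auto)
qed

lemma \<xi>1_series: "\<bar>u\<bar> < 2 \<Longrightarrow> \<xi>1 u = (\<Sum>n. diffs cf n * u ^ n)"
  using has_deriv_series[OF summable_cf _ \<xi>_series] DERIV_imp_deriv by blast

lemma \<xi>2_series: "\<bar>u\<bar> < 2 \<Longrightarrow> \<xi>2 u = (\<Sum>n. diffs (diffs cf) n * u ^ n)"
  using has_deriv_series[OF summable_cf1 _ \<xi>1_series] DERIV_imp_deriv by blast

lemma \<xi>_deriv: "\<bar>u\<bar> < 2 \<Longrightarrow> (\<xi> has_real_derivative \<xi>1 u) (at u)"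
  using has_deriv_series[OF summable_cf _ \<xi>_series] \<xi>1_series by simp

lemma \<xi>1_deriv: "\<bar>u\<bar> < 2 \<Longrightarrow> (\<xi>1 has_real_derivative \<xi>2 u) (at u)"
  using has_deriv_series[OF summable_cf1 _ \<xi>1_series] \<xi>2_series by simp

lemma \<xi>2_isCont: "\<bar>u\<bar> < 2 \<Longrightarrow> isCont \<xi>2 u"
  using has_deriv_series[OF summable_cf2' _ \<xi>2_series] DERIV_isCont by blast

lemma \<xi>2_continuous: "continuous_on {0..1} \<xi>2"
  by (intro continuous_at_imp_continuous_on ballI \<xi>2_isCont) auto

lemma \<xi>1_continuous: "continuous_on {0..1} \<xi>1"
  by (intro continuous_at_imp_continuous_on ballI DERIV_isCont[OF \<xi>1_deriv]) auto

lemma diffs_nonneg: "(\<And>n. 0 \<le> c n) \<Longrightarrow> 0 \<le> diffs c n" for c :: "nat \<Rightarrow> real"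
  by (simp add: diffs_def)

lemmas cf_nn = cf_nonneg diffs_nonneg[of cf, OF cf_nonneg] 
  diffs_nonneg[of "diffs cf", OF diffs_nonneg[of cf, OF cf_nonneg]]

lemma \<xi>1_0: "\<xi>1 0 = 0"
  by (subst \<xi>1_series) (auto simp: diffs_def cf_def)

lemma \<xi>_0: "\<xi> 0 = 0"
  by (subst \<xi>_series) (auto simp: cf_def)

lemma \<xi>2_mono: "0 \<le> u \<Longrightarrow> u \<le> w \<Longrightarrow> w \<le> 1 \<Longrightarrow> \<xi>2 u \<le> \<xi>2 w"
  by (simp add: \<xi>2_series) (intro suminf_le mult_left_mono power_mono summable_cf2' cf_nn; simp)

lemma \<xi>2_nonneg: "0 \<le> u \<Longrightarrow> u \<le> 1 \<Longrightarrow> 0 \<le> \<xi>2 u"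
  by (simp add: \<xi>2_series) (intro suminf_nonneg mult_nonneg_nonneg zero_le_power summable_cf2' cf_nn; simp)

lemma \<xi>2_pos: assumes "0 < u" "u \<le> 1" shows "0 < \<xi>2 u"
proof -
  obtain p where "2 \<le> p" "\<beta> p \<noteq> 0" using nontrivial by auto
  then obtain k where k: "\<beta> (Suc (Suc k)) \<noteq> 0" by (metis add_2_eq_Suc le_Suc_ex)
  then have "0 < diffs (diffs cf) k * u ^ k"
    using assms by (simp add: diffs_def cf_def)
  then have "0 < (\<Sum>n. diffs (diffs cf) n * u ^ n)"
    using assms by (intro suminf_pos2[OF summable_cf2']) (auto intro!: mult_nonneg_nonneg cf_nn)
  then show ?thesis using assms by (simp add: \<xi>2_series)
qed

lemma \<xi>1_mono: assumes "0 \<le> u" "u \<le> w" "w \<le> 1" shows "\<xi>1 u \<le> \<xi>1 w"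
proof (rule DERIV_nonneg_imp_nondecreasing[OF assms(2)])
  fix t assume "u \<le> t" "t \<le> w"
  then show "\<exists>y. (\<xi>1 has_real_derivative y) (at t) \<and> 0 \<le> y"
    using assms \<xi>1_deriv[of t] \<xi>2_nonneg[of t] by auto
qed

lemma \<xi>1_nonneg: "0 \<le> u \<Longrightarrow> u \<le> 1 \<Longrightarrow> 0 \<le> \<xi>1 u"
  using \<xi>1_mono[of 0 u] \<xi>1_0 by simp

text \<open>All exponents are at least 2, so each term of the series is at most half of the matching
  term of c \<xi>'(c).\<close>

lemma \<xi>_le: assumes c: "0 \<le> c" "c \<le> 1" shows "\<xi> c \<le> c * \<xi>1 c / 2"
proof -
  have s: "summable (\<lambda>n. cf (Suc n) * c ^ Suc n)"
    using summable_cf[of c] c summable_Suc_iff[of "\<lambda>n. cf n * c ^ n"] by simp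
  have "\<xi> c = (\<Sum>n. cf (Suc n) * c ^ Suc n)"
    using suminf_split_head[OF summable_cf[of c]] c by (simp add: \<xi>_series cf_def)
  also have "\<dots> \<le> (\<Sum>n. c / 2 * (diffs cf n * c ^ n))"
  proof (rule suminf_le[OF _ s])
    fix n
    show "cf (Suc n) * c ^ Suc n \<le> c / 2 * (diffs cf n * c ^ n)"
    proof (cases "n = 0")
      case False
      then have "2 * (cf (Suc n) * c ^ Suc n) \<le> real (Suc n) * (cf (Suc n) * c ^ Suc n)"
        using c by (intro mult_right_mono mult_nonneg_nonneg cf_nn) auto
      then show ?thesis by (simp add: diffs_def mult_ac)
    qed (simp add: cf_def diffs_def)
  qed (use c summable_cf1 in \<open>auto intro!: summable_mult\<close>)
  also have "\<dots> = c / 2 * \<xi>1 c" using c summable_cf1[of c] by (subst suminf_mult) (auto simp: \<xi>1_series)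
  finally show ?thesis by (simp add: mult_ac)
qed

text \<open>Termwise comparison with u \<xi>''(q)/2: for n >= 1, division by n + 1 >= 2 gains the
  factor 1/2, and the half of the constant term that is missing is supplied by \<xi>''(0)/2. When
  \<xi>''(q) = 1 and \<xi>''(0) < 1 the factor is below 1, a gap s - \<xi>'(s) that is linear in s
  up to q itself.\<close>

lemma \<xi>1_le: assumes u: "0 \<le> u" "u \<le> q" "q \<le> 1" shows "\<xi>1 u \<le> u * ((\<xi>2 0 + \<xi>2 q) / 2)"
proof -
  have s: "summable (\<lambda>n. diffs cf (Suc n) * u ^ Suc n)"
    using summable_cf1[of u] u summable_Suc_iff[of "\<lambda>n. diffs cf n * u ^ n"] by simp
  let ?e = "diffs (diffs cf)"
  let ?d0 = "\<lambda>n. if n = 0 then ?e 0 / 2 else 0"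
  have s0: "summable ?d0" by (rule summable_finite[of "{0}"]) auto
  have s1: "summable (\<lambda>n. ?e n * q ^ n)" using summable_cf2' u by auto
  have s2: "summable (\<lambda>n. u * (?d0 n + ?e n * q ^ n / 2))"
    by (intro summable_mult summable_add s0 summable_divide s1)
  have "\<xi>1 u = (\<Sum>n. diffs cf (Suc n) * u ^ Suc n)"
    using suminf_split_head[OF summable_cf1[of u]] u by (simp add: \<xi>1_series cf_def diffs_def)
  also have "\<dots> \<le> (\<Sum>n. u * (?d0 n + ?e n * q ^ n / 2))"
  proof (rule suminf_le[OF _ s s2])
    fix n
    have "diffs cf (Suc n) * u ^ n \<le> ?d0 n + ?e n * q ^ n / 2"
    proof (cases "n = 0")
      case False
      have "2 * (diffs cf (Suc n) * u ^ n) \<le> real (Suc n) * (diffs cf (Suc n) * q ^ n)"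
        using False u by (intro mult_mono mult_nonneg_nonneg cf_nn power_mono) auto
      also have "\<dots> = ?e n * q ^ n" by (simp add: diffs_def)
      finally show ?thesis using False by simp
    qed (simp add: diffs_def)
    from mult_left_mono[OF this u(1)]
    show "diffs cf (Suc n) * u ^ Suc n \<le> u * (?d0 n + ?e n * q ^ n / 2)" by (simp add: mult_ac)
  qed
  also have "\<dots> = u * ((\<Sum>n. ?d0 n) + (\<Sum>n. ?e n * q ^ n) / 2)"
    by (subst suminf_mult, intro summable_add s0 summable_divide s1)
      (simp add: suminf_add[symmetric] s0 s1 summable_divide suminf_divide)
  also have "(\<Sum>n. ?d0 n) = \<xi>2 0 / 2"
    using suminf_finite[of "{0}" ?d0] by (simp add: \<xi>2_series)
  finally show ?thesis using u by (simp add: \<xi>2_series add_divide_distrib)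
qed

end

text \<open>Unlike the defining recursion, the mass is read off at the left end of each interval, so that
  further points may be inserted into the grid and two measures share a common grid.\<close>

primrec grid_rec :: "(real \<Rightarrow> real) \<Rightarrow> (real \<Rightarrow> real) \<Rightarrow> real list \<Rightarrow> real \<Rightarrow> real \<Rightarrow> real" where
  "grid_rec \<xi> m [] u = (\<lambda>x. ln (cosh x) + (deriv \<xi> 1 - deriv \<xi> u) / 2)"
| "grid_rec \<xi> m (q # qs) u =
    (if u < q then gauss_step (m u) (deriv \<xi> q - deriv \<xi> u) (grid_rec \<xi> m qs q) else grid_rec \<xi> m qs u)"

text \<open>Intervals open on the left fit distribution functions, which are right-continuous: a
  jump at a point of \<open>S\<close> takes effect at that point.\<close>

definition step_on :: "(real \<Rightarrow> real) \<Rightarrow> real set \<Rightarrow> bool" where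
  "step_on m S \<longleftrightarrow> (\<forall>u u'. 0 \<le> u \<longrightarrow> u \<le> u' \<longrightarrow> u' \<le> 1 \<longrightarrow> S \<inter> {u<..u'} = {} \<longrightarrow> m u = m u')"

lemma step_onD: "step_on m S \<Longrightarrow> 0 \<le> u \<Longrightarrow> u \<le> u' \<Longrightarrow> u' \<le> 1 \<Longrightarrow> S \<inter> {u<..u'} = {} \<Longrightarrow> m u = m u'"
  unfolding step_on_def by blast

lemma step_on_mono: "step_on m S \<Longrightarrow> S \<subseteq> T \<Longrightarrow> step_on m T"
  unfolding step_on_def by blast

lemma gexp_exp: "gexp (\<lambda>z. exp (s * z)) = exp (s\<^sup>2 / 2)"
proof -
  have "gexp (\<lambda>z. (\<lambda>_. 1) (z + - s) * exp (- (- s) * z - (- s)\<^sup>2 / 2)) = gexp (\<lambda>_. 1)"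
    by (rule gexp_shift) simp
  then have "gexp (\<lambda>z. exp (s * z) * exp (- (s\<^sup>2 / 2))) = 1" by (simp flip: exp_add)
  then have "gexp (\<lambda>z. exp (s * z)) * exp (- (s\<^sup>2 / 2)) = 1" by simp
  then show ?thesis by (simp add: exp_minus field_simps)
qed

text \<open>cosh is an eigenfunction of the heat semigroup with factor exp (h/2). Hence the terminal
  formula of the recursion is itself a step with mass 1, and grid points may be added beyond the
  last atom.\<close>

lemma gauss_step_ln_cosh:
  assumes h: "0 \<le> h"
  shows "gauss_step 1 h (\<lambda>x. ln (cosh x) + c) x = ln (cosh x) + (c + h / 2)"
proof -
  have "exp (ln (cosh (x + z * sqrt h)) + c) 
      = exp c * (exp x / 2) * exp (sqrt h * z) + exp c * (exp (- x) / 2) * exp (- sqrt h * z)" for z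
    by (simp add: exp_add cosh_real_pos) (simp add: cosh_def exp_add exp_minus exp_diff field_simps)
  then have "gexp (\<lambda>z. exp (1 * (ln (cosh (x + z * sqrt h)) + c))) 
      = gexp (\<lambda>z. exp c * (exp x / 2) * exp (sqrt h * z)) + gexp (\<lambda>z. exp c * (exp (- x) / 2) * exp (- sqrt h * z))"
    by (simp only: mult_1_left, intro Bochner_Integration.integral_add integrable_mult_right integrable_exp_mult_gauss)
  also have "\<dots> = exp c * (exp x / 2) * exp (h / 2) + exp c * (exp (- x) / 2) * exp (h / 2)"
    using h gexp_exp[of "sqrt h"] gexp_exp[of "- sqrt h"] by simp
  also have "\<dots> = cosh x * (exp c * exp (h / 2))" by (simp add: cosh_def field_simps)
  also have "\<dots> = cosh x * exp (c + h / 2)" by (simp only: exp_add)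
  finally show ?thesis unfolding gauss_step_def by (simp add: ln_mult cosh_real_pos)
qed

context mixture_function begin

lemma grid_rec_class:
  assumes "set qs \<subseteq> {0..1}" "0 \<le> u" "u \<le> 1" "\<And>s. 0 \<le> s \<Longrightarrow> s \<le> 1 \<Longrightarrow> 0 \<le> m s \<and> m s \<le> 1"
  shows "grid_rec \<xi> m qs u \<in> parisi_class"
  using assms
proof (induction qs arbitrary: u)
  case Nil
  show ?case by (simp add: class_add_const ln_cosh_class)
next
  case (Cons q qs)
  show ?case
  proof (cases "u < q")
    case True
    have "gauss_step (m u) (\<xi>1 q - \<xi>1 u) (grid_rec \<xi> m qs q) \<in> parisi_class"
      by (rule gauss_step_class) (use Cons True \<xi>1_mono[of u q] in auto)
    then show ?thesis using True by simp
  qed (use Cons in simp)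
qed

text \<open>A point without a jump of \<open>m\<close> splits one step into two of equal mass, which
  the semigroup property merges again. Beyond the last grid point the mass is 1 and the explicit
  step of log cosh takes over. Only jumps to the right of \<open>u\<close> matter for the value at
  \<open>u\<close>.\<close>

lemma grid_rec_insort:
  assumes "sorted qs" "set qs \<subseteq> {0..1}" "p \<in> {0..1}" "p \<notin> set qs" "0 \<le> u" "u \<le> 1"
    and "S \<inter> {u<..} \<subseteq> set qs" and m: "step_on m S" "m 1 = 1" "\<And>s. 0 \<le> s \<Longrightarrow> s \<le> 1 \<Longrightarrow> 0 \<le> m s \<and> m s \<le> 1"
  shows "grid_rec \<xi> m (insort p qs) u = grid_rec \<xi> m qs u"
  using assms(1-7)
proof (induction qs arbitrary: u)
  case Nil
  have "S \<inter> {u<..1} = {}" using Nil by auto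
  then have "m u = 1" using step_onD[OF m(1), of u 1] m(2) Nil by auto
  moreover have "0 \<le> \<xi>1 p - \<xi>1 u" if "u < p" using that Nil \<xi>1_mono[of u p] by auto
  moreover have "(\<xi>1 1 - \<xi>1 p) / 2 + (\<xi>1 p - \<xi>1 u) / 2 = (\<xi>1 1 - \<xi>1 u) / 2" by (simp add: field_simps)
  ultimately have "u < p \<Longrightarrow> gauss_step 1 (\<xi>1 p - \<xi>1 u) (\<lambda>x. ln (cosh x) + (\<xi>1 1 - \<xi>1 p) / 2) x 
      = ln (cosh x) + (\<xi>1 1 - \<xi>1 u) / 2" for x
    by (simp only: gauss_step_ln_cosh)
  with \<open>m u = 1\<close> show ?case by auto
next
  case (Cons q qs)
  show ?case
  proof (cases "p \<le> q")
    case True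
    then have pq: "p < q" using Cons.prems by auto
    have cls: "grid_rec \<xi> m qs q \<in> parisi_class" by (rule grid_rec_class) (use Cons.prems m in auto)
    show ?thesis
    proof (cases "u < p")
      case up: True
      have "m u = m p"
        by (rule step_onD[OF m(1)]) (use Cons.prems up pq in force)+
      moreover have "0 \<le> \<xi>1 p - \<xi>1 u" "0 \<le> \<xi>1 q - \<xi>1 p"
        using Cons.prems up pq \<xi>1_mono[of u p] \<xi>1_mono[of p q] by auto
      moreover have "0 \<le> m p" using m(3) Cons.prems by auto
      ultimately show ?thesis
        using up pq by (simp add: gauss_step_semigroup[OF class_nonexpansive[OF cls]])
    qed (use True in simp)
  next
    case False
    show ?thesis
    proof (cases "u < q")
      case True
      have "S \<inter> {q<..} \<subseteq> set qs" using Cons.prems True by auto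
      then have "grid_rec \<xi> m (insort p qs) q = grid_rec \<xi> m qs q"
        using Cons.prems by (intro Cons.IH) auto
      then show ?thesis using True False by simp
    next
      case uq: False
      have "S \<inter> {u<..} \<subseteq> set qs" using Cons.prems uq by auto
      then have "grid_rec \<xi> m (insort p qs) u = grid_rec \<xi> m qs u"
        using Cons.prems by (intro Cons.IH) auto
      then show ?thesis using uq False by simp
    qed
  qed
qed

lemma grid_rec_refine:
  assumes fin: "finite B" and A: "finite A" "A \<subseteq> {0..1}" and B: "B \<subseteq> {0..1}" and u: "0 \<le> u" "u \<le> 1"
    and S: "S \<subseteq> A" and m: "step_on m S" "m 1 = 1" "\<And>s. 0 \<le> s \<Longrightarrow> s \<le> 1 \<Longrightarrow> 0 \<le> m s \<and> m s \<le> 1"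
  shows "grid_rec \<xi> m (sorted_list_of_set (A \<union> B)) u = grid_rec \<xi> m (sorted_list_of_set A) u"
  using fin B
proof (induction B rule: finite_induct)
  case (insert p B)
  show ?case
  proof (cases "p \<in> A \<union> B")
    case True
    then show ?thesis using insert by (simp add: insert_absorb)
  next
    case False
    have "grid_rec \<xi> m (insort p (sorted_list_of_set (A \<union> B))) u = grid_rec \<xi> m (sorted_list_of_set (A \<union> B)) u"
      by (rule grid_rec_insort[where S=S]) (use insert False A u S m in auto)
    then show ?thesis using insert False A by simp
  qed
qed simp

end

section \<open>Measures on the unit interval\<close>

context mixture_function begin

text \<open>Antiderivatives \<xi>' and (\<xi>' - \<xi>'(u))^2/2 on a piece where \<open>d\<close> is
  constant. The end \<open>q\<close> is left out because \<open>d\<close> may jump there; a single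
  point does not change the integral.\<close>

lemma step_weight_has_integral:
  assumes uq: "0 \<le> u" "u \<le> q" "q \<le> 1" and d: "\<And>s. u \<le> s \<Longrightarrow> s < q \<Longrightarrow> d s = c"
  shows "((\<lambda>s. d s * \<xi>2 s) has_integral c * (\<xi>1 q - \<xi>1 u)) {u..q}"
    and "((\<lambda>s. d s * \<xi>2 s * (\<xi>1 s - \<xi>1 u)) has_integral c * (\<xi>1 q - \<xi>1 u)\<^sup>2 / 2) {u..q}"
proof -
  have der: "(\<xi>1 has_vector_derivative \<xi>2 s) (at s within {u..q})" if "s \<in> {u..q}" for s
    using \<xi>1_deriv[of s] that uq 
    by (auto simp: has_real_derivative_iff_has_vector_derivative[symmetric] intro: DERIV_subset)
  have "(\<xi>2 has_integral \<xi>1 q - \<xi>1 u) {u..q}"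
    by (rule fundamental_theorem_of_calculus) (use uq der in auto)
  then have 1: "((\<lambda>s. c * \<xi>2 s) has_integral c * (\<xi>1 q - \<xi>1 u)) {u..q}"
    by (rule has_integral_mult_right)
  show "((\<lambda>s. d s * \<xi>2 s) has_integral c * (\<xi>1 q - \<xi>1 u)) {u..q}"
    by (rule has_integral_spike_finite[OF _ _ 1, of "{q}"]) (use d in auto)
  have der2: "((\<lambda>s. (\<xi>1 s - \<xi>1 u)\<^sup>2 / 2) has_vector_derivative (\<xi>2 s * (\<xi>1 s - \<xi>1 u))) (at s within {u..q})" if "s \<in> {u..q}" for s
    using der[OF that] unfolding has_real_derivative_iff_has_vector_derivative[symmetric]
    by (auto intro!: derivative_eq_intros)
  have "((\<lambda>s. \<xi>2 s * (\<xi>1 s - \<xi>1 u)) has_integral (\<xi>1 q - \<xi>1 u)\<^sup>2 / 2 - (\<xi>1 u - \<xi>1 u)\<^sup>2 / 2) {u..q}"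
    by (rule fundamental_theorem_of_calculus) (use uq der2 in auto)
  from has_integral_mult_right[OF this, of c]
  have 2: "((\<lambda>s. c * (\<xi>2 s * (\<xi>1 s - \<xi>1 u))) has_integral c * (\<xi>1 q - \<xi>1 u)\<^sup>2 / 2) {u..q}" by simp
  show "((\<lambda>s. d s * \<xi>2 s * (\<xi>1 s - \<xi>1 u)) has_integral c * (\<xi>1 q - \<xi>1 u)\<^sup>2 / 2) {u..q}"
    by (rule has_integral_spike_finite[OF _ _ 2, of "{q}"]) (use d in auto)
qed

text \<open>Induction over the grid from the right. The fixed sign \<sigma> of the majorant
  \<open>d\<close> selects the nonnegative or the nonpositive version of the step. For \<sigma> = -1
  the integral \<open>B\<close> is nonpositive and is replaced by 0 in the bound.\<close>

lemma grid_rec_dominated: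
  assumes "sorted qs" "set qs \<subseteq> {0..1}" "0 \<le> u" "u \<le> 1" "S \<inter> {u<..} \<subseteq> set qs"
    and S: "1 \<in> S" and d: "step_on d S" "\<And>s. 0 \<le> s \<Longrightarrow> s \<le> 1 \<Longrightarrow> m' s - m s \<le> d s \<and> 0 \<le> \<sigma> * d s" "\<sigma> = 1 \<or> \<sigma> = -1"
    and m: "\<And>s. 0 \<le> s \<Longrightarrow> s \<le> 1 \<Longrightarrow> 0 \<le> m s \<and> m s \<le> 1"
    and m': "\<And>s. 0 \<le> s \<Longrightarrow> s \<le> 1 \<Longrightarrow> 0 \<le> m' s \<and> m' s \<le> 1"
  shows "\<exists>A B. ((\<lambda>s. d s * \<xi>2 s) has_integral A) {u..1} \<and> ((\<lambda>s. d s * \<xi>2 s * (\<xi>1 s - \<xi>1 u)) has_integral B) {u..1}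
    \<and> 0 \<le> \<sigma> * A \<and> 0 \<le> \<sigma> * B \<and> dominated (grid_rec \<xi> m qs u) (grid_rec \<xi> m' qs u) A (max 0 B)"
  using assms(1-5)
proof (induction qs arbitrary: u)
  case Nil
  \<comment> \<open>Since 1 belongs to \<open>S\<close>, an exhausted list forces
    \<open>u = 1\<close>, so the integrals start from a single point.\<close>
  then have "1 \<notin> {u<..}" using S by auto
  then have u: "u = 1" using Nil by auto
  have "dominated (grid_rec \<xi> m [] u) (grid_rec \<xi> m' [] u) 0 0"
    using dominated_refl[OF grid_rec_class[of "[]" 1 m]] m u by simp
  then show ?case unfolding u by (intro exI[of _ 0] conjI) (simp_all add: has_integral_refl)
next
  case (Cons q qs)
  show ?case
  proof (cases "u < q")
    case True
    have q: "0 \<le> q" "q \<le> 1" "u \<le> q" using Cons.prems True by auto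
    have "S \<inter> {q<..} \<subseteq> set qs" using Cons.prems True by auto
    from Cons.IH[OF _ _ q(1,2) this] Cons.prems obtain A B where A: "((\<lambda>s. d s * \<xi>2 s) has_integral A) {q..1}" "0 \<le> \<sigma> * A"
      and B: "((\<lambda>s. d s * \<xi>2 s * (\<xi>1 s - \<xi>1 q)) has_integral B) {q..1}" and B0: "0 \<le> \<sigma> * B"
      and dom: "dominated (grid_rec \<xi> m qs q) (grid_rec \<xi> m' qs q) A (max 0 B)"
      by auto
    let ?h = "\<xi>1 q - \<xi>1 u"
    have h: "0 \<le> ?h" using \<xi>1_mono[of u q] q Cons.prems by auto
    have dc: "d s = d u" if "u \<le> s" "s < q" for s
      
    proof (rule step_onD[OF d(1), symmetric])
      show "S \<inter> {u<..s} = {}" using Cons.prems(1,5) that by force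
    qed (use that q Cons.prems(3) in auto)
    note piece = step_weight_has_integral[where d=d and c="d u", OF Cons.prems(3) q(3,2) dc]
    have A': "((\<lambda>s. d s * \<xi>2 s) has_integral d u * ?h + A) {u..1}"
      by (rule has_integral_combine[OF q(3,2) piece(1) A(1)])
    \<comment> \<open>Changing the base of the variance from \<open>q\<close> to \<open>u\<close>
      adds \<open>?h\<close> times the first integral. This is the term \<open>A * h\<close> in the
      step lemma.\<close>
    have "((\<lambda>s. d s * \<xi>2 s * (\<xi>1 s - \<xi>1 q) + d s * \<xi>2 s * ?h) has_integral B + A * ?h) {q..1}"
      by (intro has_integral_add B has_integral_mult_left A)
    then have Bq: "((\<lambda>s. d s * \<xi>2 s * (\<xi>1 s - \<xi>1 u)) has_integral B + A * ?h) {q..1}"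
      by (rule has_integral_eq[rotated]) (simp add: algebra_simps)
    have B': "((\<lambda>s. d s * \<xi>2 s * (\<xi>1 s - \<xi>1 u)) has_integral d u * ?h\<^sup>2 / 2 + (B + A * ?h)) {u..1}"
      by (rule has_integral_combine[OF q(3,2) piece(2) Bq])
    let ?B = "d u * ?h\<^sup>2 / 2 + (B + A * ?h)"
    have du: "0 \<le> \<sigma> * d u" "m' u - m u \<le> d u" using d(2)[of u] Cons.prems(3,4) by auto
    have cls: "grid_rec \<xi> m qs q \<in> parisi_class" "grid_rec \<xi> m' qs q \<in> parisi_class"
      using Cons.prems(2) m m' q by (auto intro!: grid_rec_class)
    have mu: "0 \<le> m u" "m u \<le> 1" "0 \<le> m' u" "m' u \<le> 1" using m m' Cons.prems(3,4) by auto
    have signs: "0 \<le> \<sigma> * (d u * ?h + A)" "0 \<le> \<sigma> * ?B"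
    proof -
      have "\<sigma> * (d u * ?h + A) = (\<sigma> * d u) * ?h + \<sigma> * A" by (simp add: algebra_simps)
      then show "0 \<le> \<sigma> * (d u * ?h + A)" using du h A(2) by simp
      have "\<sigma> * ?B = (\<sigma> * d u) * (?h\<^sup>2 / 2) + (\<sigma> * B + (\<sigma> * A) * ?h)" by (simp add: algebra_simps)
      then show "0 \<le> \<sigma> * ?B" using mult_nonneg_nonneg[OF du(1), of "?h\<^sup>2 / 2"] mult_nonneg_nonneg[OF A(2) h] B0 by simp
    qed
    have "dominated (gauss_step (m u) ?h (grid_rec \<xi> m qs q)) (gauss_step (m' u) ?h (grid_rec \<xi> m' qs q)) 
        (A + d u * ?h) (max 0 ?B)"
      using d(3)
    proof
      assume s: "\<sigma> = 1"
      have "max 0 B + (A * ?h + d u * ?h\<^sup>2 / 2) = max 0 ?B" using B0 signs(2) s by (simp add: max_absorb2)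
      with dominated_step_pos[OF cls mu h du(2) dom] A(2) du(1) s show ?thesis by simp
    next
      assume s: "\<sigma> = -1"
      have "max 0 B = max 0 ?B" using B0 signs(2) s by (simp add: max_absorb1)
      with dominated_step_neg[OF cls mu h du(2) dom] A(2) du(1) s show ?thesis by simp
    qed
    then show ?thesis using A' B' signs True
      by (intro exI[of _ "d u * ?h + A"] exI[of _ ?B]) (simp add: add.commute)
  next
    case False
    have "S \<inter> {u<..} \<subseteq> set qs" using Cons.prems False by auto
    then show ?thesis using Cons False by auto
  qed
qed

end

text \<open>For \<open>u > 1\<close> the set \<open>{0..u}\<close> is not measurable and the value is \<open>0\<close>.\<close>

definition unit_cdf :: "real measure \<Rightarrow> real \<Rightarrow> real" where
  "unit_cdf \<mu> u = measure \<mu> {0..u}"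

section \<open>Distribution functions and finitely supported measures\<close>

lemma unit_prob: "\<mu> \<in> unit_measures \<Longrightarrow> prob_space \<mu>"
  by (simp add: unit_measures_def)

lemma unit_space: "\<mu> \<in> unit_measures \<Longrightarrow> space \<mu> = {0..1}"
  using sets_eq_imp_space_eq[of \<mu> "restrict_space borel {0..1}"] by (simp add: unit_measures_def space_restrict_space)

lemma unit_sets: "\<mu> \<in> unit_measures \<Longrightarrow> A \<in> sets \<mu> \<longleftrightarrow> A \<in> sets borel \<and> A \<subseteq> {0..1}"
  by (auto simp: unit_measures_def sets_restrict_space_iff)

lemma unit_cdf_mono:
  assumes "\<mu> \<in> unit_measures" "u \<le> v" "v \<le> 1" shows "unit_cdf \<mu> u \<le> unit_cdf \<mu> v"
proof -
  interpret prob_space \<mu> by (rule unit_prob[OF assms(1)])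
  show ?thesis unfolding unit_cdf_def
    by (rule finite_measure_mono) (use assms in \<open>auto simp: unit_sets\<close>)
qed

lemma unit_cdf_bounds: "\<mu> \<in> unit_measures \<Longrightarrow> 0 \<le> unit_cdf \<mu> u \<and> unit_cdf \<mu> u \<le> 1"
  using prob_space.prob_le_1[OF unit_prob] by (simp add: unit_cdf_def)

lemma unit_cdf_1: "\<mu> \<in> unit_measures \<Longrightarrow> unit_cdf \<mu> 1 = 1"
  using prob_space.prob_space[OF unit_prob] by (simp add: unit_cdf_def unit_space)

lemma unit_cdf_diff:
  assumes "\<mu> \<in> unit_measures" "0 \<le> u" "u \<le> v" "v \<le> 1" 
  shows "unit_cdf \<mu> v - unit_cdf \<mu> u = measure \<mu> {u<..v}"
proof -
  interpret prob_space \<mu> by (rule unit_prob[OF assms(1)])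
  have "{0..v} = {0..u} \<union> {u<..v}" using assms by auto
  then have "measure \<mu> {0..v} = measure \<mu> ({0..u} \<union> {u<..v})" by simp
  also have "\<dots> = measure \<mu> {0..u} + measure \<mu> {u<..v}"
    by (rule finite_measure_Union) (use assms in \<open>auto simp: unit_sets\<close>)
  finally have "measure \<mu> {0..v} = measure \<mu> {0..u} + measure \<mu> {u<..v}" .
  then show ?thesis by (simp add: unit_cdf_def)
qed

lemma unit_cdf_set_integrable:
  assumes \<mu>: "\<mu> \<in> unit_measures" and w: "continuous_on {0..1} w" and ab: "0 \<le> a" "b \<le> 1"
  shows "set_integrable lborel {a..b} (\<lambda>s. w s * unit_cdf \<mu> s)"
proof -
  have "mono_on {0..1} (unit_cdf \<mu>)" using unit_cdf_mono[OF \<mu>] by (auto simp: mono_on_def)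
  then have "unit_cdf \<mu> \<in> borel_measurable (restrict_space borel {0..1})" by (rule borel_measurable_mono_on_fnc)
  then have meas: "(\<lambda>s. indicator {0..1} s *\<^sub>R unit_cdf \<mu> s) \<in> borel_measurable borel"
    by (subst (asm) borel_measurable_restrict_space_iff) auto
  have wi: "set_integrable lborel {0..1} w" by (rule borel_integrable_atLeastAtMost'[OF w])
  have "set_integrable lborel {0..1} (\<lambda>s. w s * unit_cdf \<mu> s)"
    unfolding set_integrable_def
  proof (rule Bochner_Integration.integrable_bound)
    show "integrable lborel (\<lambda>s. indicator {0..1} s *\<^sub>R w s)" using wi by (simp add: set_integrable_def)
    have "(\<lambda>s. indicator {0..1} s *\<^sub>R w s) \<in> borel_measurable lborel" using wi by (simp add: set_integrable_def borel_measurable_integrable)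
    then have "(\<lambda>s. (indicator {0..1} s *\<^sub>R w s) * (indicator {0..1} s *\<^sub>R unit_cdf \<mu> s)) \<in> borel_measurable lborel"
      using meas by measurable
    also have "(\<lambda>s. (indicator {0..1} s *\<^sub>R w s) * (indicator {0..1} s *\<^sub>R unit_cdf \<mu> s)) 
        = (\<lambda>s. indicator {0..1} s *\<^sub>R (w s * unit_cdf \<mu> s))" by (auto simp: indicator_def)
    finally show "(\<lambda>s. indicator {0..1} s *\<^sub>R (w s * unit_cdf \<mu> s)) \<in> borel_measurable lborel" .
    show "AE s in lborel. norm (indicator {0..1} s *\<^sub>R (w s * unit_cdf \<mu> s)) \<le> norm (indicator {0..1} s *\<^sub>R w s)"
      using unit_cdf_bounds[OF \<mu>] by (intro AE_I2) (auto simp: abs_mult indicator_def mult_left_le)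
  qed
  then show ?thesis by (rule set_integrable_subset) (use ab in auto)
qed

lemma unit_cdf_integrable_on:
  assumes \<mu>: "\<mu> \<in> unit_measures" and w: "continuous_on {0..1} w" and ab: "0 \<le> a" "b \<le> 1"
  shows "(\<lambda>s. w s * unit_cdf \<mu> s) integrable_on {a..b}"
  using set_borel_integral_eq_integral(1)[OF unit_cdf_set_integrable[OF assms]] .

lemma discrete_unit: "\<mu> \<in> discrete_unit_measures \<Longrightarrow> \<mu> \<in> unit_measures"
  by (simp add: discrete_unit_measures_def)

text \<open>The finite set of full measure may contain points of mass zero. Removing them leaves the
  atoms, and the removed part is null as a finite union of null points.\<close>

lemma discrete_atoms:
  assumes "\<mu> \<in> discrete_unit_measures"
  shows "finite (atoms \<mu>)" "atoms \<mu> \<subseteq> {0..1}" "measure \<mu> ({0..1} - atoms \<mu>) = 0"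
proof -
  have \<mu>: "\<mu> \<in> unit_measures" by (rule discrete_unit[OF assms])
  interpret prob_space \<mu> by (rule unit_prob[OF \<mu>])
  obtain A where A: "finite A" "A \<subseteq> {0..1}" "measure \<mu> A = 1" using assms by (auto simp: discrete_unit_measures_def)
  have fs: "B \<in> sets \<mu>" if "finite B" "B \<subseteq> {0..1}" for B
    using that by (auto simp: unit_sets[OF \<mu>] intro: finite_imp_closed borel_closed)
  have co: "measure \<mu> ({0..1} - A) = 0"
    using prob_compl[OF fs[OF A(1,2)]] A by (simp add: unit_space[OF \<mu>])
  have "atoms \<mu> \<subseteq> A"
  proof
    fix x assume x: "x \<in> atoms \<mu>"
    show "x \<in> A"
    proof (rule ccontr)
      assume "x \<notin> A"
      then have "measure \<mu> {x} \<le> measure \<mu> ({0..1} - A)"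
        using x fs[OF A(1,2)] by (intro finite_measure_mono) (auto simp: atoms_def unit_space[OF \<mu>] unit_sets[OF \<mu>])
      then show False using x co by (simp add: atoms_def)
    qed
  qed
  then show fin: "finite (atoms \<mu>)" using A(1) finite_subset by blast
  show sub: "atoms \<mu> \<subseteq> {0..1}" using \<open>atoms \<mu> \<subseteq> A\<close> A by auto
  have "measure \<mu> (A - atoms \<mu>) = (\<Sum>x\<in>A - atoms \<mu>. measure \<mu> {x})"
    by (rule finite_measure_eq_sum_singleton) (use A fs in auto)
  also have "\<dots> = 0"
  proof (rule sum.neutral, rule ballI)
    fix x assume "x \<in> A - atoms \<mu>"
    then have "\<not> 0 < measure \<mu> {x}" using A(2) unfolding atoms_def unit_space[OF \<mu>] by blast
    then show "measure \<mu> {x} = 0" using measure_nonneg[of \<mu> "{x}"] by linarith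
  qed
  finally have "measure \<mu> (A - atoms \<mu>) = 0" .
  moreover have "measure \<mu> ({0..1} - atoms \<mu>) \<le> measure \<mu> ({0..1} - A) + measure \<mu> (A - atoms \<mu>)"
    by (rule order_trans[OF finite_measure_mono measure_Un_le])
      (use fs[OF A(1,2)] fs[OF fin sub] in \<open>auto simp: unit_sets[OF \<mu>]\<close>)
  ultimately show "measure \<mu> ({0..1} - atoms \<mu>) = 0" using co measure_nonneg[of \<mu> "{0..1} - atoms \<mu>"] by linarith
qed

lemma discrete_null:
  assumes "\<mu> \<in> discrete_unit_measures" "B \<in> sets borel" "B \<subseteq> {0..1}" "B \<inter> atoms \<mu> = {}"
  shows "measure \<mu> B = 0"
proof -
  have \<mu>: "\<mu> \<in> unit_measures" by (rule discrete_unit[OF assms(1)])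
  interpret prob_space \<mu> by (rule unit_prob[OF \<mu>])
  have "atoms \<mu> \<in> sets borel"
    using discrete_atoms(1)[OF assms(1)] by (intro borel_closed finite_imp_closed)
  then have "measure \<mu> B \<le> measure \<mu> ({0..1} - atoms \<mu>)"
    using assms by (intro finite_measure_mono) (auto simp: unit_sets[OF \<mu>])
  then show ?thesis using discrete_atoms(3)[OF assms(1)] measure_nonneg[of \<mu> B] by simp
qed

lemma discrete_step_on:
  assumes "\<mu> \<in> discrete_unit_measures" shows "step_on (unit_cdf \<mu>) (atoms \<mu>)"
  unfolding step_on_def
proof (intro allI impI)
  fix u u' :: real assume *: "0 \<le> u" "u \<le> u'" "u' \<le> 1" "atoms \<mu> \<inter> {u<..u'} = {}"
  then have "measure \<mu> {u<..u'} = 0" by (intro discrete_null[OF assms]) auto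
  then show "unit_cdf \<mu> u = unit_cdf \<mu> u'" using unit_cdf_diff[OF discrete_unit[OF assms] *(1-3)] by simp
qed

text \<open>\<open>b\<close> is the last point already passed and \<open>c\<close> the mass stored
  there. No atom lies between \<open>b\<close> and \<open>u\<close>, so the stored mass equals the
  mass read off at \<open>u\<close>.\<close>

lemma parisi_rec_eq_grid_rec:
  assumes \<mu>: "\<mu> \<in> discrete_unit_measures"
    and "sorted (b # qs)" "set qs \<subseteq> {0..1}" "0 \<le> u" "u \<le> 1" "b \<le> u" "c = unit_cdf \<mu> b" "atoms \<mu> \<inter> {b<..} \<subseteq> set qs"
  shows "parisi_rec \<xi> \<mu> qs c x u = grid_rec \<xi> (unit_cdf \<mu>) qs u x"
  using assms(2-)
proof (induction qs arbitrary: u b c x)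
  case (Cons q qs)
  have *: "atoms \<mu> \<inter> {q<..} \<subseteq> set qs" using Cons.prems by auto
  show ?case
  proof (cases "u < q")
    case True
    have no: "atoms \<mu> \<inter> {b<..u} = {}" using Cons.prems True by force
    have "c = unit_cdf \<mu> u"
    proof (cases "0 \<le> b")
      case True
      then show ?thesis using step_onD[OF discrete_step_on[OF \<mu>], of b u] no Cons.prems by simp
    next
      case False
      then have "measure \<mu> {0..u} = 0" using no Cons.prems by (intro discrete_null[OF \<mu>]) force+
      then show ?thesis using False Cons.prems by (simp add: unit_cdf_def)
    qed
    moreover have "parisi_rec \<xi> \<mu> qs (measure \<mu> {0..q}) y q = grid_rec \<xi> (unit_cdf \<mu>) qs q y" for y
      by (rule Cons.IH[where b=q and u=q]) (use Cons.prems(1-4) True * in \<open>auto simp: unit_cdf_def[symmetric]\<close>)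
    ultimately show ?thesis using True by simp
  next
    case False
    have "parisi_rec \<xi> \<mu> qs (measure \<mu> {0..q}) x u = grid_rec \<xi> (unit_cdf \<mu>) qs u x"
      by (rule Cons.IH[where b=q and u=u]) (use Cons.prems(1-4) False * in \<open>auto simp: unit_cdf_def[symmetric]\<close>)
    then show ?thesis using False by simp
  qed
qed simp

text \<open>Comparing the tangent of \<open>F\<close> with the parabola above \<open>G\<close> over
  a distance t gives (F' - G') t <= t^2/2 + 2 e; the choice t = 2 sqrt e makes the right side equal
  to t^2.\<close>

lemma class_deriv_close:
  assumes F: "F \<in> parisi_class" and G: "G \<in> parisi_class" and e: "0 < e" and c: "\<And>x. \<bar>F x - G x\<bar> \<le> e"
  shows "\<bar>deriv F x - deriv G x\<bar> \<le> 2 * sqrt e"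
proof -
  have *: "deriv F x - deriv G x \<le> 2 * sqrt e"
    if F: "F \<in> parisi_class" and G: "G \<in> parisi_class" and c: "\<And>x. \<bar>F x - G x\<bar> \<le> e" for F G
  proof -
    define t where "t = 2 * sqrt e"
    have t: "0 < t" "t\<^sup>2 = 4 * e" using e by (auto simp: t_def power_mult_distrib)
    have "(deriv F x - deriv G x) * t \<le> t\<^sup>2 / 2 + 2 * e"
      using class_tangent[OF F, of x "x + t"] class_upper[OF G, of "x + t" x] c[of x] c[of "x + t"]
      by (simp add: algebra_simps abs_le_iff)
    also have "\<dots> = t * t" using t by (simp add: power2_eq_square)
    finally have "deriv F x - deriv G x \<le> t" using t(1) by (rule mult_right_le_imp_le)
    then show ?thesis by (simp add: t_def)
  qed
  show ?thesis using *[OF F G c] *[OF G F] c by (simp add: abs_le_iff abs_minus_commute)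
qed

section \<open>Estimates in the distance on measures\<close>

lemma unit_integrable_abs_diff:
  assumes "\<mu> \<in> unit_measures" "\<nu> \<in> unit_measures" "0 \<le> a" "b \<le> 1"
  shows "set_integrable lborel {a..b} (\<lambda>s. \<bar>unit_cdf \<mu> s - unit_cdf \<nu> s\<bar>)"
    "(\<lambda>s. \<bar>unit_cdf \<mu> s - unit_cdf \<nu> s\<bar>) integrable_on {a..b}"
proof -
  have "set_integrable lborel {a..b} (\<lambda>s. 1 * unit_cdf \<mu> s - 1 * unit_cdf \<nu> s)"
    by (intro set_integral_diff unit_cdf_set_integrable assms) auto
  then show *: "set_integrable lborel {a..b} (\<lambda>s. \<bar>unit_cdf \<mu> s - unit_cdf \<nu> s\<bar>)"
    using set_integrable_abs by simp
  show "(\<lambda>s. \<bar>unit_cdf \<mu> s - unit_cdf \<nu> s\<bar>) integrable_on {a..b}"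
    using set_borel_integral_eq_integral(1)[OF *] .
qed

lemma cdf_dist_eq_integral:
  assumes "\<mu> \<in> unit_measures" "\<nu> \<in> unit_measures"
  shows "cdf_dist \<mu> \<nu> = integral {0..1} (\<lambda>s. \<bar>unit_cdf \<mu> s - unit_cdf \<nu> s\<bar>)"
  using set_borel_integral_eq_integral(2)[OF unit_integrable_abs_diff(1)[OF assms, of 0 1]]
  by (simp add: cdf_dist_def unit_cdf_def)

lemma cdf_dist_commute: "cdf_dist \<mu> \<nu> = cdf_dist \<nu> \<mu>"
  by (simp add: cdf_dist_def abs_minus_commute)

lemma integral_tail_le_cdf_dist:
  assumes "\<mu> \<in> unit_measures" "\<nu> \<in> unit_measures" "0 \<le> u" "u \<le> 1"
  shows "integral {u..1} (\<lambda>s. \<bar>unit_cdf \<mu> s - unit_cdf \<nu> s\<bar>) \<le> cdf_dist \<mu> \<nu>"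
  unfolding cdf_dist_eq_integral[OF assms(1,2)]
  by (rule integral_subset_le) (use assms unit_integrable_abs_diff(2) in auto)

lemma integral_tail_triangle:
  assumes "\<mu> \<in> unit_measures" "\<nu> \<in> unit_measures" "\<rho> \<in> unit_measures" "0 \<le> u" "u \<le> 1"
  shows "integral {u..1} (\<lambda>s. \<bar>unit_cdf \<mu> s - unit_cdf \<rho> s\<bar>) \<le> 
    integral {u..1} (\<lambda>s. \<bar>unit_cdf \<mu> s - unit_cdf \<nu> s\<bar>) + integral {u..1} (\<lambda>s. \<bar>unit_cdf \<nu> s - unit_cdf \<rho> s\<bar>)"
proof -
  note i = unit_integrable_abs_diff(2)[OF _ _ assms(4) order_refl]
  show ?thesis
    by (subst Henstock_Kurzweil_Integration.integral_add[symmetric], 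
        (intro i assms)+, rule integral_le, (intro i integrable_add assms)+) auto
qed

lemma cdf_dist_triangle:
  assumes "\<mu> \<in> unit_measures" "\<nu> \<in> unit_measures" "\<rho> \<in> unit_measures"
  shows "cdf_dist \<mu> \<rho> \<le> cdf_dist \<mu> \<nu> + cdf_dist \<nu> \<rho>"
  using integral_tail_triangle[OF assms, of 0] by (simp add: cdf_dist_eq_integral assms)

lemma cdf_dist_nonneg:
  assumes "\<mu> \<in> unit_measures" "\<nu> \<in> unit_measures"
  shows "0 \<le> cdf_dist \<mu> \<nu>"
  unfolding cdf_dist_eq_integral[OF assms] by (rule integral_nonneg) (use unit_integrable_abs_diff(2) assms in auto)

lemma weighted_integral_close:
  assumes "\<mu> \<in> unit_measures" "\<nu> \<in> unit_measures" "0 \<le> u" "u \<le> 1" and w: "continuous_on {0..1} w" 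
    and C: "\<And>s. 0 \<le> s \<Longrightarrow> s \<le> 1 \<Longrightarrow> \<bar>w s\<bar> \<le> C"
  shows "\<bar>integral {u..1} (\<lambda>s. w s * unit_cdf \<mu> s) - integral {u..1} (\<lambda>s. w s * unit_cdf \<nu> s)\<bar> \<le> C * cdf_dist \<mu> \<nu>"
proof -
  note i = unit_cdf_integrable_on[OF _ w assms(3) order_refl]
  have "\<bar>integral {u..1} (\<lambda>s. w s * unit_cdf \<mu> s) - integral {u..1} (\<lambda>s. w s * unit_cdf \<nu> s)\<bar> 
      = norm (integral {u..1} (\<lambda>s. w s * unit_cdf \<mu> s - w s * unit_cdf \<nu> s))"
    by (subst Henstock_Kurzweil_Integration.integral_diff[OF i i]) (use assms in auto)
  also have "\<dots> \<le> integral {u..1} (\<lambda>s. C * \<bar>unit_cdf \<mu> s - unit_cdf \<nu> s\<bar>)"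
  proof (rule integral_norm_bound_integral)
    show "(\<lambda>s. w s * unit_cdf \<mu> s - w s * unit_cdf \<nu> s) integrable_on {u..1}"
      by (intro integrable_diff i assms)
    show "(\<lambda>s. C * \<bar>unit_cdf \<mu> s - unit_cdf \<nu> s\<bar>) integrable_on {u..1}"
      using integrable_on_cmult_left[OF unit_integrable_abs_diff(2)[OF assms(1-3), of 1], of C] by simp
    fix s assume "s \<in> {u..1}"
    then have "\<bar>w s\<bar> * \<bar>unit_cdf \<mu> s - unit_cdf \<nu> s\<bar> \<le> C * \<bar>unit_cdf \<mu> s - unit_cdf \<nu> s\<bar>"
      using C assms by (intro mult_right_mono) auto
    then show "norm (w s * unit_cdf \<mu> s - w s * unit_cdf \<nu> s) \<le> C * \<bar>unit_cdf \<mu> s - unit_cdf \<nu> s\<bar>"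
      by (simp add: abs_mult flip: right_diff_distrib)
  qed
  also have "\<dots> = C * integral {u..1} (\<lambda>s. \<bar>unit_cdf \<mu> s - unit_cdf \<nu> s\<bar>)" by simp
  also have "\<dots> \<le> C * cdf_dist \<mu> \<nu>"
    using C[of 0] by (intro mult_left_mono integral_tail_le_cdf_dist assms) auto
  finally show ?thesis .
qed

section \<open>Image measures and discretization\<close>

definition push :: "(real \<Rightarrow> real) \<Rightarrow> real measure \<Rightarrow> real measure" where
  "push g \<mu> = distr \<mu> (restrict_space borel {0..1}) g"

lemma
  assumes \<mu>: "\<mu> \<in> unit_measures" and g: "g \<in> borel_measurable borel" "\<And>x. 0 \<le> x \<Longrightarrow> x \<le> 1 \<Longrightarrow> 0 \<le> g x \<and> g x \<le> 1"
  shows push_unit: "push g \<mu> \<in> unit_measures"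
    and measure_push: "X \<in> sets borel \<Longrightarrow> X \<subseteq> {0..1} \<Longrightarrow> measure (push g \<mu>) X = measure \<mu> {x\<in>{0..1}. g x \<in> X}"
proof -
  have sets: "sets \<mu> = sets (restrict_space borel {0..1})" using \<mu> by (simp add: unit_measures_def)
  have "g \<in> measurable (restrict_space borel {0..1}) (restrict_space borel {0..1})"
    by (rule measurable_restrict_space3[OF g(1)]) (use g(2) in auto)
  then have g': "g \<in> measurable \<mu> (restrict_space borel {0..1})"
    by (simp add: measurable_cong_sets[OF sets refl])
  interpret prob_space \<mu> by (rule unit_prob[OF \<mu>])
  show "push g \<mu> \<in> unit_measures"
    unfolding unit_measures_def push_def using prob_space_distr[OF g'] by simp
  show "measure (push g \<mu>) X = measure \<mu> {x\<in>{0..1}. g x \<in> X}" if "X \<in> sets borel" "X \<subseteq> {0..1}"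
    unfolding push_def using that
    by (subst measure_distr[OF g']) (auto simp: sets_restrict_space_iff unit_space[OF \<mu>] intro!: arg_cong[where f="measure \<mu>"])
qed

text \<open>Rounding up moves mass to the right only, and the new distribution function at
  \<open>s\<close> is the old one at \<open>s\<close> rounded down. The order between distribution
  functions and a constant initial stretch therefore survive discretization.\<close>

definition discretize :: "nat \<Rightarrow> real measure \<Rightarrow> real measure" where
  "discretize n = push (\<lambda>x. real_of_int \<lceil>real (Suc n) * x\<rceil> / real (Suc n))"

lemma discretize_bounds: "0 \<le> x \<Longrightarrow> x \<le> 1 \<Longrightarrow> 
  0 \<le> real_of_int \<lceil>real (Suc n) * x\<rceil> / real (Suc n) \<and> real_of_int \<lceil>real (Suc n) * x\<rceil> / real (Suc n) \<le> 1"
proof -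
  assume x: "0 \<le> x" "x \<le> 1"
  have "0 \<le> \<lceil>real (Suc n) * x\<rceil>" using x by (simp add: less_le_trans[of "-1" 0] del: of_nat_Suc)
  moreover have "\<lceil>real (Suc n) * x\<rceil> \<le> int (Suc n)"
    unfolding ceiling_le_iff using x mult_left_le[of x "real (Suc n)"] by simp
  then have "real_of_int \<lceil>real (Suc n) * x\<rceil> \<le> real (Suc n)" by linarith
  ultimately show ?thesis by (simp del: of_nat_Suc)
qed

lemma discretize_unit: "\<mu> \<in> unit_measures \<Longrightarrow> discretize n \<mu> \<in> unit_measures"
  unfolding discretize_def by (rule push_unit[OF _ _ discretize_bounds]) auto

lemma discretize_cdf:
  assumes \<mu>: "\<mu> \<in> unit_measures" and u: "0 \<le> u" "u \<le> 1"
  shows "unit_cdf (discretize n \<mu>) u = unit_cdf \<mu> (real_of_int \<lfloor>real (Suc n) * u\<rfloor> / real (Suc n))"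
proof -
  have "{x\<in>{0..1}. real_of_int \<lceil>real (Suc n) * x\<rceil> / real (Suc n) \<in> {0..u}} 
      = {0..real_of_int \<lfloor>real (Suc n) * u\<rfloor> / real (Suc n)}"
  proof -
    have "real_of_int \<lceil>real (Suc n) * x\<rceil> / real (Suc n) \<le> u \<longleftrightarrow> x \<le> real_of_int \<lfloor>real (Suc n) * u\<rfloor> / real (Suc n)" for x
    proof -
      have "real_of_int \<lceil>real (Suc n) * x\<rceil> / real (Suc n) \<le> u \<longleftrightarrow> real_of_int \<lceil>real (Suc n) * x\<rceil> \<le> real (Suc n) * u"
        by (simp add: pos_divide_le_eq mult.commute del: of_nat_Suc)
      also have "\<dots> \<longleftrightarrow> \<lceil>real (Suc n) * x\<rceil> \<le> \<lfloor>real (Suc n) * u\<rfloor>" by (rule le_floor_iff[symmetric])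
      also have "\<dots> \<longleftrightarrow> real (Suc n) * x \<le> real_of_int \<lfloor>real (Suc n) * u\<rfloor>" by (rule ceiling_le_iff)
      also have "\<dots> \<longleftrightarrow> x \<le> real_of_int \<lfloor>real (Suc n) * u\<rfloor> / real (Suc n)"
        by (simp add: pos_le_divide_eq mult.commute del: of_nat_Suc)
      finally show ?thesis .
    qed
    moreover have "real_of_int \<lfloor>real (Suc n) * u\<rfloor> / real (Suc n) \<le> u"
      by (simp add: pos_divide_le_eq mult.commute del: of_nat_Suc)
    ultimately show ?thesis using discretize_bounds[of _ n] u by (auto simp del: of_nat_Suc) 
  qed
  moreover have "measure (discretize n \<mu>) {0..u} = measure \<mu> {x\<in>{0..1}. real_of_int \<lceil>real (Suc n) * x\<rceil> / real (Suc n) \<in> {0..u}}"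
    unfolding discretize_def
    by (rule measure_push[OF \<mu> _ discretize_bounds]) (use u in auto)
  ultimately show ?thesis by (simp add: unit_cdf_def)
qed

lemma discretize_discrete:
  assumes \<mu>: "\<mu> \<in> unit_measures" shows "discretize n \<mu> \<in> discrete_unit_measures"
proof -
  let ?A = "(\<lambda>k. real k / real (Suc n)) ` {..Suc n}"
  have fin: "finite ?A" and sub: "?A \<subseteq> {0..1}" by auto
  have "real_of_int \<lceil>real (Suc n) * x\<rceil> / real (Suc n) \<in> ?A" if "x \<in> {0..1}" for x
  proof
    have b: "0 \<le> \<lceil>real (Suc n) * x\<rceil>" "\<lceil>real (Suc n) * x\<rceil> \<le> int (Suc n)"
    proof -
      have a: "0 \<le> real_of_int \<lceil>real (Suc n) * x\<rceil> / real (Suc n)" "real_of_int \<lceil>real (Suc n) * x\<rceil> / real (Suc n) \<le> 1"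
        using discretize_bounds[of x n] that unfolding atLeastAtMost_iff by blast+
      then have "0 \<le> real_of_int \<lceil>real (Suc n) * x\<rceil>" "real_of_int \<lceil>real (Suc n) * x\<rceil> \<le> real (Suc n)"
        by (simp_all add: zero_le_divide_iff divide_le_eq del: of_nat_Suc of_int_0_le_iff)
      then show "0 \<le> \<lceil>real (Suc n) * x\<rceil>" "\<lceil>real (Suc n) * x\<rceil> \<le> int (Suc n)" by linarith+
    qed
    then show "real_of_int \<lceil>real (Suc n) * x\<rceil> / real (Suc n) = real (nat \<lceil>real (Suc n) * x\<rceil>) / real (Suc n)" by simp
    show "nat \<lceil>real (Suc n) * x\<rceil> \<in> {..Suc n}" using b(2) by (simp only: atMost_iff nat_le_iff)
  qed
  then have "{x\<in>{0..1}. real_of_int \<lceil>real (Suc n) * x\<rceil> / real (Suc n) \<in> ?A} = space \<mu>"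
    by (auto simp: unit_space[OF \<mu>] simp del: of_nat_Suc)
  moreover have "measure (discretize n \<mu>) ?A = measure \<mu> {x\<in>{0..1}. real_of_int \<lceil>real (Suc n) * x\<rceil> / real (Suc n) \<in> ?A}"
    unfolding discretize_def
    by (rule measure_push[OF \<mu> _ discretize_bounds _ sub]) (use fin in \<open>auto intro!: borel_closed finite_imp_closed\<close>)
  ultimately have "measure (discretize n \<mu>) ?A = 1"
    using prob_space.prob_space[OF unit_prob[OF \<mu>]] by simp
  then show ?thesis unfolding discrete_unit_measures_def using discretize_unit[OF \<mu>] fin sub by blast
qed

text \<open>A monotone distribution function is continuous off a countable set; there the values at
  the rounded-down points converge, and dominated convergence applies.\<close>

lemma discretize_tendsto:
  assumes \<mu>: "\<mu> \<in> unit_measures"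
  shows "(\<lambda>n. cdf_dist (discretize n \<mu>) \<mu>) \<longlonglongrightarrow> 0"
proof -
  let ?f = "\<lambda>n s. indicator {0..1} s *\<^sub>R \<bar>unit_cdf (discretize n \<mu>) s - unit_cdf \<mu> s\<bar>"
  let ?N = "{a\<in>{0..1}. \<not> continuous (at a within {0..1}) (unit_cdf \<mu>)}"
  have mono: "mono_on {0..1} (unit_cdf \<mu>)" using unit_cdf_mono[OF \<mu>] by (auto simp: mono_on_def)
  have null: "?N \<in> null_sets lborel"
    by (intro countable_imp_null_set_lborel mono_on_ctble_discont mono)
  have "(\<lambda>n. \<integral>s. ?f n s \<partial>lborel) \<longlonglongrightarrow> (\<integral>s. 0 \<partial>(lborel :: real measure))"
  proof (rule integral_dominated_convergence[where w="\<lambda>s. indicator {0..1} s"])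
    show "?f n \<in> borel_measurable lborel" for n
      using unit_integrable_abs_diff(1)[OF discretize_unit[OF \<mu>] \<mu>, of 0 1 n] 
      by (simp add: set_integrable_def borel_measurable_integrable)
    show "AE s in lborel. norm (?f n s) \<le> indicator {0..1} s" for n
    proof (rule AE_I2)
      fix s
      have "\<bar>unit_cdf (discretize n \<mu>) s - unit_cdf \<mu> s\<bar> \<le> 1"
        using unit_cdf_bounds[OF \<mu>, of s] unit_cdf_bounds[OF discretize_unit[OF \<mu>, of n], of s] by (simp add: abs_le_iff)
      then show "norm (?f n s) \<le> indicator {0..1} s" by (auto simp: indicator_def)
    qed
    show "AE s in lborel. (\<lambda>n. ?f n s) \<longlonglongrightarrow> 0"
    proof (rule AE_I'[OF null], safe)
      fix s assume *: "\<not> (\<lambda>n. ?f n s) \<longlonglongrightarrow> 0" 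
      show s: "s \<in> {0..1}"
      proof (rule ccontr)
        assume "s \<notin> {0..1}"
        then have "(\<lambda>n. ?f n s) = (\<lambda>n. 0)" by (auto simp: fun_eq_iff)
        with * show False by (metis tendsto_const)
      qed
      assume cont: "continuous (at s within {0..1}) (unit_cdf \<mu>)"
      let ?a = "\<lambda>n. real_of_int \<lfloor>real (Suc n) * s\<rfloor> / real (Suc n)"
      have a: "\<bar>?a n - s\<bar> \<le> inverse (real (Suc n))" "0 \<le> ?a n" "?a n \<le> 1" for n
      proof -
        have "real_of_int \<lfloor>real (Suc n) * s\<rfloor> \<le> real (Suc n) * s" "real (Suc n) * s < real_of_int \<lfloor>real (Suc n) * s\<rfloor> + 1"
          by linarith+
        then have le: "?a n \<le> s" and ge: "s < ?a n + inverse (real (Suc n))"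
          by (auto simp: divide_simps mult.commute simp del: of_nat_Suc)
        have "0 \<le> \<lfloor>real (Suc n) * s\<rfloor>" using s by simp
        then show "0 \<le> ?a n" by simp
        show "\<bar>?a n - s\<bar> \<le> inverse (real (Suc n))" using le ge by linarith
        show "?a n \<le> 1" by (rule order_trans[OF le]) (use s in simp)
      qed
      have "?a \<longlonglongrightarrow> s"
        by (rule Lim_transform2[OF tendsto_const, of s]) 
          (rule Lim_null_comparison[OF _ LIMSEQ_inverse_real_of_nat], use a in \<open>auto simp: abs_minus_commute simp del: of_nat_Suc\<close>)
      then have "(\<lambda>n. unit_cdf \<mu> (?a n)) \<longlonglongrightarrow> unit_cdf \<mu> s"
        using cont a by (intro continuous_within_tendsto_compose[OF cont]) auto
      then have "(\<lambda>n. \<bar>unit_cdf \<mu> (?a n) - unit_cdf \<mu> s\<bar>) \<longlonglongrightarrow> 0"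
        by (intro tendsto_rabs_zero) (simp add: LIM_zero)
      moreover have "?f n s = \<bar>unit_cdf \<mu> (?a n) - unit_cdf \<mu> s\<bar>" for n
        using discretize_cdf[OF \<mu>, of s n] s by simp
      ultimately show False using * by simp
    qed
  qed auto
  then show ?thesis by (simp add: cdf_dist_def unit_cdf_def set_lebesgue_integral_def)
qed

section \<open>The solution for general measures\<close>

lemma eventually_discrete_approx:
  "eventually P (discrete_approx \<mu>) \<longleftrightarrow> (\<exists>e>0. \<forall>\<nu>\<in>discrete_unit_measures. cdf_dist \<nu> \<mu> < e \<longrightarrow> P \<nu>)"
  unfolding discrete_approx_def
proof (subst eventually_INF_base)
  show "{0<..} \<noteq> ({} :: real set)" by (metis greaterThan_iff empty_iff zero_less_one)
  fix a b :: real assume "a \<in> {0<..}" "b \<in> {0<..}"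
  then show "\<exists>x\<in>{0<..}. principal {\<nu> \<in> discrete_unit_measures. cdf_dist \<nu> \<mu> < x}
     \<le> inf (principal {\<nu> \<in> discrete_unit_measures. cdf_dist \<nu> \<mu> < a}) (principal {\<nu> \<in> discrete_unit_measures. cdf_dist \<nu> \<mu> < b})"
    by (intro bexI[of _ "min a b"]) auto
qed (auto simp: eventually_principal)

context mixture_function begin

definition discrete_solution :: "real measure \<Rightarrow> real \<Rightarrow> real \<Rightarrow> real" where
  "discrete_solution \<mu> u = grid_rec \<xi> (unit_cdf \<mu>) (sorted_list_of_set (atoms \<mu>)) u"

lemma parisi_solution_discrete_eq:
  assumes \<mu>: "\<mu> \<in> discrete_unit_measures" and u: "0 \<le> u" "u \<le> 1"
  shows "parisi_solution_discrete \<xi> \<mu> (x, u) = discrete_solution \<mu> u x"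
  unfolding parisi_solution_discrete_def discrete_solution_def prod.case
  \<comment> \<open>A start below the interval encodes the initial mass m_0 = 0:
    \<open>{0..-1}\<close> is empty, and an atom at 0 still counts as lying to the right of the
    start.\<close>
  by (rule parisi_rec_eq_grid_rec[OF \<mu>, where b="-1"])
     (use discrete_atoms[OF \<mu>] u in \<open>auto simp: unit_cdf_def\<close>)

lemma discrete_solution_class:
  assumes \<mu>: "\<mu> \<in> discrete_unit_measures" and u: "0 \<le> u" "u \<le> 1"
  shows "discrete_solution \<mu> u \<in> parisi_class"
  unfolding discrete_solution_def
  by (rule grid_rec_class) (use discrete_atoms[OF \<mu>] u unit_cdf_bounds[OF discrete_unit[OF \<mu>]] in auto)

lemma discrete_solution_refine:
  assumes \<mu>: "\<mu> \<in> discrete_unit_measures" and u: "0 \<le> u" "u \<le> 1"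
    and B: "finite B" "atoms \<mu> \<subseteq> B" "B \<subseteq> {0..1}"
  shows "discrete_solution \<mu> u = grid_rec \<xi> (unit_cdf \<mu>) (sorted_list_of_set B) u"
proof -
  have "atoms \<mu> \<union> B = B" using B by auto
  then show ?thesis
    using grid_rec_refine[OF B(1) discrete_atoms(1,2)[OF \<mu>] B(3) u order_refl discrete_step_on[OF \<mu>] 
       unit_cdf_1[OF discrete_unit[OF \<mu>]] unit_cdf_bounds[OF discrete_unit[OF \<mu>]]]
    by (simp add: discrete_solution_def)
qed

lemma discrete_dominated:
  assumes \<mu>: "\<mu> \<in> discrete_unit_measures" and \<nu>: "\<nu> \<in> discrete_unit_measures" and u: "0 \<le> u" "u \<le> 1"
    and d: "step_on d (atoms \<mu> \<union> atoms \<nu>)" "\<And>s. 0 \<le> s \<Longrightarrow> s \<le> 1 \<Longrightarrow> unit_cdf \<nu> s - unit_cdf \<mu> s \<le> d s \<and> 0 \<le> \<sigma> * d s" "\<sigma> = 1 \<or> \<sigma> = -1"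
  shows "\<exists>A B. ((\<lambda>s. d s * \<xi>2 s) has_integral A) {u..1} \<and> ((\<lambda>s. d s * \<xi>2 s * (\<xi>1 s - \<xi>1 u)) has_integral B) {u..1}
    \<and> 0 \<le> \<sigma> * A \<and> 0 \<le> \<sigma> * B \<and> dominated (discrete_solution \<mu> u) (discrete_solution \<nu> u) A (max 0 B)"
proof -
  \<comment> \<open>A common grid for both measures; the point 1 anchors the integrals at the upper
    end, and refining does not change either solution.\<close>
  let ?S = "insert 1 (atoms \<mu> \<union> atoms \<nu>)"
  have S: "finite ?S" "?S \<subseteq> {0..1}" using discrete_atoms[OF \<mu>] discrete_atoms[OF \<nu>] by auto
  have "discrete_solution \<mu> u = grid_rec \<xi> (unit_cdf \<mu>) (sorted_list_of_set ?S) u"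
    "discrete_solution \<nu> u = grid_rec \<xi> (unit_cdf \<nu>) (sorted_list_of_set ?S) u"
    by (rule discrete_solution_refine[OF \<mu> u S(1) _ S(2)], blast, rule discrete_solution_refine[OF \<nu> u S(1) _ S(2)], blast)
  moreover have "sorted (sorted_list_of_set ?S)" "set (sorted_list_of_set ?S) = ?S"
    by (rule sorted_sorted_list_of_set, rule set_sorted_list_of_set[OF S(1)])
  moreover have "step_on d ?S" by (rule step_on_mono[OF d(1)]) blast
  ultimately show ?thesis
    using grid_rec_dominated[of "sorted_list_of_set ?S" u ?S d "unit_cdf \<nu>" "unit_cdf \<mu>" \<sigma>]
      S(2) u d(2,3) unit_cdf_bounds[OF discrete_unit[OF \<mu>]] unit_cdf_bounds[OF discrete_unit[OF \<nu>]]
    by (simp only: inf_le1 insertI1 simp_thms)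
qed

lemma step_on_cdf_diff:
  assumes "\<mu> \<in> discrete_unit_measures" "\<nu> \<in> discrete_unit_measures"
  shows "step_on (\<lambda>s. f (unit_cdf \<mu> s) (unit_cdf \<nu> s)) (atoms \<mu> \<union> atoms \<nu>)"
  using step_on_mono[OF discrete_step_on[OF assms(1)], of "atoms \<mu> \<union> atoms \<nu>"]
    step_on_mono[OF discrete_step_on[OF assms(2)], of "atoms \<mu> \<union> atoms \<nu>"]
  unfolding step_on_def by (metis sup_ge1 sup_ge2)

text \<open>Comes from (A + B)/2 with slopes at most 1 in modulus: \<open>A\<close> is at most
  \<xi>''(1) times the integral of the cdf difference, and \<open>B\<close> at most \<xi>'(1) times
  \<open>A\<close>.\<close>

definition lip :: real where "lip = \<xi>2 1 * (1 + \<xi>1 1) / 2"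

lemma lip_nonneg: "0 \<le> lip"
  using \<xi>2_nonneg[of 1] \<xi>1_nonneg[of 1] by (simp add: lip_def)

text \<open>The absolute difference of the distribution functions is a nonnegative majorant for both
  orders of the pair, so the comparison applies in each direction.\<close>

lemma discrete_lipschitz:
  assumes \<mu>: "\<mu> \<in> discrete_unit_measures" and \<nu>: "\<nu> \<in> discrete_unit_measures" and u: "0 \<le> u" "u \<le> 1"
  shows "\<bar>discrete_solution \<nu> u x - discrete_solution \<mu> u x\<bar> 
    \<le> lip * integral {u..1} (\<lambda>s. \<bar>unit_cdf \<mu> s - unit_cdf \<nu> s\<bar>)"
proof -
  have *: "discrete_solution \<nu> u x - discrete_solution \<mu> u x 
      \<le> lip * integral {u..1} (\<lambda>s. \<bar>unit_cdf \<mu> s - unit_cdf \<nu> s\<bar>)"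
    if \<mu>: "\<mu> \<in> discrete_unit_measures" and \<nu>: "\<nu> \<in> discrete_unit_measures" for \<mu> \<nu>
  proof -
    let ?d = "\<lambda>s. \<bar>unit_cdf \<mu> s - unit_cdf \<nu> s\<bar>"
    let ?I = "integral {u..1} ?d"
    have "unit_cdf \<nu> s - unit_cdf \<mu> s \<le> ?d s \<and> 0 \<le> 1 * ?d s" for s by auto
    with discrete_dominated[where \<sigma>=1, OF \<mu> \<nu> u step_on_cdf_diff[OF \<mu> \<nu>, of "\<lambda>a b. \<bar>a - b\<bar>"]]
    obtain A B where A: "((\<lambda>s. ?d s * \<xi>2 s) has_integral A) {u..1}" 
      and B: "((\<lambda>s. ?d s * \<xi>2 s * (\<xi>1 s - \<xi>1 u)) has_integral B) {u..1}"
      and "0 \<le> 1 * A" "0 \<le> 1 * B" and dom0: "dominated (discrete_solution \<mu> u) (discrete_solution \<nu> u) A (max 0 B)"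
      by blast
    then have A0: "0 \<le> A" and dom: "dominated (discrete_solution \<mu> u) (discrete_solution \<nu> u) A B" by auto
    have I: "(?d has_integral ?I) {u..1}"
      by (rule integrable_integral[OF unit_integrable_abs_diff(2)]) (use \<mu> \<nu> u discrete_unit in auto)
    have AI: "A \<le> \<xi>2 1 * ?I"
    proof (rule has_integral_le[OF A has_integral_mult_right[OF I, of "\<xi>2 1"]])
      fix s assume "s \<in> {u..1}"
      then have "?d s * \<xi>2 s \<le> ?d s * \<xi>2 1" using u \<xi>2_mono[of s 1] by (intro mult_left_mono) auto
      then show "?d s * \<xi>2 s \<le> \<xi>2 1 * ?d s" by (simp add: mult.commute)
    qed
    have BA: "B \<le> \<xi>1 1 * A"
    proof (rule has_integral_le[OF B has_integral_mult_right[OF A, of "\<xi>1 1"]])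
      fix s assume s: "s \<in> {u..1}"
      have "\<xi>1 s - \<xi>1 u \<le> \<xi>1 1" using s u \<xi>1_mono[of s 1] \<xi>1_nonneg[of u] by auto
      then have "?d s * \<xi>2 s * (\<xi>1 s - \<xi>1 u) \<le> ?d s * \<xi>2 s * \<xi>1 1"
        using s u \<xi>2_nonneg[of s] by (intro mult_left_mono) auto
      then show "?d s * \<xi>2 s * (\<xi>1 s - \<xi>1 u) \<le> \<xi>1 1 * (?d s * \<xi>2 s)" by (simp add: mult.commute)
    qed
    let ?v = "deriv (discrete_solution \<nu> u) x"
    have "discrete_solution \<nu> u x - discrete_solution \<mu> u x \<le> A / 2 * ?v\<^sup>2 + B / 2"
      using dom[unfolded dominated_def, rule_format, of x 0] by simp
    also have "A / 2 * ?v\<^sup>2 \<le> A / 2 * 1"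
      using A0 class_deriv_square_le[OF discrete_solution_class[OF \<nu> u]] by (intro mult_left_mono) auto
    also have "A / 2 * 1 + B / 2 \<le> (1 + \<xi>1 1) / 2 * A" using BA by (simp add: field_simps)
    also have "\<dots> \<le> (1 + \<xi>1 1) / 2 * (\<xi>2 1 * ?I)" using AI \<xi>1_nonneg[of 1] by (intro mult_left_mono) auto
    finally show ?thesis by (simp add: lip_def mult_ac)
  qed
  show ?thesis using *[OF \<mu> \<nu>] *[OF \<nu> \<mu>] by (simp add: abs_le_iff abs_minus_commute)
qed

lemma discrete_lipschitz_dist:
  assumes \<mu>: "\<mu> \<in> discrete_unit_measures" and \<nu>: "\<nu> \<in> discrete_unit_measures" and u: "0 \<le> u" "u \<le> 1"
  shows "\<bar>discrete_solution \<nu> u x - discrete_solution \<mu> u x\<bar> \<le> lip * cdf_dist \<mu> \<nu>"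
  using discrete_lipschitz[OF assms] mult_left_mono[OF integral_tail_le_cdf_dist[OF discrete_unit[OF \<mu>] discrete_unit[OF \<nu>] u] lip_nonneg]
  by (rule order_trans)

definition solution :: "real measure \<Rightarrow> real \<Rightarrow> real \<Rightarrow> real" where
  "solution \<mu> u x = parisi_solution \<xi> \<mu> (x, u)"

text \<open>A limit has to exist before the choice in \<open>parisi_solution\<close> says anything.
  The Lipschitz bound makes the discretized solutions Cauchy, and their limit is uniformly close to
  every discrete solution whose measure is near \<mu>.\<close>

lemma uniform_limit_parisi_solution:
  assumes \<mu>: "\<mu> \<in> unit_measures"
  shows "uniform_limit (UNIV \<times> {0..1}) (parisi_solution_discrete \<xi>) (parisi_solution \<xi> \<mu>) (discrete_approx \<mu>)"
proof -
  let ?\<mu> = "\<lambda>n. discretize n \<mu>"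
  have dis: "?\<mu> n \<in> discrete_unit_measures" for n by (rule discretize_discrete[OF \<mu>])
  note lim = discretize_tendsto[OF \<mu>]
  define \<Phi> where "\<Phi> = (\<lambda>(x, u). lim (\<lambda>n. discrete_solution (?\<mu> n) u x))"
  have conv: "(\<lambda>n. discrete_solution (?\<mu> n) u x) \<longlonglongrightarrow> \<Phi> (x, u)" if u: "0 \<le> u" "u \<le> 1" for x u
  proof -
    have "Cauchy (\<lambda>n. discrete_solution (?\<mu> n) u x)"
    proof (rule CauchyI')
      fix e :: real assume e: "0 < e"
      \<comment> \<open>Dividing by \<open>lip + 1\<close> keeps the denominator positive and leaves
        room for a strict inequality.\<close>
      let ?c = "e / (lip + 1) / 2"
      have c: "0 < ?c" using e lip_nonneg by simp
      obtain M where M: "\<And>n. M \<le> n \<Longrightarrow> cdf_dist (?\<mu> n) \<mu> < ?c"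
        using order_tendstoD(2)[OF lim c] by (auto simp: eventually_sequentially)
      show "\<exists>M. \<forall>m\<ge>M. \<forall>n>m. dist (discrete_solution (?\<mu> m) u x) (discrete_solution (?\<mu> n) u x) < e"
      proof (intro exI[of _ M] allI impI)
        fix m n assume mn: "M \<le> m" "m < n"
        have "dist (discrete_solution (?\<mu> m) u x) (discrete_solution (?\<mu> n) u x) \<le> lip * cdf_dist (?\<mu> n) (?\<mu> m)"
          unfolding dist_real_def by (rule discrete_lipschitz_dist[OF dis dis u])
        also have "cdf_dist (?\<mu> n) (?\<mu> m) \<le> cdf_dist (?\<mu> n) \<mu> + cdf_dist \<mu> (?\<mu> m)"
          by (intro cdf_dist_triangle discretize_unit \<mu>)
        also have "\<dots> \<le> ?c + ?c" using M[of m] M[of n] mn by (simp add: cdf_dist_commute[of \<mu>])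
        also have "lip * (?c + ?c) < e"
        proof -
          have "lip * (?c + ?c) = e * (lip / (lip + 1))"
            by (simp only: field_sum_of_halves times_divide_eq_right mult.commute)
          also have "\<dots> < e * 1" using e lip_nonneg by (intro mult_strict_left_mono) auto
          finally show ?thesis by simp
        qed
        finally show "dist (discrete_solution (?\<mu> m) u x) (discrete_solution (?\<mu> n) u x) < e"
          using lip_nonneg by (simp add: mult_left_mono)
      qed
    qed
    then show ?thesis unfolding \<Phi>_def prod.case by (simp add: Cauchy_convergent_iff convergent_LIMSEQ_iff)
  qed
  have close: "\<bar>discrete_solution \<nu> u x - \<Phi> (x, u)\<bar> \<le> lip * cdf_dist \<nu> \<mu>" 
    if \<nu>: "\<nu> \<in> discrete_unit_measures" and u: "0 \<le> u" "u \<le> 1" for \<nu> x u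
  proof (rule LIMSEQ_le)
    show "(\<lambda>n. \<bar>discrete_solution \<nu> u x - discrete_solution (?\<mu> n) u x\<bar>) \<longlonglongrightarrow> \<bar>discrete_solution \<nu> u x - \<Phi> (x, u)\<bar>"
      by (intro tendsto_intros conv u)
    show "(\<lambda>n. lip * (cdf_dist (?\<mu> n) \<mu> + cdf_dist \<nu> \<mu>)) \<longlonglongrightarrow> lip * cdf_dist \<nu> \<mu>"
      using tendsto_mult[OF tendsto_const[of lip] tendsto_add[OF lim tendsto_const[of "cdf_dist \<nu> \<mu>"]]] by simp
    have "\<bar>discrete_solution \<nu> u x - discrete_solution (?\<mu> n) u x\<bar> \<le> lip * (cdf_dist (?\<mu> n) \<mu> + cdf_dist \<nu> \<mu>)" for n
    proof -
      have "cdf_dist (?\<mu> n) \<nu> \<le> cdf_dist (?\<mu> n) \<mu> + cdf_dist \<nu> \<mu>"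
        using cdf_dist_triangle[OF discretize_unit[OF \<mu>, of n] \<mu> discrete_unit[OF \<nu>]] by (simp add: cdf_dist_commute)
      then show ?thesis
        using discrete_lipschitz_dist[OF dis[of n] \<nu> u, of x] mult_left_mono[OF _ lip_nonneg] by (meson order_trans)
    qed
    then show "\<exists>N. \<forall>n\<ge>N. \<bar>discrete_solution \<nu> u x - discrete_solution (?\<mu> n) u x\<bar> \<le> lip * (cdf_dist (?\<mu> n) \<mu> + cdf_dist \<nu> \<mu>)"
      by blast
  qed
  have "uniform_limit (UNIV \<times> {0..1}) (parisi_solution_discrete \<xi>) \<Phi> (discrete_approx \<mu>)"
    unfolding uniform_limit_iff
  proof (intro allI impI)
    fix e :: real assume e: "0 < e"
    show "\<forall>\<^sub>F \<nu> in discrete_approx \<mu>. \<forall>x\<in>UNIV \<times> {0..1}. dist (parisi_solution_discrete \<xi> \<nu> x) (\<Phi> x) < e"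
      unfolding eventually_discrete_approx
    proof (intro exI[of _ "e / (lip + 1)"] conjI ballI impI)
      show "0 < e / (lip + 1)" using e lip_nonneg by simp
      fix \<nu> and p :: "real \<times> real" assume \<nu>: "\<nu> \<in> discrete_unit_measures" "cdf_dist \<nu> \<mu> < e / (lip + 1)" and p: "p \<in> UNIV \<times> {0..1}"
      obtain x u where pq: "p = (x, u)" and u: "0 \<le> u" "u \<le> 1" using p by (cases p) auto
      have "\<bar>discrete_solution \<nu> u x - \<Phi> (x, u)\<bar> \<le> lip * cdf_dist \<nu> \<mu>" by (rule close[OF \<nu>(1) u])
      also have "\<dots> \<le> lip * (e / (lip + 1))" using \<nu>(2) lip_nonneg by (intro mult_left_mono) auto
      also have "\<dots> = e * (lip / (lip + 1))" by simp
      also have "\<dots> < e * 1" using e lip_nonneg by (intro mult_strict_left_mono) auto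
      finally show "dist (parisi_solution_discrete \<xi> \<nu> p) (\<Phi> p) < e"
        by (simp add: pq dist_real_def parisi_solution_discrete_eq[OF \<nu>(1) u])
    qed
  qed
  then show ?thesis unfolding parisi_solution_def
    by (rule someI[where P="\<lambda>\<Phi>. uniform_limit (UNIV \<times> {0..1}) (parisi_solution_discrete \<xi>) \<Phi> (discrete_approx \<mu>)"])
qed

text \<open>Valid for whichever limit was chosen: a discretization near \<mu> is close to it by
  uniform convergence, and the Lipschitz bound connects that discretization with \<nu>.\<close>

lemma solution_close:
  assumes \<mu>: "\<mu> \<in> unit_measures" and \<nu>: "\<nu> \<in> discrete_unit_measures" and u: "0 \<le> u" "u \<le> 1"
  shows "\<bar>discrete_solution \<nu> u x - solution \<mu> u x\<bar> \<le> lip * cdf_dist \<nu> \<mu>"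
proof (rule field_le_epsilon)
  fix e :: real assume e: "0 < e"
  have "0 < e / 2" using e by simp
  then have "\<forall>\<^sub>F \<rho> in discrete_approx \<mu>. \<forall>x\<in>UNIV \<times> {0..1}. dist (parisi_solution_discrete \<xi> \<rho> x) (parisi_solution \<xi> \<mu> x) < e / 2"
    using uniform_limit_parisi_solution[OF \<mu>] unfolding uniform_limit_iff by blast
  then obtain r where r: "0 < r" and near: "\<And>\<rho> x. \<rho> \<in> discrete_unit_measures \<Longrightarrow> cdf_dist \<rho> \<mu> < r \<Longrightarrow> x \<in> UNIV \<times> {0..1} 
      \<Longrightarrow> dist (parisi_solution_discrete \<xi> \<rho> x) (parisi_solution \<xi> \<mu> x) < e / 2"
    unfolding eventually_discrete_approx by blast
  let ?r = "min r (e / (lip + 1) / 2)"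
  have "0 < ?r" using r e lip_nonneg by simp
  from order_tendstoD(2)[OF discretize_tendsto[OF \<mu>] this]
  obtain n where n: "cdf_dist (discretize n \<mu>) \<mu> < ?r"
    unfolding eventually_sequentially by blast
  let ?\<rho> = "discretize n \<mu>"
  have \<rho>: "?\<rho> \<in> discrete_unit_measures" by (rule discretize_discrete[OF \<mu>])
  have "dist (parisi_solution_discrete \<xi> ?\<rho> (x, u)) (parisi_solution \<xi> \<mu> (x, u)) < e / 2"
    by (rule near[OF \<rho>]) (use n u in auto)
  then have 1: "\<bar>discrete_solution ?\<rho> u x - solution \<mu> u x\<bar> < e / 2"
    by (simp add: parisi_solution_discrete_eq[OF \<rho> u] solution_def dist_real_def)
  have "\<bar>discrete_solution \<nu> u x - discrete_solution ?\<rho> u x\<bar> \<le> lip * cdf_dist ?\<rho> \<nu>"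
    by (rule discrete_lipschitz_dist[OF \<rho> \<nu> u])
  also have "\<dots> \<le> lip * (cdf_dist ?\<rho> \<mu> + cdf_dist \<nu> \<mu>)"
    using cdf_dist_triangle[OF discretize_unit[OF \<mu>, of n] \<mu> discrete_unit[OF \<nu>]] lip_nonneg
    by (intro mult_left_mono) (auto simp: cdf_dist_commute)
  also have "\<dots> \<le> e / 2 + lip * cdf_dist \<nu> \<mu>"
  proof -
    have "lip * cdf_dist ?\<rho> \<mu> \<le> lip * (e / (lip + 1) / 2)" using n lip_nonneg by (intro mult_left_mono) auto
    also have "\<dots> = (e / 2) * (lip / (lip + 1))"
      by (simp only: times_divide_eq_right times_divide_eq_left divide_divide_eq_left mult.commute)
    also have "\<dots> \<le> (e / 2) * 1" using e lip_nonneg by (intro mult_left_mono) auto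
    finally show ?thesis by (simp add: distrib_left)
  qed
  finally show "\<bar>discrete_solution \<nu> u x - solution \<mu> u x\<bar> \<le> lip * cdf_dist \<nu> \<mu> + e"
    using 1 by linarith
qed

lemma solution_tendsto:
  assumes \<mu>: "\<mu> \<in> unit_measures" and u: "0 \<le> u" "u \<le> 1"
  shows "(\<lambda>n. discrete_solution (discretize n \<mu>) u x) \<longlonglongrightarrow> solution \<mu> u x"
proof -
  have "(\<lambda>n. lip * cdf_dist (discretize n \<mu>) \<mu>) \<longlonglongrightarrow> 0"
    using tendsto_mult[OF tendsto_const[of lip] discretize_tendsto[OF \<mu>]] by simp
  then have "(\<lambda>n. discrete_solution (discretize n \<mu>) u x - solution \<mu> u x) \<longlonglongrightarrow> 0"
    by (rule Lim_null_comparison[rotated]) (use solution_close[OF \<mu> discretize_discrete[OF \<mu>] u] in simp)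
  then show ?thesis by (rule LIM_zero_cancel)
qed

lemma solution_class:
  assumes "\<mu> \<in> unit_measures" "0 \<le> u" "u \<le> 1" shows "solution \<mu> u \<in> parisi_class"
  by (rule class_limit[OF discrete_solution_class solution_tendsto]) (use assms discretize_discrete in auto)

text \<open>The integral is kept over \<open>{u..1}\<close> only. A competitor may change the
  distribution function on all of [0, c), yet its effect at time c is governed by the change above
  c.\<close>

lemma solution_lipschitz:
  assumes \<mu>: "\<mu> \<in> unit_measures" and \<nu>: "\<nu> \<in> unit_measures" and u: "0 \<le> u" "u \<le> 1"
  shows "\<bar>solution \<nu> u x - solution \<mu> u x\<bar> \<le> lip * integral {u..1} (\<lambda>s. \<bar>unit_cdf \<mu> s - unit_cdf \<nu> s\<bar>)"
proof (rule LIMSEQ_le)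
  let ?I = "\<lambda>\<mu> \<nu>. integral {u..1} (\<lambda>s. \<bar>unit_cdf \<mu> s - unit_cdf \<nu> s\<bar>)"
  let ?\<mu> = "\<lambda>n. discretize n \<mu>" and ?\<nu> = "\<lambda>n. discretize n \<nu>"
  show "(\<lambda>n. \<bar>discrete_solution (?\<nu> n) u x - discrete_solution (?\<mu> n) u x\<bar>) \<longlonglongrightarrow> \<bar>solution \<nu> u x - solution \<mu> u x\<bar>"
    by (intro tendsto_intros solution_tendsto \<mu> \<nu> u)
  show "(\<lambda>n. lip * (cdf_dist (?\<mu> n) \<mu> + (?I \<mu> \<nu> + cdf_dist (?\<nu> n) \<nu>))) \<longlonglongrightarrow> lip * ?I \<mu> \<nu>"
    using tendsto_mult[OF tendsto_const[of lip] tendsto_add[OF discretize_tendsto[OF \<mu>] 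
        tendsto_add[OF tendsto_const[of "?I \<mu> \<nu>"] discretize_tendsto[OF \<nu>]]]] by simp
  have "\<bar>discrete_solution (?\<nu> n) u x - discrete_solution (?\<mu> n) u x\<bar> \<le> lip * (cdf_dist (?\<mu> n) \<mu> + (?I \<mu> \<nu> + cdf_dist (?\<nu> n) \<nu>))" for n
  proof -
    note un = discretize_unit[OF \<mu>, of n] discretize_unit[OF \<nu>, of n]
    have "?I (?\<mu> n) (?\<nu> n) \<le> ?I (?\<mu> n) \<mu> + (?I \<mu> \<nu> + ?I \<nu> (?\<nu> n))"
      using integral_tail_triangle[OF un(1) \<mu> un(2) u] integral_tail_triangle[OF \<mu> \<nu> un(2) u] by linarith
    also have "\<dots> \<le> cdf_dist (?\<mu> n) \<mu> + (?I \<mu> \<nu> + cdf_dist (?\<nu> n) \<nu>)"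
      using integral_tail_le_cdf_dist[OF un(1) \<mu> u] integral_tail_le_cdf_dist[OF \<nu> un(2) u] 
      by (simp add: cdf_dist_commute)
    finally show ?thesis
      using discrete_lipschitz[OF discretize_discrete[OF \<mu>] discretize_discrete[OF \<nu>] u] lip_nonneg
      by (meson mult_left_mono order_trans)
  qed
  then show "\<exists>N. \<forall>n\<ge>N. \<bar>discrete_solution (?\<nu> n) u x - discrete_solution (?\<mu> n) u x\<bar> 
      \<le> lip * (cdf_dist (?\<mu> n) \<mu> + (?I \<mu> \<nu> + cdf_dist (?\<nu> n) \<nu>))" by blast
qed

end

section \<open>Flat initial stretches and ordered distribution functions\<close>

context mixture_function begin

text \<open>All grid points below \<open>c\<close> carry the same mass, and the semigroup property
  collapses their steps into one.\<close>

lemma grid_rec_jump: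
  assumes "sorted qs" "set qs \<subseteq> {0..1}" "c \<in> set qs" "0 \<le> u" "u < c" "\<And>s. u \<le> s \<Longrightarrow> s < c \<Longrightarrow> m s = k"
    and m: "\<And>s. 0 \<le> s \<Longrightarrow> s \<le> 1 \<Longrightarrow> 0 \<le> m s \<and> m s \<le> 1"
  shows "grid_rec \<xi> m qs u = gauss_step k (\<xi>1 c - \<xi>1 u) (grid_rec \<xi> m qs c)"
  using assms(1-6)
proof (induction qs arbitrary: u)
  case (Cons q qs)
  have c: "c \<le> 1" "0 \<le> c" using Cons.prems(2,3) by auto
  have qc: "q \<le> c" using Cons.prems(1,3) by auto
  have mu: "m u = k" and k: "0 \<le> k" using Cons.prems(4-6) c m[of u] by auto
  show ?case
  proof (cases "u < q")
    case True
    show ?thesis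
    proof (cases "q = c")
      case True
      then show ?thesis using \<open>u < q\<close> mu by simp
    next
      case False
      then have lt: "q < c" and cq: "c \<in> set qs" using qc Cons.prems(3) by auto
      have "grid_rec \<xi> m qs q = gauss_step k (\<xi>1 c - \<xi>1 q) (grid_rec \<xi> m qs c)"
        by (rule Cons.IH[OF _ _ cq _ lt]) (use Cons.prems(1,2,4,6) True in auto)
      moreover have "grid_rec \<xi> m qs c \<in> parisi_class"
        by (rule grid_rec_class) (use Cons.prems(2) c m in auto)
      moreover have "0 \<le> \<xi>1 q - \<xi>1 u" "0 \<le> \<xi>1 c - \<xi>1 q"
        using \<xi>1_mono[of u q] \<xi>1_mono[of q c] Cons.prems(4) True lt c by auto
      ultimately show ?thesis using True lt mu k by (simp add: gauss_step_semigroup class_nonexpansive)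
    qed
  next
    case False
    then have cq: "c \<in> set qs" using Cons.prems(3,5) by auto
    have "sorted qs" "set qs \<subseteq> {0..1}" using Cons.prems(1,2) by auto
    from Cons.IH[OF this cq Cons.prems(4-6)]
    have "grid_rec \<xi> m qs u = gauss_step k (\<xi>1 c - \<xi>1 u) (grid_rec \<xi> m qs c)" by blast
    then show ?thesis using False qc by simp
  qed
qed simp

text \<open>Discretizing preserves the flat stretch, so the formula holds for every approximation;
  the step is a contraction in the uniform norm, which carries it to the limit.\<close>

lemma solution_step:
  assumes \<mu>: "\<mu> \<in> unit_measures" and c: "0 < c" "c \<le> 1" and m: "\<And>s. 0 \<le> s \<Longrightarrow> s < c \<Longrightarrow> unit_cdf \<mu> s = m"
  shows "solution \<mu> 0 x = gauss_step m (\<xi>1 c) (solution \<mu> c) x"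
proof -
  let ?\<mu> = "\<lambda>n. discretize n \<mu>"
  have m01: "0 \<le> m" "m \<le> 1" using m[of 0] c unit_cdf_bounds[OF \<mu>, of 0] by auto
  have T: "0 \<le> \<xi>1 c" using \<xi>1_nonneg[of c] c by simp
  have dis: "?\<mu> n \<in> discrete_unit_measures" for n by (rule discretize_discrete[OF \<mu>])
  have cdf_n: "unit_cdf (?\<mu> n) s = m" if s: "0 \<le> s" "s < c" for n s
  proof -
    have "real_of_int \<lfloor>real (Suc n) * s\<rfloor> / real (Suc n) \<le> s" "0 \<le> real_of_int \<lfloor>real (Suc n) * s\<rfloor> / real (Suc n)"
      using s by (auto simp: pos_divide_le_eq mult.commute simp del: of_nat_Suc)
    then show ?thesis using discretize_cdf[OF \<mu>, of s n] s c by (simp add: m del: of_nat_Suc)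
  qed
  have step_n: "discrete_solution (?\<mu> n) 0 x = gauss_step m (\<xi>1 c) (discrete_solution (?\<mu> n) c) x" for n
  proof -
    let ?B = "insert c (atoms (?\<mu> n))"
    have B: "finite ?B" "atoms (?\<mu> n) \<subseteq> ?B" "?B \<subseteq> {0..1}" using discrete_atoms[OF dis] c by auto
    have "grid_rec \<xi> (unit_cdf (?\<mu> n)) (sorted_list_of_set ?B) 0 
        = gauss_step m (\<xi>1 c - \<xi>1 0) (grid_rec \<xi> (unit_cdf (?\<mu> n)) (sorted_list_of_set ?B) c)"
    proof (rule grid_rec_jump)
      show "sorted (sorted_list_of_set ?B)" by (rule sorted_sorted_list_of_set)
      show "set (sorted_list_of_set ?B) \<subseteq> {0..1}" "c \<in> set (sorted_list_of_set ?B)"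
        unfolding set_sorted_list_of_set[OF B(1)] using B(3) by auto
    qed (use c cdf_n unit_cdf_bounds[OF discrete_unit[OF dis]] in auto)
    then show ?thesis
      using discrete_solution_refine[OF dis _ _ B, of 0] discrete_solution_refine[OF dis _ _ B, of c] c cdf_n[of 0 n]
      by (simp add: \<xi>1_0)
  qed
  have "(\<lambda>n. gauss_step m (\<xi>1 c) (discrete_solution (?\<mu> n) c) x - gauss_step m (\<xi>1 c) (solution \<mu> c) x) \<longlonglongrightarrow> 0"
  proof (rule Lim_null_comparison)
    show "(\<lambda>n. lip * cdf_dist (?\<mu> n) \<mu>) \<longlonglongrightarrow> 0"
      using tendsto_mult[OF tendsto_const[of lip] discretize_tendsto[OF \<mu>]] by simp
    have "\<bar>gauss_step m (\<xi>1 c) (discrete_solution (?\<mu> n) c) x - gauss_step m (\<xi>1 c) (solution \<mu> c) x\<bar> \<le> lip * cdf_dist (?\<mu> n) \<mu>" for n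
      by (rule gauss_step_contraction[OF _ _ T m01(1) solution_close[OF \<mu> dis]])
        (use c \<mu> dis in \<open>auto intro!: class_nonexpansive solution_class discrete_solution_class\<close>)
    then show "\<forall>\<^sub>F n in sequentially. norm (gauss_step m (\<xi>1 c) (discrete_solution (?\<mu> n) c) x - gauss_step m (\<xi>1 c) (solution \<mu> c) x) 
        \<le> lip * cdf_dist (?\<mu> n) \<mu>" by simp
  qed
  then have "(\<lambda>n. discrete_solution (?\<mu> n) 0 x) \<longlonglongrightarrow> gauss_step m (\<xi>1 c) (solution \<mu> c) x"
    unfolding step_n by (rule LIM_zero_cancel)
  then show ?thesis using solution_tendsto[OF \<mu>, of 0 x] LIMSEQ_unique by auto
qed

lemma weighted_integral_tendsto:
  assumes \<mu>: "\<mu> \<in> unit_measures" and u: "0 \<le> u" "u \<le> 1" and w: "continuous_on {0..1} w"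
  shows "(\<lambda>n. integral {u..1} (\<lambda>s. w s * unit_cdf (discretize n \<mu>) s)) \<longlonglongrightarrow> integral {u..1} (\<lambda>s. w s * unit_cdf \<mu> s)"
proof -
  have "compact (w ` {0..1})" by (rule compact_continuous_image[OF w]) simp
  then obtain C where C: "\<And>s. 0 \<le> s \<Longrightarrow> s \<le> 1 \<Longrightarrow> \<bar>w s\<bar> \<le> C"
    using compact_imp_bounded bounded_real by (metis atLeastAtMost_iff imageI)
  have "(\<lambda>n. C * cdf_dist (discretize n \<mu>) \<mu>) \<longlonglongrightarrow> 0"
    using tendsto_mult[OF tendsto_const[of C] discretize_tendsto[OF \<mu>]] by simp
  then have "(\<lambda>n. integral {u..1} (\<lambda>s. w s * unit_cdf (discretize n \<mu>) s) - integral {u..1} (\<lambda>s. w s * unit_cdf \<mu> s)) \<longlonglongrightarrow> 0"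
    by (rule Lim_null_comparison[rotated]) (use weighted_integral_close[OF discretize_unit[OF \<mu>] \<mu> u w C] in simp)
  then show ?thesis by (rule LIM_zero_cancel)
qed

lemma discretize_cdf_mono:
  assumes \<mu>: "\<mu> \<in> unit_measures" and \<nu>: "\<nu> \<in> unit_measures" and le: "\<And>s. 0 \<le> s \<Longrightarrow> s \<le> 1 \<Longrightarrow> unit_cdf \<mu> s \<le> unit_cdf \<nu> s"
    and s: "0 \<le> s" "s \<le> 1"
  shows "unit_cdf (discretize n \<mu>) s \<le> unit_cdf (discretize n \<nu>) s"
proof -
  let ?a = "real_of_int \<lfloor>real (Suc n) * s\<rfloor> / real (Suc n)"
  have a: "?a \<le> s" "0 \<le> ?a"
    using s by (auto simp: pos_divide_le_eq mult.commute simp del: of_nat_Suc)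
  show ?thesis unfolding discretize_cdf[OF \<mu> s] discretize_cdf[OF \<nu> s]
    by (rule le[OF a(2) order_trans[OF a(1) s(2)]])
qed

lemma weight_diff_integral:
  assumes "\<mu> \<in> unit_measures" "\<nu> \<in> unit_measures" "0 \<le> u" "continuous_on {0..1} w"
  shows "((\<lambda>s. w s * (unit_cdf \<nu> s - unit_cdf \<mu> s)) has_integral 
     integral {u..1} (\<lambda>s. w s * unit_cdf \<nu> s) - integral {u..1} (\<lambda>s. w s * unit_cdf \<mu> s)) {u..1}"
  unfolding right_diff_distrib
  by (intro has_integral_diff integrable_integral unit_cdf_integrable_on assms order_refl)

text \<open>At the origin the slope is zero by evenness, so neither the displacement term nor
  \<open>A\<close> contributes; what remains is \<open>B\<close>, the variance bound \<xi>'(s)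
  weighted with \<xi>''(s).\<close>

lemma solution_le_of_cdf_le:
  assumes \<mu>: "\<mu> \<in> unit_measures" and \<nu>: "\<nu> \<in> unit_measures" and le: "\<And>s. 0 \<le> s \<Longrightarrow> s \<le> 1 \<Longrightarrow> unit_cdf \<mu> s \<le> unit_cdf \<nu> s"
  shows "solution \<nu> 0 0 - solution \<mu> 0 0 \<le> 
    (integral {0..1} (\<lambda>s. \<xi>2 s * \<xi>1 s * unit_cdf \<nu> s) - integral {0..1} (\<lambda>s. \<xi>2 s * \<xi>1 s * unit_cdf \<mu> s)) / 2"
proof (rule LIMSEQ_le)
  let ?\<mu> = "\<lambda>n. discretize n \<mu>" and ?\<nu> = "\<lambda>n. discretize n \<nu>"
  have w: "continuous_on {0..1} (\<lambda>s. \<xi>2 s * \<xi>1 s)" by (intro continuous_intros \<xi>2_continuous \<xi>1_continuous)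
  show "(\<lambda>n. discrete_solution (?\<nu> n) 0 0 - discrete_solution (?\<mu> n) 0 0) \<longlonglongrightarrow> solution \<nu> 0 0 - solution \<mu> 0 0"
    by (intro tendsto_diff solution_tendsto \<mu> \<nu>) auto
  show "(\<lambda>n. (integral {0..1} (\<lambda>s. \<xi>2 s * \<xi>1 s * unit_cdf (?\<nu> n) s) - integral {0..1} (\<lambda>s. \<xi>2 s * \<xi>1 s * unit_cdf (?\<mu> n) s)) / 2) 
     \<longlonglongrightarrow> (integral {0..1} (\<lambda>s. \<xi>2 s * \<xi>1 s * unit_cdf \<nu> s) - integral {0..1} (\<lambda>s. \<xi>2 s * \<xi>1 s * unit_cdf \<mu> s)) / 2"
    by (intro tendsto_divide tendsto_diff weighted_integral_tendsto \<mu> \<nu> w tendsto_const) auto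
  have "discrete_solution (?\<nu> n) 0 0 - discrete_solution (?\<mu> n) 0 0 \<le> 
    (integral {0..1} (\<lambda>s. \<xi>2 s * \<xi>1 s * unit_cdf (?\<nu> n) s) - integral {0..1} (\<lambda>s. \<xi>2 s * \<xi>1 s * unit_cdf (?\<mu> n) s)) / 2" for n
  proof -
    note dis = discretize_discrete[OF \<mu>, of n] discretize_discrete[OF \<nu>, of n]
    let ?d = "\<lambda>s. unit_cdf (?\<nu> n) s - unit_cdf (?\<mu> n) s"
    obtain A B where B: "((\<lambda>s. ?d s * \<xi>2 s * (\<xi>1 s - \<xi>1 0)) has_integral B) {0..1}"
      and "0 \<le> B" and dom: "dominated (discrete_solution (?\<mu> n) 0) (discrete_solution (?\<nu> n) 0) A (max 0 B)"
      using discrete_dominated[where \<sigma>=1, OF dis order_refl _ step_on_cdf_diff[OF dis, of "\<lambda>a b. b - a"]] 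
        discretize_cdf_mono[OF \<mu> \<nu> le] by auto
    have "((\<lambda>s. \<xi>2 s * \<xi>1 s * ?d s) has_integral B) {0..1}" using B by (simp add: \<xi>1_0 mult_ac)
    then have "B = integral {0..1} (\<lambda>s. \<xi>2 s * \<xi>1 s * unit_cdf (?\<nu> n) s) - integral {0..1} (\<lambda>s. \<xi>2 s * \<xi>1 s * unit_cdf (?\<mu> n) s)"
      using weight_diff_integral[OF discretize_unit[OF \<mu>] discretize_unit[OF \<nu>] order_refl w] by (rule has_integral_unique)
    moreover have "discrete_solution (?\<nu> n) 0 0 - discrete_solution (?\<mu> n) 0 0 \<le> B / 2"
      using dom[unfolded dominated_def, rule_format, of 0 0] class_deriv_0[OF discrete_solution_class[OF dis(2)], of 0] \<open>0 \<le> B\<close> by simp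
    ultimately show ?thesis by simp
  qed
  then show "\<exists>N. \<forall>n\<ge>N. discrete_solution (?\<nu> n) 0 0 - discrete_solution (?\<mu> n) 0 0 \<le> 
    (integral {0..1} (\<lambda>s. \<xi>2 s * \<xi>1 s * unit_cdf (?\<nu> n) s) - integral {0..1} (\<lambda>s. \<xi>2 s * \<xi>1 s * unit_cdf (?\<mu> n) s)) / 2"
    by blast
qed

text \<open>The opposite order of the distribution functions: here \<open>B\<close> is discarded and
  \<open>A\<close> is multiplied by the squared slope of the new solution, whose convergence under
  discretization needs the closeness of derivatives.\<close>

lemma solution_le_of_cdf_ge:
  assumes \<mu>: "\<mu> \<in> unit_measures" and \<nu>: "\<nu> \<in> unit_measures" and le: "\<And>s. 0 \<le> s \<Longrightarrow> s \<le> 1 \<Longrightarrow> unit_cdf \<nu> s \<le> unit_cdf \<mu> s"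
    and u: "0 \<le> u" "u \<le> 1"
  shows "solution \<nu> u x - solution \<mu> u x \<le> 
    (integral {u..1} (\<lambda>s. \<xi>2 s * unit_cdf \<nu> s) - integral {u..1} (\<lambda>s. \<xi>2 s * unit_cdf \<mu> s)) / 2 * (deriv (solution \<nu> u) x)\<^sup>2"
proof (rule LIMSEQ_le)
  let ?\<mu> = "\<lambda>n. discretize n \<mu>" and ?\<nu> = "\<lambda>n. discretize n \<nu>"
  let ?A = "\<lambda>n. integral {u..1} (\<lambda>s. \<xi>2 s * unit_cdf (?\<nu> n) s) - integral {u..1} (\<lambda>s. \<xi>2 s * unit_cdf (?\<mu> n) s)"
  show "(\<lambda>n. discrete_solution (?\<nu> n) u x - discrete_solution (?\<mu> n) u x) \<longlonglongrightarrow> solution \<nu> u x - solution \<mu> u x"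
    by (intro tendsto_diff solution_tendsto \<mu> \<nu> u)
  have "(\<lambda>n. deriv (discrete_solution (?\<nu> n) u) x - deriv (solution \<nu> u) x) \<longlonglongrightarrow> 0"
  proof (rule Lim_null_comparison)
    \<comment> \<open>The reciprocal is added because the closeness lemma for derivatives asks for a
      positive bound.\<close>
    let ?e = "\<lambda>n. lip * cdf_dist (?\<nu> n) \<nu> + inverse (real (Suc n))"
    have "?e \<longlonglongrightarrow> lip * 0 + 0"
      by (intro tendsto_intros discretize_tendsto \<nu> LIMSEQ_inverse_real_of_nat)
    then show "(\<lambda>n. 2 * sqrt (?e n)) \<longlonglongrightarrow> 0"
      using tendsto_mult[OF tendsto_const[of 2] tendsto_real_sqrt] by fastforce
    have "\<bar>deriv (discrete_solution (?\<nu> n) u) x - deriv (solution \<nu> u) x\<bar> \<le> 2 * sqrt (?e n)" for n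
    proof (rule class_deriv_close[OF discrete_solution_class[OF discretize_discrete[OF \<nu>] u] solution_class[OF \<nu> u]])
      show "0 < ?e n" 
        by (intro add_nonneg_pos mult_nonneg_nonneg lip_nonneg cdf_dist_nonneg[OF discretize_unit[OF \<nu>] \<nu>]) simp
      fix y
      have "0 \<le> inverse (real (Suc n))" by simp
      with solution_close[OF \<nu> discretize_discrete[OF \<nu>, of n] u, of y]
      show "\<bar>discrete_solution (?\<nu> n) u y - solution \<nu> u y\<bar> \<le> ?e n" by linarith
    qed
    then show "\<forall>\<^sub>F n in sequentially. norm (deriv (discrete_solution (?\<nu> n) u) x - deriv (solution \<nu> u) x) \<le> 2 * sqrt (?e n)"
      by simp
  qed
  then have "(\<lambda>n. deriv (discrete_solution (?\<nu> n) u) x) \<longlonglongrightarrow> deriv (solution \<nu> u) x" by (rule LIM_zero_cancel)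
  then show "(\<lambda>n. ?A n / 2 * (deriv (discrete_solution (?\<nu> n) u) x)\<^sup>2) \<longlonglongrightarrow> 
    (integral {u..1} (\<lambda>s. \<xi>2 s * unit_cdf \<nu> s) - integral {u..1} (\<lambda>s. \<xi>2 s * unit_cdf \<mu> s)) / 2 * (deriv (solution \<nu> u) x)\<^sup>2"
    by (intro tendsto_mult tendsto_power tendsto_divide tendsto_diff weighted_integral_tendsto \<mu> \<nu> u \<xi>2_continuous tendsto_const) auto
  have "discrete_solution (?\<nu> n) u x - discrete_solution (?\<mu> n) u x \<le> ?A n / 2 * (deriv (discrete_solution (?\<nu> n) u) x)\<^sup>2" for n
  proof -
    note dis = discretize_discrete[OF \<mu>, of n] discretize_discrete[OF \<nu>, of n]
    let ?d = "\<lambda>s. unit_cdf (?\<nu> n) s - unit_cdf (?\<mu> n) s"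
    obtain A B where A: "((\<lambda>s. ?d s * \<xi>2 s) has_integral A) {u..1}"
      and "B \<le> 0" and dom: "dominated (discrete_solution (?\<mu> n) u) (discrete_solution (?\<nu> n) u) A (max 0 B)"
      using discrete_dominated[where \<sigma>="-1", OF dis u step_on_cdf_diff[OF dis, of "\<lambda>a b. b - a"]] 
        discretize_cdf_mono[OF \<nu> \<mu> le] by auto
    have "((\<lambda>s. \<xi>2 s * ?d s) has_integral A) {u..1}" using A by (simp add: mult.commute)
    then have "A = ?A n"
      using weight_diff_integral[OF discretize_unit[OF \<mu>] discretize_unit[OF \<nu>] u(1) \<xi>2_continuous] by (rule has_integral_unique)
    then show ?thesis
      using dom[unfolded dominated_def, rule_format, of x 0] \<open>B \<le> 0\<close> by simp
  qed
  then show "\<exists>N. \<forall>n\<ge>N. discrete_solution (?\<nu> n) u x - discrete_solution (?\<mu> n) u x \<le> ?A n / 2 * (deriv (discrete_solution (?\<nu> n) u) x)\<^sup>2"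
    by blast
qed

lemma parisi_functional_eq:
  assumes "\<mu> \<in> unit_measures"
  shows "parisi_functional \<xi> \<mu> = solution \<mu> 0 0 - integral {0..1} (\<lambda>s. s * \<xi>2 s * unit_cdf \<mu> s) / 2"
proof -
  have "continuous_on {0..1} (\<lambda>s. s * \<xi>2 s)" by (intro continuous_intros \<xi>2_continuous)
  from set_borel_integral_eq_integral(2)[OF unit_cdf_set_integrable[OF assms this, of 0 1]]
  show ?thesis by (simp add: parisi_functional_def solution_def unit_cdf_def)
qed

end

text \<open>Realised as a Bernoulli mixture of the two measures, which makes it a probability
  measure on the right sigma-algebra.\<close>

lemma convex_combination_measure:
  assumes \<mu>: "\<mu> \<in> unit_measures" and \<nu>: "\<nu> \<in> unit_measures" and e: "0 \<le> e" "e \<le> 1"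
  obtains \<rho> where "\<rho> \<in> unit_measures" "\<And>u. unit_cdf \<rho> u = (1 - e) * unit_cdf \<mu> u + e * unit_cdf \<nu> u"
proof -
  let ?N = "restrict_space borel {0..1::real}"
  let ?p = "measure_pmf (bernoulli_pmf e)" and ?f = "\<lambda>b. if b then \<nu> else \<mu>"
  have s: "sets \<mu> = sets ?N" "sets \<nu> = sets ?N" using \<mu> \<nu> by (auto simp: unit_measures_def)
  have "?f b \<in> space (subprob_algebra ?N)" for b
    using s unit_prob[OF \<mu>] unit_prob[OF \<nu>] by (auto simp: space_subprob_algebra prob_space_imp_subprob_space)
  then have f: "?f \<in> measurable ?p (subprob_algebra ?N)" by simp
  define \<rho> where "\<rho> = ?p \<bind> ?f"
  have sets: "sets \<rho> = sets ?N" unfolding \<rho>_def by (rule sets_bind) (use s in auto)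
  have em: "emeasure \<rho> X = ennreal ((1 - e) * measure \<mu> X + e * measure \<nu> X)" if X: "X \<in> sets ?N" for X
  proof -
    have "emeasure \<rho> X = (\<integral>\<^sup>+b. emeasure (?f b) X \<partial>?p)"
      unfolding \<rho>_def by (rule emeasure_bind[OF _ f X]) simp
    also have "\<dots> = emeasure \<nu> X * ennreal e + emeasure \<mu> X * ennreal (1 - e)"
      using e by (simp add: nn_integral_bernoulli_pmf)
    also have "\<dots> = ennreal (measure \<nu> X * e) + ennreal (measure \<mu> X * (1 - e))"
      using e finite_measure.emeasure_eq_measure[OF prob_space.finite_measure[OF unit_prob[OF \<mu>]]]
        finite_measure.emeasure_eq_measure[OF prob_space.finite_measure[OF unit_prob[OF \<nu>]]] 
      by (simp add: ennreal_mult')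
    also have "\<dots> = ennreal ((1 - e) * measure \<mu> X + e * measure \<nu> X)"
      using e by (subst ennreal_plus[symmetric]) (simp_all add: mult.commute add.commute)
    finally show ?thesis .
  qed
  have me: "measure \<rho> X = (1 - e) * measure \<mu> X + e * measure \<nu> X" if "X \<in> sets ?N" for X
    unfolding measure_def[of \<rho>] em[OF that] by (rule enn2real_ennreal) (use e in simp)
  have sp: "space \<rho> = {0..1}" using sets_eq_imp_space_eq[OF sets] by (simp add: space_restrict_space)
  have "emeasure \<rho> (space \<rho>) = 1"
    using em[of "{0..1}"] prob_space.prob_space[OF unit_prob[OF \<mu>]] prob_space.prob_space[OF unit_prob[OF \<nu>]] 
    by (simp add: sp unit_space[OF \<mu>] unit_space[OF \<nu>] sets_restrict_space_iff)
  then have "\<rho> \<in> unit_measures" unfolding unit_measures_def using sets by (auto intro: prob_spaceI)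
  moreover have "unit_cdf \<rho> u = (1 - e) * unit_cdf \<mu> u + e * unit_cdf \<nu> u" for u
  proof (cases "{0..u} \<in> sets ?N")
    case True
    then show ?thesis unfolding unit_cdf_def by (rule me)
  next
    \<comment> \<open>Beyond 1 the set is not measurable for any of the three measures, and all
      three values are 0.\<close>
    case False
    then show ?thesis unfolding unit_cdf_def using s sets by (simp add: measure_notin_sets)
  qed
  ultimately show ?thesis by (rule that)
qed

section \<open>A sharp Poincare inequality for even functions\<close>

lemma std_normal_density_has_deriv:
  "(std_normal_density has_real_derivative - x * std_normal_density x) (at x)"
proof -
  have "((\<lambda>x. exp (- x\<^sup>2 / 2)) has_real_derivative exp (- x\<^sup>2 / 2) * (- x)) (at x)"
    by (auto intro!: derivative_eq_intros)
  from DERIV_cmult[OF this, of "1 / sqrt (2 * pi)"] show ?thesis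
    unfolding std_normal_density_def[abs_def] by (simp only: mult_ac mult_minus_left mult_minus_right)
qed

lemma std_normal_density_le_1: "std_normal_density x \<le> 1"
proof -
  have "1 \<le> sqrt (2 * pi)" using pi_ge_two by simp
  then have "1 / sqrt (2 * pi) * exp (- x\<^sup>2 / 2) \<le> 1 * 1"
    by (intro mult_mono) auto
  then show ?thesis by (simp add: std_normal_density_def)
qed

text \<open>With \<open>N x = F x - F 1\<close> (after scaling) and \<open>g x = x\<^sup>2 - 1\<close>, an eigenfunction of the Ornstein--Uhlenbeck
  generator, the deficit in the inequality is the Gaussian integral of \<open>(N' - 2 x N / g)\<^sup>2 / 2\<close>, up to the
  derivative of \<open>x \<gamma> N\<^sup>2 / g\<close>, where \<open>\<gamma>\<close> is the Gaussian density. It vanishes only if \<open>N\<close> is a multiple of \<open>g\<close>, which is not Lipschitz unless it is zero.\<close>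

lemma even_Poincare_strict:
  assumes F: "F \<in> parisi_class" and T: "0 < T" and nz: "deriv F x0 \<noteq> 0"
  shows "gexp (\<lambda>z. (F (z * sqrt T) - F (sqrt T))\<^sup>2) < T / 2 * gexp (\<lambda>z. (deriv F (z * sqrt T))\<^sup>2)"
proof -
  define s where "s = sqrt T"
  have s: "0 < s" "s * s = T" using T by (auto simp: s_def)
  define N where "N x = F (x * s) - F s" for x
  define \<phi> where "\<phi> x = s * deriv F (x * s)" for x
  define \<gamma> where "\<gamma> = std_normal_density"
  define r where "r x = \<phi> x - 2 * x * N x / (x\<^sup>2 - 1)" for x
  define W where "W x = x * \<gamma> x * (N x)\<^sup>2 / (x\<^sup>2 - 1)" for x
  define D where "D x = \<gamma> x * ((\<phi> x)\<^sup>2 / 2 - (N x)\<^sup>2)" for x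
  define R where "R x = \<gamma> x * (r x)\<^sup>2 / 2" for x
  have \<gamma>pos: "0 < \<gamma> x" "\<gamma> x \<le> 1" for x
    using normal_density_pos[of 1 0 x] std_normal_density_le_1[of x] by (auto simp: \<gamma>_def)
  have \<gamma>even: "\<gamma> (- x) = \<gamma> x" for x by (simp add: \<gamma>_def std_normal_density_def)
  have derN: "(N has_real_derivative \<phi> x) (at x)" for x
    unfolding N_def \<phi>_def
    by (auto intro!: derivative_eq_intros DERIV_chain2[OF class_has_deriv[OF F]])
  have der\<gamma>: "(\<gamma> has_real_derivative - x * \<gamma> x) (at x)" for x
    unfolding \<gamma>_def by (rule std_normal_density_has_deriv)
  have contN: "isCont N x" for x by (rule DERIV_isCont[OF derN])
  have cont\<gamma>: "isCont \<gamma> x" for x by (rule DERIV_isCont[OF der\<gamma>])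
  have cont\<phi>: "isCont \<phi> x" for x
  proof -
    have "continuous_on UNIV (\<lambda>x. s * deriv F (x * s))"
      by (intro continuous_intros continuous_on_compose2[OF nonexpansive_continuous[OF class_deriv_nonexpansive[OF F]]]) auto
    then show ?thesis by (simp add: \<phi>_def[abs_def] continuous_on_eq_continuous_at)
  qed
  have Neven: "N (- x) = N x" for x using class_even[OF F, of "x * s"] by (simp add: N_def)
  have Nle: "\<bar>N x\<bar> \<le> s * \<bar>\<bar>x\<bar> - 1\<bar>" for x
  proof -
    have "N x = N \<bar>x\<bar>" using Neven[of x] by (cases "0 \<le> x") auto
    also have "\<bar>\<dots>\<bar> \<le> \<bar>\<bar>x\<bar> * s - s\<bar>" unfolding N_def by (rule nonexpansiveD[OF class_nonexpansive[OF F]])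
    also have "\<bar>x\<bar> * s - s = s * (\<bar>x\<bar> - 1)" by (simp add: algebra_simps)
    also have "\<bar>\<dots>\<bar> = s * \<bar>\<bar>x\<bar> - 1\<bar>" using s(1) by (simp add: abs_mult)
    finally show ?thesis .
  qed
  \<comment> \<open>Secures continuity at x^2 = 1, where the denominator vanishes. There division by
    zero sets \<open>W\<close> to 0, which is also its limit, since \<open>N\<close> vanishes at
    both points and enters squared.\<close>
  have W_le: "\<bar>W x\<bar> \<le> s\<^sup>2 * \<bar>\<bar>x\<bar> - 1\<bar>" for x
  proof (cases "x\<^sup>2 = 1")
    case False
    let ?a = "\<bar>x\<bar>"
    have a1: "?a \<noteq> 1" using False by (metis abs_square_eq_1)
    have g: "\<bar>x\<^sup>2 - 1\<bar> = \<bar>?a - 1\<bar> * (?a + 1)"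
    proof -
      have "x\<^sup>2 - 1 = (?a - 1) * (?a + 1)" by (simp add: algebra_simps power2_eq_square)
      then show ?thesis by (simp add: abs_mult)
    qed
    have "(N x)\<^sup>2 \<le> (s * \<bar>?a - 1\<bar>)\<^sup>2" using Nle[of x] by (metis abs_ge_zero power2_abs power_mono)
    then have "(N x)\<^sup>2 \<le> s\<^sup>2 * \<bar>?a - 1\<bar> * \<bar>?a - 1\<bar>" by (simp add: power2_eq_square mult_ac)
    moreover have "?a * \<gamma> x \<le> (?a + 1) * 1" using \<gamma>pos[of x] by (intro mult_mono) auto
    ultimately have "(?a * \<gamma> x) * (N x)\<^sup>2 \<le> (?a + 1) * (s\<^sup>2 * \<bar>?a - 1\<bar> * \<bar>?a - 1\<bar>)"
      using \<gamma>pos(1)[of x] by (intro mult_mono) auto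
    also have "\<dots> = s\<^sup>2 * \<bar>?a - 1\<bar> * \<bar>x\<^sup>2 - 1\<bar>" unfolding g by simp
    finally have "\<bar>x * \<gamma> x * (N x)\<^sup>2\<bar> \<le> s\<^sup>2 * \<bar>?a - 1\<bar> * \<bar>x\<^sup>2 - 1\<bar>"
      using \<gamma>pos(1)[of x] by (simp add: abs_mult)
    then show ?thesis using False unfolding W_def abs_divide by (simp add: pos_divide_le_eq)
  qed (simp add: W_def)
  have derW: "(W has_real_derivative D x - R x) (at x)" if x: "x\<^sup>2 \<noteq> 1" for x
  proof -
    define g where "g = x\<^sup>2 - 1"
    have g: "g \<noteq> 0" using x by (simp add: g_def)
    have "(W has_real_derivative (((1 * \<gamma> x + x * (- x * \<gamma> x)) * (N x)\<^sup>2 + x * \<gamma> x * (2 * N x * \<phi> x)) * g - x * \<gamma> x * (N x)\<^sup>2 * (2 * x)) / (g * g)) (at x)"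
      unfolding W_def[abs_def] g_def
      by (rule derivative_eq_intros derN der\<gamma> refl | use x in simp)+
    also have "((1 * \<gamma> x + x * (- x * \<gamma> x)) * (N x)\<^sup>2 + x * \<gamma> x * (2 * N x * \<phi> x)) * g - x * \<gamma> x * (N x)\<^sup>2 * (2 * x)
       = \<gamma> x * ((- g * (N x)\<^sup>2 + 2 * x * N x * \<phi> x) * g - 2 * x\<^sup>2 * (N x)\<^sup>2)"
      by (simp add: g_def power2_eq_square algebra_simps)
    also have "\<dots> / (g * g) = D x - R x"
      using g unfolding D_def R_def r_def g_def[symmetric]
      by (simp add: divide_simps) (simp add: power2_eq_square algebra_simps)
    finally show ?thesis .
  qed
  have contW: "isCont W x" for x
  proof (cases "x\<^sup>2 = 1")
    case False
    then show ?thesis using DERIV_isCont[OF derW] by simp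
  next
    case True
    have "((\<lambda>y. s\<^sup>2 * \<bar>\<bar>y\<bar> - 1\<bar>) \<longlongrightarrow> s\<^sup>2 * \<bar>\<bar>x\<bar> - 1\<bar>) (at x)" by (intro tendsto_intros)
    moreover have "\<bar>x\<bar> = 1" using True by (metis abs_square_eq_1)
    ultimately have "(W \<longlongrightarrow> 0) (at x)"
      by (intro Lim_null_comparison[OF always_eventually[OF allI[OF W_le[folded real_norm_def]]]]) simp
    then show ?thesis using True by (simp add: isCont_def W_def)
  qed
  have contD: "isCont D x" for x unfolding D_def by (intro continuous_intros cont\<gamma> contN cont\<phi>) auto
  have R_nonneg: "0 \<le> R x" for x using \<gamma>pos(1)[of x] by (simp add: R_def)
  have W_odd: "W (- x) = - W x" for x by (simp add: W_def Neven \<gamma>even)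
  have W_nonneg: "0 \<le> W x" if "1 < x" for x 
  proof -
    have "0 \<le> x\<^sup>2 - 1" using that by (simp add: less_imp_le)
    then show ?thesis using that \<gamma>pos(1)[of x] by (simp add: W_def)
  qed
  \<comment> \<open>Otherwise \<open>N\<close> would be a multiple of x^2 - 1 beyond 1. The linear
    growth of \<open>N\<close> makes the factor zero, so the slope of \<open>F\<close> vanishes far
    out, and by oddness and monotonicity everywhere, against \<open>nz\<close>.\<close>
  obtain x1 where x1: "1 < x1" "r x1 \<noteq> 0"
  proof (rule ccontr)
    assume "\<not> thesis"
    with that have r0: "\<And>x. 1 < x \<Longrightarrow> r x = 0" by blast
    have sq: "x\<^sup>2 - 1 \<noteq> 0" if "1 < x" for x :: real using that by (metis abs_square_eq_1 abs_of_pos less_irrefl eq_iff_diff_eq_0 less_trans zero_less_one)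
    have "\<exists>c. \<forall>x\<in>{1<..}. N x / (x\<^sup>2 - 1) = c"
    proof (rule has_field_derivative_zero_constant)
      fix x :: real assume x: "x \<in> {1<..}"
      have "((\<lambda>x. N x / (x\<^sup>2 - 1)) has_real_derivative (\<phi> x * (x\<^sup>2 - 1) - N x * (2 * x)) / ((x\<^sup>2 - 1) * (x\<^sup>2 - 1))) (at x)"
        by (rule derivative_eq_intros derN refl | use x sq in simp)+
      also have "(\<phi> x * (x\<^sup>2 - 1) - N x * (2 * x)) = r x * (x\<^sup>2 - 1)"
      proof -
        define g where "g = x\<^sup>2 - 1"
        have "g \<noteq> 0" using x sq[of x] by (simp add: g_def)
        then show ?thesis unfolding r_def g_def[symmetric] by (simp add: field_simps)
      qed
      also have "r x = 0" using r0 x by simp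
      finally have "((\<lambda>x. N x / (x\<^sup>2 - 1)) has_real_derivative 0) (at x)"
        by (simp only: mult_zero_left div_0)
      then show "((\<lambda>x. N x / (x\<^sup>2 - 1)) has_real_derivative 0) (at x within {1<..})"
        by (rule has_field_derivative_at_within)
    qed auto
    then obtain c where c: "\<And>x. 1 < x \<Longrightarrow> N x = c * (x\<^sup>2 - 1)" using sq by (auto simp: divide_eq_eq)
    have "c = 0"
    proof (rule ccontr)
      assume c0: "c \<noteq> 0"
      \<comment> \<open>Chosen so that \<open>|c| * (x + 1) = s + 3 * |c|\<close> exceeds the
        Lipschitz bound \<open>s\<close>.\<close>
      define x where "x = s / \<bar>c\<bar> + 2"
      have "0 \<le> s / \<bar>c\<bar>" using s by simp
      then have x: "1 < x" unfolding x_def by linarith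
      have "\<bar>c\<bar> * (x + 1) * (x - 1) = \<bar>N x\<bar>"
      proof -
        have "x\<^sup>2 - 1 = (x + 1) * (x - 1)" by (simp add: power2_eq_square algebra_simps)
        then show ?thesis using x c[of x] by (simp add: abs_mult)
      qed
      also have "\<dots> \<le> s * (x - 1)" using Nle[of x] x by simp
      finally have "\<bar>c\<bar> * (x + 1) \<le> s" using x by simp
      moreover have "\<bar>c\<bar> * (x + 1) = s + 3 * \<bar>c\<bar>" using c0 by (simp add: x_def algebra_simps)
      ultimately show False using c0 by simp
    qed
    then have "\<phi> x = 0" if "1 < x" for x using r0[OF that] c[OF that] by (simp add: r_def)
    then have d0: "deriv F y = 0" if "s < y" for y
      using that s by (simp add: \<phi>_def) (metis less_divide_eq_1_pos nonzero_eq_divide_eq order_less_irrefl)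
    define y where "y = max \<bar>x0\<bar> s + 1"
    have y: "s < y" "- y \<le> x0" "x0 \<le> y" by (auto simp: y_def)
    have "deriv F (- y) = 0" using class_deriv_uminus[OF F, of y] d0[OF y(1)] by simp
    then show False using class_deriv_mono[OF F y(2)] class_deriv_mono[OF F y(3)] d0[OF y(1)] nz by simp
  qed
  have x1sq: "x1\<^sup>2 - 1 \<noteq> 0" using x1(1) by (metis abs_square_eq_1 abs_of_pos less_irrefl eq_iff_diff_eq_0 less_trans zero_less_one)
  have R1: "0 < R x1" using x1 \<gamma>pos(1)[of x1] by (simp add: R_def)
  have "isCont R x1" unfolding R_def r_def
    by (intro continuous_intros cont\<gamma> contN cont\<phi>) (use x1sq in auto)
  then obtain \<delta> where \<delta>: "0 < \<delta>" "\<And>x. \<bar>x - x1\<bar> < \<delta> \<Longrightarrow> \<bar>R x - R x1\<bar> < R x1 / 2"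
    unfolding continuous_at_eps_delta dist_real_def using R1 by (metis half_gt_zero)
  \<comment> \<open>A lower bound for the integral of \<open>R\<close> near \<open>x1\<close>, where
    \<open>R\<close> stays above half its value. It does not depend on \<open>M\<close>, so
    strictness survives the limit of growing intervals.\<close>
  define \<kappa> where "\<kappa> = \<delta> / 2 * (R x1 / 2)"
  have \<kappa>: "0 < \<kappa>" using \<delta> R1 by (simp add: \<kappa>_def)
  have intD: "\<kappa> \<le> integral {-M..M} D" if M: "x1 + \<delta> \<le> M" for M
  proof -
    have M1: "1 < M" using M x1 \<delta> by linarith
    have "((\<lambda>x. D x - R x) has_integral W M - W (- M)) {-M..M}"
      by (rule fundamental_theorem_of_calculus_interior_strong[where S="{1, -1}"])
         (use M1 derW in \<open>auto simp: has_real_derivative_iff_has_vector_derivative[symmetric] power2_eq_1_iff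
            intro: continuous_at_imp_continuous_on contW\<close>)
    \<comment> \<open>\<open>W\<close> is odd, so the boundary terms add up to
      \<open>2 * W M\<close>, which is nonnegative beyond 1. Only its sign is used; no decay at
      infinity has to be shown.\<close>
    then have DR: "((\<lambda>x. D x - R x) has_integral 2 * W M) {-M..M}" by (simp add: W_odd)
    have Dint: "D integrable_on {-M..M}"
      by (intro integrable_continuous_real continuous_at_imp_continuous_on ballI contD)
    have "((\<lambda>x. D x - (D x - R x)) has_integral integral {-M..M} D - 2 * W M) {-M..M}"
      by (intro has_integral_diff integrable_integral Dint DR)
    then have Rint: "(R has_integral integral {-M..M} D - 2 * W M) {-M..M}" by simp
    have sub: "{x1..x1 + \<delta> / 2} \<subseteq> {-M..M}" using M x1 \<delta> by auto
    have Rsub: "R integrable_on {x1..x1 + \<delta> / 2}"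
      using integrable_on_subinterval[OF has_integral_integrable[OF Rint] sub] .
    have "\<kappa> = integral {x1..x1 + \<delta> / 2} (\<lambda>_. R x1 / 2)" using \<delta> by (simp add: \<kappa>_def)
    also have "\<dots> \<le> integral {x1..x1 + \<delta> / 2} R"
    proof (rule integral_le[OF _ Rsub])
      fix x assume "x \<in> {x1..x1 + \<delta> / 2}"
      then have "\<bar>R x - R x1\<bar> < R x1 / 2" using \<delta>(1) by (intro \<delta>(2)) auto
      then show "R x1 / 2 \<le> R x" by linarith
    qed auto
    also have "\<dots> \<le> integral {-M..M} R"
      by (rule integral_subset_le[OF sub Rsub has_integral_integrable[OF Rint]]) (use R_nonneg in auto)
    also have "\<dots> = integral {-M..M} D - 2 * W M" using Rint by (rule integral_unique)
    finally show ?thesis using W_nonneg[OF M1] by linarith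
  qed
  have meas[measurable]: "N \<in> borel_measurable borel" "\<phi> \<in> borel_measurable borel"
    using contN cont\<phi> by (auto intro!: borel_measurable_continuous_onI simp: continuous_on_eq_continuous_at)
  have i\<phi>: "integrable std_normal_distribution (\<lambda>z. (\<phi> z)\<^sup>2)"
  proof (rule integrable_gaussI[where C="s\<^sup>2" and c=0])
    show "\<bar>(\<phi> z)\<^sup>2\<bar> \<le> s\<^sup>2 * exp (0 * \<bar>z\<bar>)" for z
      using class_deriv_square_le[OF F, of "z * s"] by (simp add: \<phi>_def power_mult_distrib mult_left_le)
  qed measurable
  have iN: "integrable std_normal_distribution (\<lambda>z. (N z)\<^sup>2)"
  proof (rule integrable_gaussI[where C="4 * s\<^sup>2" and c=2])
    fix z
    have "s * \<bar>\<bar>z\<bar> - 1\<bar> \<le> s * (2 * exp \<bar>z\<bar>)"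
    proof (rule mult_left_mono)
      have "1 \<le> exp \<bar>z\<bar>" by simp
      then show "\<bar>\<bar>z\<bar> - 1\<bar> \<le> 2 * exp \<bar>z\<bar>" using abs_le_exp_abs[of z] by arith
    qed (use s in simp)
    with Nle[of z] have "\<bar>N z\<bar> \<le> s * (2 * exp \<bar>z\<bar>)" by linarith
    then have "(N z)\<^sup>2 \<le> (s * (2 * exp \<bar>z\<bar>))\<^sup>2" by (metis abs_ge_zero power2_abs power_mono)
    also have "\<dots> = 4 * s\<^sup>2 * (exp \<bar>z\<bar> * exp \<bar>z\<bar>)" by (simp add: power2_eq_square)
    also have "exp \<bar>z\<bar> * exp \<bar>z\<bar> = exp (2 * \<bar>z\<bar>)" by (simp add: mult_exp_exp)
    finally show "\<bar>(N z)\<^sup>2\<bar> \<le> 4 * s\<^sup>2 * exp (2 * \<bar>z\<bar>)" by simp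
  qed measurable
  have iD0: "integrable std_normal_distribution (\<lambda>z. (\<phi> z)\<^sup>2 / 2 - (N z)\<^sup>2)"
    by (intro Bochner_Integration.integrable_diff iN integrable_divide i\<phi>)
  then have iD: "integrable lborel D"
    unfolding D_def[abs_def] \<gamma>_def by (subst (asm) integrable_density) auto
  have gD: "gexp (\<lambda>z. (\<phi> z)\<^sup>2 / 2 - (N z)\<^sup>2) = (\<integral>x. D x \<partial>lborel)"
    unfolding D_def[abs_def] \<gamma>_def by (subst integral_density) auto
  have "(\<lambda>n. \<integral>x. indicator {- real n..real n} x * D x \<partial>lborel) \<longlonglongrightarrow> (\<integral>x. D x \<partial>lborel)"
  proof (rule integral_dominated_convergence[where w="\<lambda>x. \<bar>D x\<bar>"])
    show "AE x in lborel. (\<lambda>n. indicator {- real n..real n} x * D x) \<longlonglongrightarrow> D x"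
    proof (rule AE_I2)
      fix x :: real
      obtain n0 where n0: "\<bar>x\<bar> \<le> real n0" using real_arch_simple by blast
      have "\<forall>\<^sub>F n in sequentially. indicator {- real n..real n} x * D x = D x"
        using eventually_ge_at_top[of n0]
      proof eventually_elim
        case (elim n)
        then have "\<bar>x\<bar> \<le> real n" using n0 by linarith
        then show ?case by (auto simp: indicator_def)
      qed
      then show "(\<lambda>n. indicator {- real n..real n} x * D x) \<longlonglongrightarrow> D x" by (rule tendsto_eventually)
    qed
  qed (use iD in \<open>auto simp: indicator_def borel_measurable_integrable\<close>)
  moreover have "\<exists>n1. \<forall>n\<ge>n1. \<kappa> \<le> (\<integral>x. indicator {- real n..real n} x * D x \<partial>lborel)"
  proof -
    obtain n1 where n1: "x1 + \<delta> \<le> real n1" using real_arch_simple by blast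
    have "\<kappa> \<le> (\<integral>x. indicator {- real n..real n} x * D x \<partial>lborel)" if "n1 \<le> n" for n
    proof -
      have "set_integrable lborel {- real n..real n} D"
        unfolding set_integrable_def by (rule integrable_mult_indicator) (use iD in simp_all)
      from set_borel_integral_eq_integral(2)[OF this] 
      have "(\<integral>x. indicator {- real n..real n} x * D x \<partial>lborel) = integral {- real n..real n} D"
        by (simp add: set_lebesgue_integral_def)
      then show ?thesis using intD[of "real n"] n1 that by simp
    qed
    then show ?thesis by blast
  qed
  ultimately have "\<kappa> \<le> (\<integral>x. D x \<partial>lborel)" by (rule LIMSEQ_le_const)
  then have "0 < gexp (\<lambda>z. (\<phi> z)\<^sup>2 / 2 - (N z)\<^sup>2)" unfolding gD using \<kappa> by linarith
  also have "\<dots> = gexp (\<lambda>z. (\<phi> z)\<^sup>2 / 2) - gexp (\<lambda>z. (N z)\<^sup>2)"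
    by (intro Bochner_Integration.integral_diff iN integrable_divide i\<phi>)
  also have "gexp (\<lambda>z. (\<phi> z)\<^sup>2 / 2) = T / 2 * gexp (\<lambda>z. (deriv F (z * sqrt T))\<^sup>2)"
    using s by (simp add: \<phi>_def power_mult_distrib s_def[symmetric] power2_eq_square[of s])
  finally show ?thesis by (simp add: N_def s_def)
qed

section \<open>Expansion of a recursion step for small mass\<close>

lemma exp_third_order_le: "exp t \<le> 1 + t + t\<^sup>2 / 2 + \<bar>t\<bar> ^ 3 * exp \<bar>t :: real\<bar>"
proof -
  obtain u where u: "\<bar>u\<bar> \<le> \<bar>t\<bar>" "exp t = (\<Sum>m<3. t ^ m / fact m) + exp u / fact 3 * t ^ 3"
    using Maclaurin_exp_le[of t 3] by blast
  have "exp u / fact 3 * t ^ 3 \<le> \<bar>exp u / fact 3 * t ^ 3\<bar>" by (rule abs_ge_self)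
  also have "\<dots> = exp u / fact 3 * \<bar>t\<bar> ^ 3" by (simp add: abs_mult power_abs)
  also have "\<dots> \<le> exp \<bar>t\<bar> * \<bar>t\<bar> ^ 3"
  proof (rule mult_right_mono)
    have "exp u / fact 3 \<le> exp u / 1" by (intro divide_left_mono) (auto simp: fact_numeral)
    also have "\<dots> \<le> exp \<bar>t\<bar>" using u(1) by simp
    finally show "exp u / fact 3 \<le> exp \<bar>t\<bar>" .
  qed auto
  finally have "exp u / fact 3 * t ^ 3 \<le> \<bar>t\<bar> ^ 3 * exp \<bar>t\<bar>" by (simp only: mult.commute)
  moreover have "(\<Sum>m<3. t ^ m / fact m) = 1 + t + t\<^sup>2 / 2" by (simp add: eval_nat_numeral)
  ultimately show ?thesis using u(2) by linarith
qed

text \<open>Cumulant expansion: after centring, the linear term integrates to zero, the quadratic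
  one gives the variance, and the cubic remainder divided by \<open>p\<close> is of order p^2. The
  logarithm is avoided through 1 + t <= exp t.\<close>

lemma gauss_step_second_order:
  assumes F: "nonexpansive F" and T: "0 \<le> T"
  obtains K where "\<And>p. 0 < p \<Longrightarrow> p \<le> 1 \<Longrightarrow> gauss_step p T F 0 \<le> gexp (\<lambda>z. F (z * sqrt T)) 
      + p / 2 * gexp (\<lambda>z. (F (z * sqrt T) - gexp (\<lambda>z. F (z * sqrt T)))\<^sup>2) + K * p\<^sup>2"
proof -
  note [measurable] = nonexpansive_measurable[OF F]
  define G where "G = gexp (\<lambda>z. F (z * sqrt T))"
  define X where "X z = F (z * sqrt T) - G" for z
  define V where "V = gexp (\<lambda>z. (X z)\<^sup>2)"
  define c where "c = \<bar>F 0 - G\<bar>"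
  define K where "K = exp (4 * c) * gexp (\<lambda>z. exp (4 * sqrt T * \<bar>z\<bar>))"
  have [measurable]: "X \<in> borel_measurable borel" unfolding X_def by measurable
  have iF: "integrable std_normal_distribution (\<lambda>z. F (z * sqrt T))" using nonexpansive_integrable[OF F T, of 0] by simp
  have iX: "integrable std_normal_distribution X"
    unfolding X_def by (intro Bochner_Integration.integrable_diff iF integrable_gauss_const)
  have EX: "gexp X = 0"
    unfolding X_def by (subst Bochner_Integration.integral_diff[OF iF integrable_gauss_const]) (simp add: G_def)
  have Xle: "\<bar>X z\<bar> \<le> c + sqrt T * \<bar>z\<bar>" for z
    using nonexpansive_gauss_bound[OF F T, of 0 z] unfolding X_def c_def by simp
  have expX: "exp (4 * \<bar>X z\<bar>) \<le> exp (4 * c) * exp (4 * sqrt T * \<bar>z\<bar>)" for z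
    using Xle[of z] by (simp flip: exp_add)
  have pow: "\<bar>X z\<bar> ^ n \<le> exp (real n * \<bar>X z\<bar>)" for z n
    using power_mono[OF abs_le_exp_abs[of "X z"], of n] by (simp add: exp_of_nat_mult)
  have iX2: "integrable std_normal_distribution (\<lambda>z. (X z)\<^sup>2)"
  proof (rule integrable_gaussI[where C="exp (4 * c)" and c="4 * sqrt T"])
    fix z
    have "\<bar>(X z)\<^sup>2\<bar> \<le> exp (2 * \<bar>X z\<bar>)" using pow[of z 2] by simp
    also have "\<dots> \<le> exp (4 * \<bar>X z\<bar>)" by simp
    finally show "\<bar>(X z)\<^sup>2\<bar> \<le> exp (4 * c) * exp (4 * sqrt T * \<bar>z\<bar>)" using expX[of z] by linarith
  qed measurable
  have "gauss_step p T F 0 \<le> G + p / 2 * V + K * p\<^sup>2" if p: "0 < p" "p \<le> 1" for p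
  proof -
    let ?g = "gauss_step p T F 0"
    have ieF: "integrable std_normal_distribution (\<lambda>z. exp (p * F (z * sqrt T)))"
      using nonexpansive_integrable_exp[OF F T, of p 0] by simp
    have "exp (p * (?g - G)) = exp (- (p * G)) * exp (p * ?g)" by (simp add: right_diff_distrib flip: exp_add)
    also have "exp (p * ?g) = gexp (\<lambda>z. exp (p * F (z * sqrt T)))"
      using exp_gauss_step[OF F T, of p 0] p by simp
    also have "exp (- (p * G)) * \<dots> = gexp (\<lambda>z. exp (- (p * G)) * exp (p * F (z * sqrt T)))" by simp
    also have "\<dots> \<le> gexp (\<lambda>z. (1 + p * X z) + (p\<^sup>2 / 2 * (X z)\<^sup>2 + p ^ 3 * (exp (4 * c) * exp (4 * sqrt T * \<bar>z\<bar>))))"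
    proof (rule gexp_mono)
      fix z
      have "exp (- (p * G)) * exp (p * F (z * sqrt T)) = exp (p * X z)" by (simp add: X_def right_diff_distrib flip: exp_add)
      also have "\<dots> \<le> 1 + p * X z + (p * X z)\<^sup>2 / 2 + \<bar>p * X z\<bar> ^ 3 * exp \<bar>p * X z\<bar>" by (rule exp_third_order_le)
      also have "\<bar>p * X z\<bar> ^ 3 * exp \<bar>p * X z\<bar> \<le> (p ^ 3 * exp (3 * \<bar>X z\<bar>)) * exp \<bar>X z\<bar>"
      proof (rule mult_mono)
        show "\<bar>p * X z\<bar> ^ 3 \<le> p ^ 3 * exp (3 * \<bar>X z\<bar>)"
          using pow[of z 3] p by (simp add: abs_mult power_mult_distrib mult_left_mono)
        show "exp \<bar>p * X z\<bar> \<le> exp \<bar>X z\<bar>" using p by (simp add: abs_mult mult_left_le_one_le)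
      qed (use p in auto)
      also have "(p ^ 3 * exp (3 * \<bar>X z\<bar>)) * exp \<bar>X z\<bar> = p ^ 3 * exp (4 * \<bar>X z\<bar>)" by (simp add: mult_exp_exp)
      also have "\<dots> \<le> p ^ 3 * (exp (4 * c) * exp (4 * sqrt T * \<bar>z\<bar>))"
        using expX[of z] p by (intro mult_left_mono) auto
      finally show "exp (- (p * G)) * exp (p * F (z * sqrt T)) \<le> (1 + p * X z) + (p\<^sup>2 / 2 * (X z)\<^sup>2 + p ^ 3 * (exp (4 * c) * exp (4 * sqrt T * \<bar>z\<bar>)))"
        by (simp add: power_mult_distrib)
    qed (intro Bochner_Integration.integrable_add integrable_mult_right integrable_gauss_const iX iX2 ieF integrable_exp_abs_gauss)+
    also have "\<dots> = gexp (\<lambda>z. 1 + p * X z) + gexp (\<lambda>z. p\<^sup>2 / 2 * (X z)\<^sup>2 + p ^ 3 * (exp (4 * c) * exp (4 * sqrt T * \<bar>z\<bar>)))"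
      by (intro Bochner_Integration.integral_add Bochner_Integration.integrable_add integrable_mult_right integrable_gauss_const iX iX2 integrable_exp_abs_gauss)
    also have "gexp (\<lambda>z. 1 + p * X z) = 1"
      by (subst Bochner_Integration.integral_add[OF integrable_gauss_const integrable_mult_right[OF iX]]) (simp add: EX)
    also have "gexp (\<lambda>z. p\<^sup>2 / 2 * (X z)\<^sup>2 + p ^ 3 * (exp (4 * c) * exp (4 * sqrt T * \<bar>z\<bar>))) = p\<^sup>2 / 2 * V + p ^ 3 * K"
      by (subst Bochner_Integration.integral_add) (auto intro!: integrable_mult_right iX2 integrable_exp_abs_gauss simp: V_def K_def)
    finally have "1 + p * (?g - G) \<le> 1 + (p\<^sup>2 / 2 * V + p ^ 3 * K)"
      using exp_ge_add_one_self[of "p * (?g - G)"] by linarith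
    then have "p * (?g - G) \<le> p * (p / 2 * V + K * p\<^sup>2)" by (simp add: power2_eq_square power3_eq_cube algebra_simps)
    then show ?thesis using p by simp
  qed
  then show ?thesis using that[of K] by (simp add: G_def V_def X_def)
qed

text \<open>Links the variance, centred at the mean, with the Poincare inequality, which centres
  \<open>F\<close> at its value at \<open>sqrt T\<close>, where the eigenfunction vanishes.\<close>

lemma gexp_variance_le:
  assumes F: "nonexpansive F" and T: "0 \<le> T"
  shows "gexp (\<lambda>z. (F (z * sqrt T) - gexp (\<lambda>z. F (z * sqrt T)))\<^sup>2) \<le> gexp (\<lambda>z. (F (z * sqrt T) - a)\<^sup>2)"
proof -
  let ?f = "\<lambda>z. F (z * sqrt T)"
  let ?m = "gexp ?f"
  have i1: "integrable std_normal_distribution ?f" using nonexpansive_integrable[OF F T, of 0] by simp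
  have i2: "integrable std_normal_distribution (\<lambda>z. (?f z)\<^sup>2)" using gexp_square_nonexpansive(3)[OF F T, of 0] by simp
  have *: "gexp (\<lambda>z. (?f z - b)\<^sup>2) = gexp (\<lambda>z. (?f z)\<^sup>2) - 2 * b * ?m + b\<^sup>2" for b
  proof -
    have "(?f z - b)\<^sup>2 = ((?f z)\<^sup>2 - 2 * b * ?f z) + b\<^sup>2" for z by (simp add: power2_eq_square algebra_simps)
    then have "gexp (\<lambda>z. (?f z - b)\<^sup>2) = gexp (\<lambda>z. (?f z)\<^sup>2 - 2 * b * ?f z) + gexp (\<lambda>z. b\<^sup>2)"
      by (simp only:) (intro Bochner_Integration.integral_add Bochner_Integration.integrable_diff integrable_mult_right i1 i2 integrable_gauss_const)
    also have "gexp (\<lambda>z. (?f z)\<^sup>2 - 2 * b * ?f z) = gexp (\<lambda>z. (?f z)\<^sup>2) - gexp (\<lambda>z. 2 * b * ?f z)"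
      by (intro Bochner_Integration.integral_diff integrable_mult_right i1 i2)
    finally show ?thesis by simp
  qed
  show ?thesis unfolding * using zero_le_power2[of "?m - a"] by (simp add: power2_eq_square algebra_simps)
qed

section \<open>First-order conditions for a minimizer\<close>

lemma integral_le_negative_piece:
  fixes f :: "real \<Rightarrow> real"
  assumes f: "(f has_integral I) {l..1}" and ab: "l \<le> a" "a \<le> b" "b \<le> 1"
    and neg: "\<And>s. l \<le> s \<Longrightarrow> s \<le> 1 \<Longrightarrow> f s \<le> 0" and piece: "\<And>s. a \<le> s \<Longrightarrow> s \<le> b \<Longrightarrow> f s \<le> - \<eta>"
  shows "I \<le> - \<eta> * (b - a)"
proof (rule has_integral_le[OF f])
  have "((\<lambda>s. - \<eta>) has_integral (b - a) *\<^sub>R (- \<eta>)) {a..b}"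
    using has_integral_const_real[of "- \<eta>" a b] ab by simp
  then have "((\<lambda>s. if s \<in> {a..b} then - \<eta> else 0) has_integral (b - a) *\<^sub>R (- \<eta>)) {l..1}"
    by (subst has_integral_restrict) (use ab in auto)
  then show "((\<lambda>s. if s \<in> {a..b} then - \<eta> else 0) has_integral - \<eta> * (b - a)) {l..1}" by (simp add: mult.commute)
qed (use neg piece in auto)

lemma gexp_deriv_square_bounds:
  assumes F: "F \<in> parisi_class" and G: "G \<in> parisi_class" and T: "0 \<le> T" and e: "0 < e" "\<And>x. \<bar>F x - G x\<bar> \<le> e"
  shows "gexp (\<lambda>z. (deriv F (z * sqrt T))\<^sup>2) \<le> gexp (\<lambda>z. (deriv G (z * sqrt T))\<^sup>2) + 4 * sqrt e"
proof -
  have i: "integrable std_normal_distribution (\<lambda>z. (deriv H (z * sqrt T))\<^sup>2)" if "H \<in> parisi_class" for H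
    using gexp_square_nonexpansive(3)[OF class_deriv_nonexpansive[OF that] T, of 0] by simp
  have "gexp (\<lambda>z. (deriv F (z * sqrt T))\<^sup>2) \<le> gexp (\<lambda>z. (deriv G (z * sqrt T))\<^sup>2 + 4 * sqrt e)"
  proof (rule gexp_mono)
    fix z
    let ?a = "deriv F (z * sqrt T)" and ?b = "deriv G (z * sqrt T)"
    have "?a\<^sup>2 - ?b\<^sup>2 \<le> \<bar>?a - ?b\<bar> * \<bar>?a + ?b\<bar>" by (simp add: power2_eq_square algebra_simps flip: abs_mult)
    also have "\<dots> \<le> (2 * sqrt e) * 2"
      using class_deriv_close[OF F G e] class_deriv_abs_le[OF F, of "z * sqrt T"] class_deriv_abs_le[OF G, of "z * sqrt T"] e(1)
      by (intro mult_mono) auto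
    finally show "?a\<^sup>2 \<le> ?b\<^sup>2 + 4 * sqrt e" by simp
  qed (intro i F G Bochner_Integration.integrable_add integrable_gauss_const)+
  also have "\<dots> = gexp (\<lambda>z. (deriv G (z * sqrt T))\<^sup>2) + gexp (\<lambda>z. 4 * sqrt e)"
    by (intro Bochner_Integration.integral_add i G integrable_gauss_const)
  finally show ?thesis by simp
qed

context mixture_function begin

lemma functional_diff:
  assumes "\<mu> \<in> unit_measures" "\<nu> \<in> unit_measures"
  shows "parisi_functional \<xi> \<nu> - parisi_functional \<xi> \<mu> = solution \<nu> 0 0 - solution \<mu> 0 0
    - (integral {0..1} (\<lambda>s. s * \<xi>2 s * unit_cdf \<nu> s) - integral {0..1} (\<lambda>s. s * \<xi>2 s * unit_cdf \<mu> s)) / 2"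
  by (simp add: parisi_functional_eq assms diff_divide_distrib)

text \<open>The common form of both competitor tests: an upper bound for the change of the solution
  and a lower bound for the change of the integral term are all that is needed.\<close>

lemma minimality_bound:
  assumes "\<mu> \<in> unit_measures" "\<nu> \<in> unit_measures" "parisi_functional \<xi> \<mu> \<le> parisi_functional \<xi> \<nu>"
    and X: "solution \<nu> 0 0 - solution \<mu> 0 0 \<le> X"
    and Y: "Y \<le> integral {0..1} (\<lambda>s. s * \<xi>2 s * unit_cdf \<nu> s) - integral {0..1} (\<lambda>s. s * \<xi>2 s * unit_cdf \<mu> s)"
  shows "Y / 2 \<le> X"
proof -
  let ?J = "integral {0..1} (\<lambda>s. s * \<xi>2 s * unit_cdf \<nu> s) - integral {0..1} (\<lambda>s. s * \<xi>2 s * unit_cdf \<mu> s)"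
  have arith: "J / 2 \<le> S" if "P - Q = S - J / 2" "Q \<le> P" for J P Q S :: real using that by linarith
  have "Y / 2 \<le> ?J / 2" using Y by (rule divide_right_mono) simp
  also have "\<dots> \<le> solution \<nu> 0 0 - solution \<mu> 0 0" by (rule arith[OF functional_diff[OF assms(1,2)] assms(3)])
  finally show ?thesis using X by (rule order_trans)
qed

lemma continuous_weight: "continuous_on {0..1} (\<lambda>s. s * \<xi>2 s)"
  by (intro continuous_intros \<xi>2_continuous)

text \<open>Collapsing [0, q) to 0 lifts the distribution function to the constant \<open>M\<close>
  below q and keeps it from q on. The functional changes by at most half the integral of (\<xi>'(s)
  - s) \<xi>''(s) times the lift, which is strictly negative if any mass was moved.\<close>

lemma no_mass_in_open_interval:
  assumes \<mu>: "\<mu> \<in> unit_measures" and min: "\<And>\<nu>. \<nu> \<in> unit_measures \<Longrightarrow> parisi_functional \<xi> \<mu> \<le> parisi_functional \<xi> \<nu>"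
    and q: "0 \<le> q" "q \<le> 1" "\<xi>2 q = 1" and lt1: "\<xi>2 0 < 1"
  shows "measure \<mu> {0..<q} = measure \<mu> {0}"
proof (rule ccontr)
  assume ne: "measure \<mu> {0..<q} \<noteq> measure \<mu> {0}"
  interpret prob_space \<mu> by (rule unit_prob[OF \<mu>])
  have q0: "0 < q" using q lt1 by (cases "q = 0") auto
  define M where "M = measure \<mu> {0..<q}"
  have "measure \<mu> {0} \<le> M" unfolding M_def using q q0 by (intro finite_measure_mono) (auto simp: unit_sets[OF \<mu>])
  with ne have lt: "measure \<mu> {0} < M" by (simp add: M_def)
  \<comment> \<open>Right-continuity at 0: some \<open>b > 0\<close> still has distribution function
    below \<open>M\<close>, so the lift is bounded away from zero on [0, b].\<close>
  have "(\<lambda>n. measure \<mu> {0..inverse (real (Suc n))}) \<longlonglongrightarrow> measure \<mu> (\<Inter>n. {0..inverse (real (Suc n))})"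
  proof (rule finite_Lim_measure_decseq)
    show "range (\<lambda>n. {0..inverse (real (Suc n))}) \<subseteq> sets \<mu>"
      by (auto simp: unit_sets[OF \<mu>] inverse_le_1_iff intro: order_trans)
    show "decseq (\<lambda>n. {0..inverse (real (Suc n))})"
      by (auto simp: decseq_def intro: order_trans le_imp_inverse_le)
  qed
  also have "(\<Inter>n. {0..inverse (real (Suc n))}) = {0}"
  proof safe
    fix x assume x: "x \<in> (\<Inter>n. {0..inverse (real (Suc n))})"
    have "0 \<le> x" using x by auto
    moreover have "x \<le> 0"
      by (rule LIMSEQ_le_const[OF LIMSEQ_inverse_real_of_nat]) (use x in auto)
    ultimately show "x = 0" by simp
  qed auto
  finally have "(\<lambda>n. measure \<mu> {0..inverse (real (Suc n))}) \<longlonglongrightarrow> measure \<mu> {0}" .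
  from order_tendstoD(2)[OF this lt] obtain n where n: "unit_cdf \<mu> (inverse (real (Suc n))) < M"
    unfolding unit_cdf_def eventually_sequentially by blast
  define b where "b = min (inverse (real (Suc n))) (q / 2)"
  have b: "0 < b" "b < q" "b \<le> 1" using q0 q by (auto simp: b_def)
  have cb: "unit_cdf \<mu> b < M"
    using unit_cdf_mono[OF \<mu>, of b "inverse (real (Suc n))"] n by (simp add: b_def inverse_le_1_iff)
  define \<nu> where "\<nu> = push (\<lambda>x. if x < q then 0 else x) \<mu>"
  have \<nu>: "\<nu> \<in> unit_measures" unfolding \<nu>_def by (rule push_unit[OF \<mu>]) auto
  have cdf\<nu>: "unit_cdf \<nu> s = (if s < q then M else unit_cdf \<mu> s)" if "0 \<le> s" "s \<le> 1" for s
  proof -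
    have "{x\<in>{0..1}. (if x < q then 0 else x) \<in> {0..s}} = (if s < q then {0..<q} else {0..s})"
      using that q by auto
    then show ?thesis unfolding unit_cdf_def \<nu>_def M_def
      by (subst measure_push[OF \<mu>]) (use that in auto)
  qed
  have cM: "unit_cdf \<mu> s \<le> M" if "s < q" for s
    unfolding unit_cdf_def M_def using that q by (intro finite_measure_mono) (auto simp: unit_sets[OF \<mu>])
  let ?\<Delta> = "\<lambda>s. unit_cdf \<nu> s - unit_cdf \<mu> s"
  have \<Delta>: "0 \<le> ?\<Delta> s" if "0 \<le> s" "s \<le> 1" for s using cdf\<nu>[OF that] cM[of s] by auto
  have w1: "continuous_on {0..1} (\<lambda>s. \<xi>2 s * \<xi>1 s)" by (intro continuous_intros \<xi>2_continuous \<xi>1_continuous)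
  note I = has_integral_diff[OF weight_diff_integral[OF \<mu> \<nu> order_refl w1] weight_diff_integral[OF \<mu> \<nu> order_refl continuous_weight]]
  define k where "k = (\<xi>2 0 + 1) / 2"
  have k: "k < 1" using lt1 by (simp add: k_def)
  \<comment> \<open>Product of lower bounds for s - \<xi>'(s), \<xi>''(s) and the lift on [b/2, b].
    The lower end stays away from 0, where the first factor vanishes and the second may.\<close>
  define \<eta> where "\<eta> = b / 2 * (1 - k) * \<xi>2 (b / 2) * (M - unit_cdf \<mu> b)"
  have \<eta>: "0 < \<eta>" unfolding \<eta>_def using b k cb \<xi>2_pos[of "b / 2"] by (intro mult_pos_pos) auto
  have x1: "s - \<xi>1 s \<ge> s * (1 - k)" if "0 \<le> s" "s < q" for s
    using \<xi>1_le[of s q] that q by (simp add: k_def algebra_simps)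
  have le: "\<xi>2 s * \<xi>1 s * ?\<Delta> s - s * \<xi>2 s * ?\<Delta> s = - ((s - \<xi>1 s) * \<xi>2 s * ?\<Delta> s)" for s by (simp add: algebra_simps)
  have "(integral {0..1} (\<lambda>s. \<xi>2 s * \<xi>1 s * unit_cdf \<nu> s) - integral {0..1} (\<lambda>s. \<xi>2 s * \<xi>1 s * unit_cdf \<mu> s)) -
     (integral {0..1} (\<lambda>s. s * \<xi>2 s * unit_cdf \<nu> s) - integral {0..1} (\<lambda>s. s * \<xi>2 s * unit_cdf \<mu> s)) \<le> - \<eta> * (b - b / 2)"
  proof (rule integral_le_negative_piece[OF I])
    fix s :: real assume s: "0 \<le> s" "s \<le> 1"
    show "\<xi>2 s * \<xi>1 s * ?\<Delta> s - s * \<xi>2 s * ?\<Delta> s \<le> 0"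
    proof (cases "s < q")
      case True
      have "0 \<le> s * (1 - k)" using s k by simp
      with x1[OF s(1) True] have "0 \<le> s - \<xi>1 s" by linarith
      then show ?thesis unfolding le using \<Delta>[OF s] \<xi>2_nonneg[OF s] by simp
    qed (use cdf\<nu>[OF s] in simp)
  next
    fix s :: real assume s: "b / 2 \<le> s" "s \<le> b"
    have s01: "0 \<le> s" "s \<le> 1" "s < q" using s b by auto
    have "b / 2 * (1 - k) \<le> s * (1 - k)" using s k by (intro mult_right_mono) auto
    then have 1: "b / 2 * (1 - k) \<le> s - \<xi>1 s" using x1[OF s01(1,3)] by linarith
    have 2: "\<xi>2 (b / 2) \<le> \<xi>2 s" using \<xi>2_mono[of "b / 2" s] s b by auto
    have 3: "M - unit_cdf \<mu> b \<le> ?\<Delta> s"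
      using cdf\<nu>[OF s01(1,2)] s01 unit_cdf_mono[OF \<mu> s(2) b(3)] by simp
    have "\<eta> \<le> (s - \<xi>1 s) * \<xi>2 s * ?\<Delta> s"
    proof -
      have p: "0 \<le> b / 2 * (1 - k)" "0 \<le> \<xi>2 (b / 2)" "0 \<le> M - unit_cdf \<mu> b"
        using b k cb \<xi>2_pos[of "b / 2"] by auto
      then have "0 \<le> s - \<xi>1 s" "0 \<le> \<xi>2 s" using 1 2 by linarith+
      with p show ?thesis unfolding \<eta>_def by (intro mult_mono 1 2 3 mult_nonneg_nonneg)
    qed
    then show "\<xi>2 s * \<xi>1 s * ?\<Delta> s - s * \<xi>2 s * ?\<Delta> s \<le> - \<eta>" unfolding le by simp
  qed (use b in auto)
  also have "\<dots> < 0" using \<eta> b by (simp add: mult_less_0_iff)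
  finally have "parisi_functional \<xi> \<nu> - parisi_functional \<xi> \<mu> < 0"
    using solution_le_of_cdf_le[OF \<mu> \<nu>] \<Delta> unfolding functional_diff[OF \<mu> \<nu>] by fastforce
  with min[OF \<nu>] show False by simp
qed

section \<open>Competitors that move mass near the bottom of the support\<close>

lemma weight_integral_ge:
  assumes c: "0 \<le> c" "c \<le> 1"
  shows "((\<lambda>s. s * \<xi>2 s) has_integral c * \<xi>1 c - \<xi> c) {0..c}" "c * \<xi>1 c / 2 \<le> c * \<xi>1 c - \<xi> c"
proof -
  have "((\<lambda>s. s * \<xi>2 s) has_integral (c * \<xi>1 c - \<xi> c) - (0 * \<xi>1 0 - \<xi> 0)) {0..c}"
  proof (rule fundamental_theorem_of_calculus[OF c(1)])
    fix s assume "s \<in> {0..c}"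
    then have s: "\<bar>s\<bar> < 2" using c by auto
    have "((\<lambda>s. s * \<xi>1 s - \<xi> s) has_real_derivative s * \<xi>2 s) (at s)"
      by (auto intro!: derivative_eq_intros \<xi>1_deriv[OF s] \<xi>_deriv[OF s])
    then show "((\<lambda>s. s * \<xi>1 s - \<xi> s) has_vector_derivative s * \<xi>2 s) (at s within {0..c})"
      by (simp add: has_real_derivative_iff_has_vector_derivative has_vector_derivative_at_within)
  qed
  then show "((\<lambda>s. s * \<xi>2 s) has_integral c * \<xi>1 c - \<xi> c) {0..c}" by (simp add: \<xi>_0)
  show "c * \<xi>1 c / 2 \<le> c * \<xi>1 c - \<xi> c" using \<xi>_le[OF c] by simp
qed

text \<open>The proportion \<open>e\<close> of the mass in [0, r] is sent to 0. To first order in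
  the new mass \<open>p\<close> near 0, the step over [0, c] gains p V/2, the change above c costs
  at most lip p (r - c), and the integral term takes off at least p c T/4. Division by
  \<open>p\<close> and e to 0 give the claim.\<close>

lemma move_mass_left:
  assumes \<mu>: "\<mu> \<in> unit_measures" and min: "\<And>\<nu>. \<nu> \<in> unit_measures \<Longrightarrow> parisi_functional \<xi> \<mu> \<le> parisi_functional \<xi> \<nu>"
    and c: "0 < c" "c \<le> r" "r \<le> 1" and zero: "\<And>s. 0 \<le> s \<Longrightarrow> s < c \<Longrightarrow> unit_cdf \<mu> s = 0" and pos: "0 < unit_cdf \<mu> r"
  defines "F \<equiv> solution \<mu> c" and "T \<equiv> \<xi>1 c"
  shows "c * T / 4 \<le> gexp (\<lambda>z. (F (z * sqrt T) - gexp (\<lambda>z. F (z * sqrt T)))\<^sup>2) / 2 + lip * (r - c)"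
proof -
  have c1: "c \<le> 1" using c by simp
  have T: "0 \<le> T" unfolding T_def using \<xi>1_nonneg[of c] c by simp
  have F: "F \<in> parisi_class" unfolding F_def by (rule solution_class[OF \<mu>]) (use c in auto)
  define V where "V = gexp (\<lambda>z. (F (z * sqrt T) - gexp (\<lambda>z. F (z * sqrt T)))\<^sup>2)"
  obtain K where K: "\<And>p. 0 < p \<Longrightarrow> p \<le> 1 \<Longrightarrow> gauss_step p T F 0 \<le> gexp (\<lambda>z. F (z * sqrt T)) + p / 2 * V + K * p\<^sup>2"
    using gauss_step_second_order[OF class_nonexpansive[OF F] T] unfolding V_def by metis
  define m where "m = unit_cdf \<mu> r"
  have m: "0 < m" "m \<le> 1" using pos unit_cdf_bounds[OF \<mu>, of r] by (auto simp: m_def)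
  have sol0: "solution \<mu> 0 0 = gexp (\<lambda>z. F (z * sqrt T))"
    using solution_step[OF \<mu> c(1) c1 zero, of 0] by (simp add: gauss_step_0 F_def T_def)
  let ?g = "\<lambda>x. if x \<le> r then 0 else x"
  have pu: "push ?g \<mu> \<in> unit_measures" by (rule push_unit[OF \<mu>]) auto
  have cdf_pu: "unit_cdf (push ?g \<mu>) s = unit_cdf \<mu> (max r s)" if "0 \<le> s" "s \<le> 1" for s
  proof -
    have "{x\<in>{0..1}. ?g x \<in> {0..s}} = {0..max r s}" using that c by auto
    then show ?thesis unfolding unit_cdf_def by (subst measure_push[OF \<mu>]) (use that in auto)
  qed
  have main: "c * T / 4 \<le> V / 2 + lip * (r - c) + K * (e * m)" if e: "0 < e" "e \<le> 1" for e
  proof -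
    obtain \<rho> where \<rho>: "\<rho> \<in> unit_measures" 
      and cdf\<rho>0: "\<And>u. unit_cdf \<rho> u = (1 - e) * unit_cdf \<mu> u + e * unit_cdf (push ?g \<mu>) u"
      by (rule convex_combination_measure[OF \<mu> pu, of e]) (use e in auto)
    have \<Delta>: "unit_cdf \<rho> s - unit_cdf \<mu> s = e * (unit_cdf \<mu> (max r s) - unit_cdf \<mu> s)" if "0 \<le> s" "s \<le> 1" for s
      unfolding cdf\<rho>0 cdf_pu[OF that] by (simp add: algebra_simps)
    have \<Delta>0: "0 \<le> unit_cdf \<rho> s - unit_cdf \<mu> s" if "0 \<le> s" "s \<le> 1" for s
      unfolding \<Delta>[OF that] using unit_cdf_mono[OF \<mu>, of s "max r s"] that c e by auto
    \<comment> \<open>The value of the new distribution function on [0, c), where the old one is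
      zero.\<close>
    define p where "p = e * m"
    have p: "0 < p" "p \<le> 1" using e m by (auto simp: p_def intro: mult_le_one)
    have cdf\<rho>: "unit_cdf \<rho> s = p" if "0 \<le> s" "s < c" for s
      using \<Delta>[of s] zero[OF that] that c by (simp add: p_def m_def max_def)
    have close: "solution \<rho> c x \<le> F x + lip * p * (r - c)" for x
    proof -
      have "integral {c..1} (\<lambda>s. \<bar>unit_cdf \<mu> s - unit_cdf \<rho> s\<bar>) \<le> p * (r - c)"
      proof (rule has_integral_le[OF integrable_integral[OF unit_integrable_abs_diff(2)[OF \<mu> \<rho>]]])
        have "((\<lambda>s. p) has_integral (r - c) *\<^sub>R p) {c..r}" using has_integral_const_real[of p c r] c by simp
        then have "((\<lambda>s. if s \<in> {c..r} then p else 0) has_integral (r - c) *\<^sub>R p) {c..1}"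
          by (subst has_integral_restrict) (use c in auto)
        then show "((\<lambda>s. if s \<in> {c..r} then p else 0) has_integral p * (r - c)) {c..1}" by (simp add: mult.commute)
        fix s assume s: "s \<in> {c..1}"
        have s01: "0 \<le> s" "s \<le> 1" using s c by auto
        have "unit_cdf \<rho> s - unit_cdf \<mu> s \<le> (if s \<in> {c..r} then p else 0)"
        proof (cases "s \<le> r")
          case True
          have "e * (m - unit_cdf \<mu> s) \<le> e * m" using e unit_cdf_bounds[OF \<mu>, of s] by (intro mult_left_mono) auto
          then show ?thesis unfolding \<Delta>[OF s01] using s True by (simp add: p_def m_def max_def)
        next
          case False
          then show ?thesis unfolding \<Delta>[OF s01] by (simp add: max_def)
        qed
        then show "\<bar>unit_cdf \<mu> s - unit_cdf \<rho> s\<bar> \<le> (if s \<in> {c..r} then p else 0)"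
          using \<Delta>0[OF s01] by linarith
      qed (use c in auto)
      then have "lip * integral {c..1} (\<lambda>s. \<bar>unit_cdf \<mu> s - unit_cdf \<rho> s\<bar>) \<le> lip * p * (r - c)"
        using mult_left_mono[OF _ lip_nonneg] by (simp add: mult.assoc)
      moreover have "\<bar>solution \<rho> c x - F x\<bar> \<le> lip * integral {c..1} (\<lambda>s. \<bar>unit_cdf \<mu> s - unit_cdf \<rho> s\<bar>)"
        unfolding F_def by (rule solution_lipschitz[OF \<mu> \<rho>]) (use c in auto)
      ultimately show ?thesis by linarith
    qed
    have "solution \<rho> 0 0 = gauss_step p T (solution \<rho> c) 0"
      unfolding T_def by (rule solution_step[OF \<rho> c(1) c1 cdf\<rho>])
    also have "\<dots> \<le> gauss_step p T F 0 + lip * p * (r - c)"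
      by (rule gauss_step_le[OF class_nonexpansive[OF solution_class[OF \<rho>]] class_nonexpansive[OF F] T])
        (use c p close in auto)
    also have "gauss_step p T F 0 \<le> solution \<mu> 0 0 + p / 2 * V + K * p\<^sup>2" unfolding sol0 by (rule K[OF p])
    finally have s1: "solution \<rho> 0 0 - solution \<mu> 0 0 \<le> p / 2 * V + K * p\<^sup>2 + lip * p * (r - c)" by simp
    have s2: "p * (c * T / 2) \<le> integral {0..1} (\<lambda>s. s * \<xi>2 s * unit_cdf \<rho> s) - integral {0..1} (\<lambda>s. s * \<xi>2 s * unit_cdf \<mu> s)"
    proof -
      have "p * (c * T / 2) \<le> p * (c * \<xi>1 c - \<xi> c)"
        unfolding T_def using weight_integral_ge(2)[of c] c p by (intro mult_left_mono) auto
      also have "\<dots> \<le> integral {0..1} (\<lambda>s. s * \<xi>2 s * unit_cdf \<rho> s) - integral {0..1} (\<lambda>s. s * \<xi>2 s * unit_cdf \<mu> s)"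
      proof (rule has_integral_le[OF _ weight_diff_integral[OF \<mu> \<rho> order_refl continuous_weight]])
        have "((\<lambda>s. p * (s * \<xi>2 s)) has_integral p * (c * \<xi>1 c - \<xi> c)) {0..c}"
          by (intro has_integral_mult_right weight_integral_ge(1)) (use c in auto)
        then have "((\<lambda>s. if s \<in> {0..c} then p * (s * \<xi>2 s) else 0) has_integral p * (c * \<xi>1 c - \<xi> c)) {0..1}"
          by (subst has_integral_restrict) (use c in auto)
        \<comment> \<open>The point c is dropped: \<mu> may have an atom there, and then the
          distribution function rises by less than \<open>p\<close>.\<close>
        then show "((\<lambda>s. if s < c then p * (s * \<xi>2 s) else 0) has_integral p * (c * \<xi>1 c - \<xi> c)) {0..1}"
          by (rule has_integral_spike_finite[of "{c}", rotated 2]) auto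
        fix s :: real assume s: "s \<in> {0..1}"
        show "(if s < c then p * (s * \<xi>2 s) else 0) \<le> s * \<xi>2 s * (unit_cdf \<rho> s - unit_cdf \<mu> s)"
          using s zero[of s] cdf\<rho>[of s] \<Delta>0[of s] \<xi>2_nonneg[of s] by (auto simp: mult_ac)
      qed
      finally show ?thesis .
    qed
    have "p * (c * T / 2) / 2 \<le> p / 2 * V + K * p\<^sup>2 + lip * p * (r - c)"
      by (rule minimality_bound[OF \<mu> \<rho> min[OF \<rho>] s1 s2])
    then have "p * (c * T / 4) \<le> p * (V / 2 + lip * (r - c) + K * p)"
      by (simp add: power2_eq_square algebra_simps)
    then have "c * T / 4 \<le> V / 2 + lip * (r - c) + K * p" using p(1) by (rule mult_left_le_imp_le)
    then show ?thesis by (simp add: p_def)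
  qed
  have "(\<lambda>n. V / 2 + lip * (r - c) + K * (inverse (real (Suc n)) * m)) \<longlonglongrightarrow> V / 2 + lip * (r - c) + K * (0 * m)"
    by (intro tendsto_intros LIMSEQ_inverse_real_of_nat)
  then have "c * T / 4 \<le> V / 2 + lip * (r - c) + K * (0 * m)"
    by (rule LIMSEQ_le_const) (use main in \<open>auto simp: inverse_le_1_iff simp del: of_nat_Suc\<close>)
  then show ?thesis by (simp add: V_def)
qed

text \<open>All mass below r is moved to r. Both distribution functions vanish on [0, c), so the
  same heat step is applied to both solutions and the comparison is only needed at time c. It yields
  A r <= A e with A < 0, hence e <= r for the competitor; the square-root term transfers this to
  \<mu>.\<close>

lemma move_mass_right:
  assumes \<mu>: "\<mu> \<in> unit_measures" and min: "\<And>\<nu>. \<nu> \<in> unit_measures \<Longrightarrow> parisi_functional \<xi> \<mu> \<le> parisi_functional \<xi> \<nu>"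
    and c: "0 < c" "c < r" "r \<le> 1" and zero: "\<And>s. 0 \<le> s \<Longrightarrow> s < c \<Longrightarrow> unit_cdf \<mu> s = 0" 
    and pos: "\<And>s. c < s \<Longrightarrow> s \<le> 1 \<Longrightarrow> 0 < unit_cdf \<mu> s"
  shows "gexp (\<lambda>z. (deriv (solution \<mu> c) (z * sqrt (\<xi>1 c)))\<^sup>2) \<le> r + 4 * sqrt ((lip + 1) * (r - c))"
proof -
  define T where "T = \<xi>1 c"
  have c1: "c \<le> 1" using c by simp
  have T: "0 \<le> T" unfolding T_def using \<xi>1_nonneg[of c] c by simp
  let ?g = "\<lambda>x. if x < r then r else x"
  define \<nu> where "\<nu> = push ?g \<mu>"
  have \<nu>: "\<nu> \<in> unit_measures" unfolding \<nu>_def by (rule push_unit[OF \<mu>]) (use c in auto)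
  have cdf\<nu>: "unit_cdf \<nu> s = (if s < r then 0 else unit_cdf \<mu> s)" if "0 \<le> s" "s \<le> 1" for s
  proof -
    have "{x\<in>{0..1}. ?g x \<in> {0..s}} = (if s < r then {} else {0..s})" using that c by auto
    then show ?thesis unfolding unit_cdf_def \<nu>_def by (subst measure_push[OF \<mu>]) (use that c in auto)
  qed
  let ?\<Delta> = "\<lambda>s. unit_cdf \<nu> s - unit_cdf \<mu> s"
  have \<Delta>: "?\<Delta> s \<le> 0" if "0 \<le> s" "s \<le> 1" for s
    using cdf\<nu>[OF that] unit_cdf_bounds[OF \<mu>, of s] by auto
  let ?F = "solution \<mu> c" and ?H = "solution \<nu> c"
  have F: "?F \<in> parisi_class" "?H \<in> parisi_class" using c by (auto intro!: solution_class \<mu> \<nu>)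
  define A where "A = integral {c..1} (\<lambda>s. \<xi>2 s * unit_cdf \<nu> s) - integral {c..1} (\<lambda>s. \<xi>2 s * unit_cdf \<mu> s)"
  define e where "e = gexp (\<lambda>z. (deriv ?H (z * sqrt T))\<^sup>2)"
  have IA: "((\<lambda>s. \<xi>2 s * ?\<Delta> s) has_integral A) {c..1}"
    unfolding A_def by (rule weight_diff_integral[OF \<mu> \<nu> _ \<xi>2_continuous]) (use c in simp)
  define a where "a = (c + r) / 2"
  have a: "c < a" "a < r" "0 \<le> a" "a \<le> 1" using c by (auto simp: a_def)
  \<comment> \<open>Strict negativity is what permits the division by \<open>A\<close>; it comes
    from the positive mass in every interval to the right of c.\<close>
  have A_neg: "A < 0"
  proof -
    have "A \<le> - (\<xi>2 a * unit_cdf \<mu> a) * ((a + r) / 2 - a)"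
    proof (rule integral_le_negative_piece[OF IA])
      fix s :: real assume "c \<le> s" "s \<le> 1"
      then show "\<xi>2 s * ?\<Delta> s \<le> 0" using \<Delta>[of s] \<xi>2_nonneg[of s] c by (simp add: mult_nonneg_nonpos)
    next
      fix s assume s: "a \<le> s" "s \<le> (a + r) / 2"
      have s01: "0 \<le> s" "s \<le> 1" "s < r" using s a c by auto
      have "\<xi>2 a * unit_cdf \<mu> a \<le> \<xi>2 s * unit_cdf \<mu> s"
        using \<xi>2_mono[OF a(3) s(1) s01(2)] unit_cdf_mono[OF \<mu> s(1) s01(2)] \<xi>2_nonneg[OF s01(1,2)] unit_cdf_bounds[OF \<mu>, of a]
        by (intro mult_mono) auto
      then show "\<xi>2 s * ?\<Delta> s \<le> - (\<xi>2 a * unit_cdf \<mu> a)" using cdf\<nu>[OF s01(1,2)] s01 by simp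
    qed (use a c in auto)
    also have "\<dots> < 0"
    proof -
      have "0 < \<xi>2 a * unit_cdf \<mu> a" using \<xi>2_pos[of a] pos[of a] a c by simp
      then show ?thesis using a by (simp add: mult_less_0_iff)
    qed
    finally show ?thesis .
  qed
  have i: "integrable std_normal_distribution (\<lambda>z. G (z * sqrt T))" if "G \<in> parisi_class" for G
    using nonexpansive_integrable[OF class_nonexpansive[OF that] T, of 0] by simp
  have i2: "integrable std_normal_distribution (\<lambda>z. (deriv ?H (z * sqrt T))\<^sup>2)"
    using gexp_square_nonexpansive(3)[OF class_deriv_nonexpansive[OF F(2)] T, of 0] by simp
  have "solution \<nu> 0 0 - solution \<mu> 0 0 = gexp (\<lambda>z. ?H (z * sqrt T)) - gexp (\<lambda>z. ?F (z * sqrt T))"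
    using solution_step[OF \<mu> c(1) c1 zero, of 0] solution_step[OF \<nu> c(1) c1, of 0 0] cdf\<nu> c 
    by (simp add: gauss_step_0 T_def)
  also have "\<dots> = gexp (\<lambda>z. ?H (z * sqrt T) - ?F (z * sqrt T))"
    by (intro Bochner_Integration.integral_diff[symmetric] i F)
  also have "\<dots> \<le> gexp (\<lambda>z. A / 2 * (deriv ?H (z * sqrt T))\<^sup>2)"
  proof (rule gexp_mono)
    show "?H (z * sqrt T) - ?F (z * sqrt T) \<le> A / 2 * (deriv ?H (z * sqrt T))\<^sup>2" for z
      unfolding A_def by (rule solution_le_of_cdf_ge[OF \<mu> \<nu>]) (use \<Delta> c in auto)
  qed (intro Bochner_Integration.integrable_diff integrable_mult_right i F i2)+
  also have "\<dots> = A / 2 * e" by (simp add: e_def)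
  finally have s1: "solution \<nu> 0 0 - solution \<mu> 0 0 \<le> A / 2 * e" .
  \<comment> \<open>A lower bound is wanted and the change is nonpositive, so the weight s is
    replaced by its upper bound r, valid wherever the distribution functions differ.\<close>
  have s2: "r * A \<le> integral {0..1} (\<lambda>s. s * \<xi>2 s * unit_cdf \<nu> s) - integral {0..1} (\<lambda>s. s * \<xi>2 s * unit_cdf \<mu> s)"
  proof (rule has_integral_le[OF _ weight_diff_integral[OF \<mu> \<nu> order_refl continuous_weight]])
    have "((\<lambda>s. r * (\<xi>2 s * ?\<Delta> s)) has_integral r * A) {c..1}" by (intro has_integral_mult_right IA)
    then show "((\<lambda>s. if s \<in> {c..1} then r * (\<xi>2 s * ?\<Delta> s) else 0) has_integral r * A) {0..1}"
      by (subst has_integral_restrict) (use c in auto)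
    fix s :: real assume s: "s \<in> {0..1}"
    show "(if s \<in> {c..1} then r * (\<xi>2 s * ?\<Delta> s) else 0) \<le> s * \<xi>2 s * ?\<Delta> s"
    proof (cases "s < c")
      case True
      then show ?thesis using cdf\<nu>[of s] zero[of s] s c by simp
    next
      case False
      show ?thesis
      proof (cases "s < r")
        case True
        have "\<xi>2 s * ?\<Delta> s \<le> 0" using \<Delta>[of s] \<xi>2_nonneg[of s] s by (simp add: mult_nonneg_nonpos)
        then have "r * (\<xi>2 s * ?\<Delta> s) \<le> s * (\<xi>2 s * ?\<Delta> s)" using True by (intro mult_right_mono_neg) auto
        then show ?thesis using False s by (simp add: mult.assoc)
      next
        case False
        then show ?thesis using cdf\<nu>[of s] s by simp
      qed
    qed
  qed
  have "A * r \<le> A * e"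
  proof -
    have "r * A / 2 \<le> A / 2 * e" by (rule minimality_bound[OF \<mu> \<nu> min[OF \<nu>] s1 s2])
    then show ?thesis by (simp add: mult.commute)
  qed
  then have er: "e \<le> r" using A_neg by simp
  have close: "\<bar>?F x - ?H x\<bar> \<le> (lip + 1) * (r - c)" for x
  proof -
    have "integral {c..1} (\<lambda>s. \<bar>unit_cdf \<mu> s - unit_cdf \<nu> s\<bar>) \<le> r - c"
    proof (rule has_integral_le[OF integrable_integral[OF unit_integrable_abs_diff(2)[OF \<mu> \<nu>]]])
      have "((\<lambda>s. 1 :: real) has_integral (r - c) *\<^sub>R 1) {c..r}" using has_integral_const_real[of "1 :: real" c r] c by simp
      then have "((\<lambda>s. if s \<in> {c..r} then 1 else 0 :: real) has_integral (r - c) *\<^sub>R 1) {c..1}"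
        by (subst has_integral_restrict) (use c in auto)
      then show "((\<lambda>s. if s \<in> {c..r} then 1 else 0) has_integral r - c) {c..1}" by simp
      fix s assume s: "s \<in> {c..1}"
      then show "\<bar>unit_cdf \<mu> s - unit_cdf \<nu> s\<bar> \<le> (if s \<in> {c..r} then 1 else 0)"
        using cdf\<nu>[of s] unit_cdf_bounds[OF \<mu>, of s] c by auto
    qed (use c in auto)
    then have "lip * integral {c..1} (\<lambda>s. \<bar>unit_cdf \<mu> s - unit_cdf \<nu> s\<bar>) \<le> lip * (r - c)"
      by (intro mult_left_mono lip_nonneg)
    moreover have "\<bar>?H x - ?F x\<bar> \<le> lip * integral {c..1} (\<lambda>s. \<bar>unit_cdf \<mu> s - unit_cdf \<nu> s\<bar>)"
      by (rule solution_lipschitz[OF \<mu> \<nu>]) (use c in auto)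
    ultimately show ?thesis using c by (simp add: algebra_simps abs_minus_commute)
  qed
  have "0 < (lip + 1) * (r - c)" using c lip_nonneg by simp
  from gexp_deriv_square_bounds[OF F T this close] er show ?thesis by (simp add: e_def T_def)
qed

lemma zero_in_support:
  assumes \<mu>: "\<mu> \<in> unit_measures" and min: "\<And>\<nu>. \<nu> \<in> unit_measures \<Longrightarrow> parisi_functional \<xi> \<mu> \<le> parisi_functional \<xi> \<nu>"
  shows "0 \<in> measure_support \<mu>"
proof (rule ccontr)
  assume not: "0 \<notin> measure_support \<mu>"
  interpret prob_space \<mu> by (rule unit_prob[OF \<mu>])
  obtain U where U: "open U" "0 \<in> U" "\<not> 0 < measure \<mu> (U \<inter> {0..1})"
    using not unfolding measure_support_def unit_space[OF \<mu>] by auto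
  obtain \<delta> where \<delta>: "0 < \<delta>" "ball 0 \<delta> \<subseteq> U" using U open_contains_ball by blast
  define d where "d = min (\<delta> / 2) 1"
  have d: "0 < d" "d \<le> 1" using \<delta> by (auto simp: d_def)
  have "{0..d} \<subseteq> U \<inter> {0..1}" using \<delta> d by (auto simp: d_def subset_iff ball_def dist_real_def)
  then have "measure \<mu> {0..d} \<le> measure \<mu> (U \<inter> {0..1})"
    by (rule finite_measure_mono) (use U in \<open>auto simp: unit_sets[OF \<mu>]\<close>)
  then have cd: "unit_cdf \<mu> d = 0" using U(3) measure_nonneg[of \<mu> "{0..d}"] unfolding unit_cdf_def by linarith
  define Z where "Z = {u\<in>{0..1}. unit_cdf \<mu> u = 0}"
  \<comment> \<open>The least point of the support. The distribution function at c itself may be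
    zero or not, so it is evaluated at r > c with r tending to c.\<close>
  define c where "c = Sup Z"
  have dZ: "d \<in> Z" using d cd by (simp add: Z_def)
  have bdd: "bdd_above Z" unfolding Z_def by (rule bdd_aboveI[of _ 1]) auto
  have c: "0 < c" "c \<le> 1" unfolding c_def
    using cSup_upper[OF dZ bdd] d dZ by (auto intro!: cSup_least simp: Z_def)
  have zero: "unit_cdf \<mu> s = 0" if "0 \<le> s" "s < c" for s
  proof -
    have "Z \<noteq> {}" using dZ by auto
    moreover have "s < Sup Z" using that(2) by (simp add: c_def)
    ultimately obtain z where z: "z \<in> Z" "s < z" using less_cSup_iff[OF _ bdd] by auto
    then have "unit_cdf \<mu> s \<le> unit_cdf \<mu> z" by (intro unit_cdf_mono[OF \<mu>]) (auto simp: Z_def)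
    then show ?thesis using z unit_cdf_bounds[OF \<mu>, of s] by (simp add: Z_def)
  qed
  have pos: "0 < unit_cdf \<mu> s" if "c < s" "s \<le> 1" for s
  proof (rule ccontr)
    assume "\<not> ?thesis"
    then have "s \<in> Z" using unit_cdf_bounds[OF \<mu>, of s] that c by (simp add: Z_def)
    then have "s \<le> c" unfolding c_def by (rule cSup_upper[OF _ bdd])
    then show False using that by simp
  qed
  define F where "F = solution \<mu> c"
  define T where "T = \<xi>1 c"
  have F: "F \<in> parisi_class" unfolding F_def by (rule solution_class[OF \<mu>]) (use c in auto)
  have T: "0 < T"
  proof -
    have "\<xi>1 (c / 2) < \<xi>1 c"
    proof (rule DERIV_pos_imp_increasing[where f=\<xi>1 and a="c / 2" and b=c])
      fix x assume "c / 2 \<le> x" "x \<le> c"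
      then show "\<exists>y. (\<xi>1 has_real_derivative y) (at x) \<and> 0 < y" using \<xi>1_deriv[of x] \<xi>2_pos[of x] c by auto
    qed (use c in simp)
    then show ?thesis using \<xi>1_nonneg[of "c / 2"] c by (simp add: T_def)
  qed
  define V where "V = gexp (\<lambda>z. (F (z * sqrt T) - gexp (\<lambda>z. F (z * sqrt T)))\<^sup>2)"
  define e where "e = gexp (\<lambda>z. (deriv F (z * sqrt T))\<^sup>2)"
  have left: "c * T / 4 \<le> V / 2 + lip * (r - c)" if "c \<le> r" "r \<le> 1" "0 < unit_cdf \<mu> r" for r
    using move_mass_left[OF \<mu> min c(1) that(1,2) zero that(3)] by (simp add: V_def F_def T_def)
  have cV: "c * T / 2 \<le> V"
  proof (cases "c = 1")
    \<comment> \<open>For c = 1 no r > c exists, but r = 1 is admissible because all mass lies in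
      [0, 1], and the error term is then zero.\<close>
    case True
    then show ?thesis using left[of 1] unit_cdf_1[OF \<mu>] by simp
  next
    case False
    let ?r = "\<lambda>n. c + (1 - c) * inverse (real (Suc n))"
    have "(\<lambda>n. V / 2 + lip * (?r n - c)) \<longlonglongrightarrow> V / 2 + lip * (c + (1 - c) * 0 - c)"
      by (intro tendsto_intros LIMSEQ_inverse_real_of_nat)
    then have "c * T / 4 \<le> V / 2 + lip * (c + (1 - c) * 0 - c)"
    proof (rule LIMSEQ_le_const, intro exI allI impI)
      fix n :: nat
      have r: "c < ?r n" using c False by simp
      have "(1 - c) * inverse (real (Suc n)) \<le> (1 - c) * 1" using c by (intro mult_left_mono) (auto simp: inverse_le_1_iff)
      then have "?r n \<le> 1" by simp
      then show "c * T / 4 \<le> V / 2 + lip * (?r n - c)" using r by (intro left pos) auto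
    qed
    then show ?thesis by (simp add: mult.commute)
  qed
  have Vle: "V \<le> gexp (\<lambda>z. (F (z * sqrt T) - F (sqrt T))\<^sup>2)"
    unfolding V_def by (rule gexp_variance_le[OF class_nonexpansive[OF F]]) (use T in simp)
  \<comment> \<open>The nondegeneracy required for strictness: a constant \<open>F\<close> would
    have variance zero, contradicting V >= c T/2 > 0.\<close>
  have "\<exists>x0. deriv F x0 \<noteq> 0"
  proof (rule ccontr)
    assume no: "\<nexists>x0. deriv F x0 \<noteq> 0"
    have "F x = F (sqrt T)" for x
      using class_tangent[OF F, of x "sqrt T"] class_tangent[OF F, of "sqrt T" x] no by simp
    then have "(\<lambda>z. (F (z * sqrt T) - F (sqrt T))\<^sup>2) = (\<lambda>z. 0)" by (intro ext) (metis cancel_comm_monoid_add_class.diff_cancel zero_power2)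
    then have "V \<le> 0" using Vle by simp
    then show False using cV c T by (smt (verit) divide_pos_pos mult_pos_pos)
  qed
  then obtain x0 where "deriv F x0 \<noteq> 0" by blast
  then have "c * T / 2 < T / 2 * e"
    using even_Poincare_strict[OF F T] Vle cV unfolding e_def by fastforce
  then have ce: "c < e" using T by (simp add: mult.commute)
  \<comment> \<open>Slopes are at most 1 in modulus, so c < e <= 1 leaves room to the right of c for
    the second competitor.\<close>
  have e1: "e \<le> 1"
  proof -
    have "e \<le> gexp (\<lambda>z. 1)" unfolding e_def
      using gexp_square_nonexpansive(3)[OF class_deriv_nonexpansive[OF F], of T 0] T
      by (intro gexp_mono class_deriv_square_le[OF F] integrable_gauss_const) auto
    then show ?thesis by simp
  qed
  have c1: "c < 1" using ce e1 by simp
  let ?r = "\<lambda>n. c + (1 - c) * inverse (real (Suc n))"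
  have "(\<lambda>n. ?r n + 4 * sqrt ((lip + 1) * (?r n - c))) \<longlonglongrightarrow> c + (1 - c) * 0 + 4 * sqrt ((lip + 1) * (c + (1 - c) * 0 - c))"
    by (intro tendsto_intros LIMSEQ_inverse_real_of_nat)
  then have "e \<le> c + (1 - c) * 0 + 4 * sqrt ((lip + 1) * (c + (1 - c) * 0 - c))"
  proof (rule LIMSEQ_le_const, intro exI allI impI)
    fix n :: nat
    have r: "c < ?r n" using c1 by simp
    have "(1 - c) * inverse (real (Suc n)) \<le> (1 - c) * 1" using c by (intro mult_left_mono) (auto simp: inverse_le_1_iff)
    then have r1: "?r n \<le> 1" by simp
    show "e \<le> ?r n + 4 * sqrt ((lip + 1) * (?r n - c))"
      unfolding e_def F_def T_def by (rule move_mass_right[OF \<mu> min c(1) r r1 zero pos])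
  qed
  then show False using ce by simp
qed

end

theorem theorem1:
  fixes \<beta> :: "nat \<Rightarrow> real" and \<xi> :: "real \<Rightarrow> real" and \<mu>\<^sub>P :: "real measure"
  assumes "summable (\<lambda>p. 2 ^ (p + 2) * (\<beta> (p + 2))\<^sup>2)"
    and "\<exists>p\<ge>2. \<beta> p \<noteq> 0"
    and "\<xi> = mixture \<beta>"
    and "parisi_measure \<xi> \<mu>\<^sub>P"
  shows "0 \<in> measure_support \<mu>\<^sub>P \<and>
    (deriv (deriv \<xi>) 0 < 1 \<longrightarrow>
      (\<forall>q\<in>{0..1}. deriv (deriv \<xi>) q = 1 \<longrightarrow> measure \<mu>\<^sub>P {0..<q} = measure \<mu>\<^sub>P {0}))"
proof -
  interpret mixture_function \<beta> \<xi> by unfold_locales (use assms in auto)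
  have \<mu>: "\<mu>\<^sub>P \<in> unit_measures" 
    and min: "\<And>\<nu>. \<nu> \<in> unit_measures \<Longrightarrow> parisi_functional \<xi> \<mu>\<^sub>P \<le> parisi_functional \<xi> \<nu>"
    using assms(4) unfolding parisi_measure_def is_arg_min_def by (auto simp: not_less)
  show ?thesis
    using zero_in_support[OF \<mu> min] no_mass_in_open_interval[OF \<mu> min] by auto
qed

end
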